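(* Let $\Gamma$ be a $\mathbb{Z}^d$-periodic graph with fixed nonzero $\mathbb{Z}^d$-periodic edge weight $E$ and fundamental domain $W=\{u_1,\dots,u_N\}$, $N\ge 2$, without self-loops and with connected quotient graph. Consider the conditions: (I) There exists a finite set $C\subset\mathbb{Z}^d$ such that $C_{ii}=C$ for every $i=1,\dots,N$; moreover, for any fixed $a\in C$, the edge weight $E((u_i,u_i+a))$ is independent of $i$. (II) For all distinct $i,j\in\{1,\dots,N\}$, $|C_{ij}|\le 1$. (III) (Given (II).) For any cycle $u_{i_1}\to u_{i_2}\to\cdots\to u_{i_m}\to u_{i_1}$ in the quotient graph, $\sum_{j=1}^m \alpha_{i_ji_{j+1}}=0$, where $\alpha_{i_ji_{j+1}}$ is the unique element of $C_{i_ji_{j+1}}$ and the indices $j$ are taken modulo $m$. Then the Bloch variety $\mathcal B_V$ is reducible for generic $V\in\mathbb{C}^N$ if and only if (I), (II) and (III) all hold. If any of these conditions fails, then $\mathcal B_V$ is irreducible for generic $V\in\mathbb{C}^N$.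
   Context: Let $d\ge 1$, $R=\mathbb{C}[z_1^{\pm1},\dots,z_d^{\pm1}]$, and $z^a=z_1^{a_1}\cdots z_d^{a_d}$ for $a\in\mathbb{Z}^d$. Periodic graphs. A $\mathbb{Z}^d$-periodic graph is a locally finite (undirected) graph $\Gamma=(\mathcal V,\mathcal E)$ with an action of $\mathbb{Z}^d$ on $\mathcal V$, written $u\mapsto u+a$, such that no nonzero $a\in\mathbb{Z}^d$ fixes a vertex, $(u,v)\in\mathcal E$ implies $(u+a,v+a)\in\mathcal E$ for all $a$, and $\mathcal V/\mathbb{Z}^d$ is finite. A fundamental domain is a set $W=\{u_1,\dots,u_N\}$ containing exactly one vertex of each $\mathbb{Z}^d$-orbit. A $\mathbb{Z}^d$-periodic edge weight is a function $E:\mathcal E\to\mathbb{C}$ with $E((u,v))=E((v,u))=E((u+a,v+a))$; it is assumed nowhere zero. $\Gamma$ is assumed to have no self-loops. For $i,j\in\{1,\dots,N\}$ let $C_{ij}=\{a\in\mathbb{Z}^d : (u_i,u_j+a)\in\mathcal E\}$ (so $0\notin C_{ii}$). The quotient graph is the finite graph with vertex set $W$ in which, for $i\ne j$, $u_i$ and $u_j$ are adjacent iff $C_{ij}\neq\varnothing$. It is assumed connected, and $N\ge2$. Floquet matrix. Let $l_{ij}(z)=\sum_{a\in C_{ij}}E((u_i,u_j+a))z^a\in R$. For a periodic potential, identified with $V=(v_1,\dots,v_N)\in\mathbb{C}^N$ ($v_i$ the value on the orbit of $u_i$), let $L(z,V)$ be the $N\times N$ matrix with entries $L(z,V)_{ij}=\delta_{ij}v_i+l_{ij}(z)$.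 The dispersion polynomial is $D(z,V,\lambda)=\det(\lambda I-L(z,V))$. For fixed $V$, the Bloch variety is the algebraic set $\mathcal B_V=\{(z,\lambda)\in(\mathbb{C}^* )^d\times\mathbb{C} : D(z,V,\lambda)=0\}$; reducible/irreducible is meant in the usual sense for algebraic sets. A property holds for generic $V\in\mathbb{C}^N$ if it holds for all $V$ in some nonempty Zariski open subset of $\mathbb{C}^N$. *)

theory Defs
  imports "HOL-Analysis.Analysis" "HOL-Library.Poly_Mapping"
begin

section \<open>Periodic graphs\<close>

text \<open>
  The group \<open>\<int>\<^sup>d\<close> is the type \<^typ>\<open>int ^ 'd\<close>, and \<open>act a x\<close> stands for the translate
  \<open>x + a\<close>. An undirected graph is a vertex set together with a symmetric set of ordered pairs.
\<close>

definition translates :: "(int ^ 'd::finite \<Rightarrow> 'v \<Rightarrow> 'v) \<Rightarrow> 'v \<Rightarrow> 'v set" where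
  "translates act x = range (\<lambda>a. act a x)"

locale periodic_graph =
  fixes act :: "int ^ 'd::finite \<Rightarrow> 'v \<Rightarrow> 'v"
    and verts :: "'v set"
    and edges :: "('v \<times> 'v) set"
  assumes edges_subset: "edges \<subseteq> verts \<times> verts"
    and edges_sym: "sym edges"
    and locally_finite: "\<And>x. x \<in> verts \<Longrightarrow> finite {y. (x, y) \<in> edges}"
    and act_closed: "\<And>a x. x \<in> verts \<Longrightarrow> act a x \<in> verts"
    and act_zero: "\<And>x. x \<in> verts \<Longrightarrow> act 0 x = x"
    and act_add: "\<And>a b x. x \<in> verts \<Longrightarrow> act (a + b) x = act a (act b x)"
    and act_free: "\<And>a x. x \<in> verts \<Longrightarrow> act a x = x \<Longrightarrow> a = 0"
    and act_edges: "\<And>a x y. (x, y) \<in> edges \<Longrightarrow> (act a x, act a y) \<in> edges"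
    and finite_quotient: "finite (translates act ` verts)"

definition no_self_loops :: "('v \<times> 'v) set \<Rightarrow> bool" where
  "no_self_loops edges \<longleftrightarrow> (\<forall>x. (x, x) \<notin> edges)"

text \<open>
  A fundamental domain \<open>W = {u\<^sub>1, \<dots>, u\<^sub>N}\<close> is given by its enumeration \<open>u\<close>, indexed by a finite
  type \<open>'n\<close>; thus \<open>N = CARD('n)\<close>.
\<close>

definition fundamental_domain ::
    "(int ^ 'd::finite \<Rightarrow> 'v \<Rightarrow> 'v) \<Rightarrow> 'v set \<Rightarrow> ('n::finite \<Rightarrow> 'v) \<Rightarrow> bool" where
  "fundamental_domain act verts u \<longleftrightarrow>
     inj u \<and> range u \<subseteq> verts \<and> (\<forall>x\<in>verts. \<exists>!w. w \<in> range u \<and> w \<in> translates act x)"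

definition periodic_edge_weight ::
    "(int ^ 'd::finite \<Rightarrow> 'v \<Rightarrow> 'v) \<Rightarrow> ('v \<times> 'v) set \<Rightarrow> ('v \<times> 'v \<Rightarrow> complex) \<Rightarrow> bool" where
  "periodic_edge_weight act edges E \<longleftrightarrow>
     (\<forall>(x, y)\<in>edges. E (x, y) = E (y, x) \<and> (\<forall>a. E (x, y) = E (act a x, act a y)))"

definition nowhere_zero_weight :: "('v \<times> 'v) set \<Rightarrow> ('v \<times> 'v \<Rightarrow> complex) \<Rightarrow> bool" where
  "nowhere_zero_weight edges E \<longleftrightarrow> (\<forall>e\<in>edges. E e \<noteq> 0)"

definition conn ::
    "(int ^ 'd::finite \<Rightarrow> 'v \<Rightarrow> 'v) \<Rightarrow> ('v \<times> 'v) set \<Rightarrow> ('n \<Rightarrow> 'v) \<Rightarrow> 'n \<Rightarrow> 'n \<Rightarrow> (int ^ 'd) set"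
  where
  "conn act edges u i j = {a. (u i, act a (u j)) \<in> edges}"

text \<open>The quotient graph has vertex set \<open>W\<close>, which is identified with the index type.\<close>

definition quotient_edges ::
    "(int ^ 'd::finite \<Rightarrow> 'v \<Rightarrow> 'v) \<Rightarrow> ('v \<times> 'v) set \<Rightarrow> ('n \<Rightarrow> 'v) \<Rightarrow> ('n \<times> 'n) set" where
  "quotient_edges act edges u = {(i, j). i \<noteq> j \<and> conn act edges u i j \<noteq> {}}"

definition quotient_connected ::
    "(int ^ 'd::finite \<Rightarrow> 'v \<Rightarrow> 'v) \<Rightarrow> ('v \<times> 'v) set \<Rightarrow> ('n \<Rightarrow> 'v) \<Rightarrow> bool" where
  "quotient_connected act edges u \<longleftrightarrow> (\<forall>i j. (i, j) \<in> (quotient_edges act edges u)\<^sup>*)"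

text \<open>
  A cycle is the list of its pairwise distinct vertices, at least three in number. (A closed walk
  \<open>i \<rightarrow> j \<rightarrow> i\<close> would add nothing to \<open>condition_III\<close> below, since \<open>C\<^sub>j\<^sub>i = - C\<^sub>i\<^sub>j\<close>.)
\<close>

definition is_cycle :: "('n \<times> 'n) set \<Rightarrow> 'n list \<Rightarrow> bool" where
  "is_cycle G c \<longleftrightarrow> 3 \<le> length c \<and> distinct c \<and>
     (\<forall>j<length c. (c ! j, c ! (Suc j mod length c)) \<in> G)"


section \<open>The conditions on the graph\<close>

definition condition_I ::
    "(int ^ 'd::finite \<Rightarrow> 'v \<Rightarrow> 'v) \<Rightarrow> ('v \<times> 'v) set \<Rightarrow> ('v \<times> 'v \<Rightarrow> complex) \<Rightarrow> ('n \<Rightarrow> 'v) \<Rightarrow> bool"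
  where
  "condition_I act edges E u \<longleftrightarrow>
     (\<exists>C. finite C \<and> (\<forall>i. conn act edges u i i = C) \<and>
        (\<forall>a\<in>C. \<forall>i j. E (u i, act a (u i)) = E (u j, act a (u j))))"

definition condition_II ::
    "(int ^ 'd::finite \<Rightarrow> 'v \<Rightarrow> 'v) \<Rightarrow> ('v \<times> 'v) set \<Rightarrow> ('n \<Rightarrow> 'v) \<Rightarrow> bool" where
  "condition_II act edges u \<longleftrightarrow>
     (\<forall>i j. i \<noteq> j \<longrightarrow> finite (conn act edges u i j) \<and> card (conn act edges u i j) \<le> 1)"

definition conn_elem ::
    "(int ^ 'd::finite \<Rightarrow> 'v \<Rightarrow> 'v) \<Rightarrow> ('v \<times> 'v) set \<Rightarrow> ('n \<Rightarrow> 'v) \<Rightarrow> 'n \<Rightarrow> 'n \<Rightarrow> int ^ 'd" where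
  "conn_elem act edges u i j = (THE a. a \<in> conn act edges u i j)"

text \<open>This condition is meaningful only together with \<open>condition_II\<close>.\<close>

definition condition_III ::
    "(int ^ 'd::finite \<Rightarrow> 'v \<Rightarrow> 'v) \<Rightarrow> ('v \<times> 'v) set \<Rightarrow> ('n \<Rightarrow> 'v) \<Rightarrow> bool" where
  "condition_III act edges u \<longleftrightarrow>
     (\<forall>c. is_cycle (quotient_edges act edges u) c \<longrightarrow>
        (\<Sum>j<length c. conn_elem act edges u (c ! j) (c ! (Suc j mod length c))) = 0)"


section \<open>Floquet matrix and Bloch variety\<close>

definition laurent_monom :: "complex ^ 'd::finite \<Rightarrow> int ^ 'd \<Rightarrow> complex" where
  "laurent_monom z a = (\<Prod>k\<in>UNIV. (z $ k) powi (a $ k))"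

definition floquet_entry ::
    "(int ^ 'd::finite \<Rightarrow> 'v \<Rightarrow> 'v) \<Rightarrow> ('v \<times> 'v) set \<Rightarrow> ('v \<times> 'v \<Rightarrow> complex) \<Rightarrow> ('n \<Rightarrow> 'v) \<Rightarrow>
     'n \<Rightarrow> 'n \<Rightarrow> complex ^ 'd \<Rightarrow> complex" where
  "floquet_entry act edges E u i j z =
     (\<Sum>a\<in>conn act edges u i j. E (u i, act a (u j)) * laurent_monom z a)"

definition floquet_matrix ::
    "(int ^ 'd::finite \<Rightarrow> 'v \<Rightarrow> 'v) \<Rightarrow> ('v \<times> 'v) set \<Rightarrow> ('v \<times> 'v \<Rightarrow> complex) \<Rightarrow>
     ('n::finite \<Rightarrow> 'v) \<Rightarrow> complex ^ 'd \<Rightarrow> complex ^ 'n \<Rightarrow> complex ^ 'n ^ 'n" where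
  "floquet_matrix act edges E u z V =
     (\<chi> i j. (if i = j then V $ i else 0) + floquet_entry act edges E u i j z)"

definition dispersion ::
    "(int ^ 'd::finite \<Rightarrow> 'v \<Rightarrow> 'v) \<Rightarrow> ('v \<times> 'v) set \<Rightarrow> ('v \<times> 'v \<Rightarrow> complex) \<Rightarrow>
     ('n::finite \<Rightarrow> 'v) \<Rightarrow> complex ^ 'd \<Rightarrow> complex ^ 'n \<Rightarrow> complex \<Rightarrow> complex" where
  "dispersion act edges E u z V x = det (mat x - floquet_matrix act edges E u z V)"

text \<open>The ambient space \<open>(\<complex>\<^sup>*)\<^sup>d \<times> \<complex>\<close>.\<close>

definition torus_line :: "((complex ^ 'd::finite) \<times> complex) set" where
  "torus_line = {z. \<forall>k. z $ k \<noteq> 0} \<times> UNIV"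

definition bloch_variety ::
    "(int ^ 'd::finite \<Rightarrow> 'v \<Rightarrow> 'v) \<Rightarrow> ('v \<times> 'v) set \<Rightarrow> ('v \<times> 'v \<Rightarrow> complex) \<Rightarrow>
     ('n::finite \<Rightarrow> 'v) \<Rightarrow> complex ^ 'n \<Rightarrow> ((complex ^ 'd) \<times> complex) set" where
  "bloch_variety act edges E u V =
     {(z, x). (z, x) \<in> torus_line \<and> dispersion act edges E u z V x = 0}"


section \<open>Algebraic sets and genericity\<close>

text \<open>
  The coordinate ring \<open>R[\<lambda>]\<close> of \<open>(\<complex>\<^sup>*)\<^sup>d \<times> \<complex>\<close>: an element is the finitely supported family of the
  coefficients of \<open>z\<^sup>a \<lambda>\<^sup>k\<close>, indexed by \<open>(a, k)\<close>.
\<close>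

definition eval_laurent ::
    "((int ^ 'd::finite) \<times> nat \<Rightarrow>\<^sub>0 complex) \<Rightarrow> (complex ^ 'd) \<times> complex \<Rightarrow> complex" where
  "eval_laurent f = (\<lambda>(z, x).
     \<Sum>(a, k)\<in>Poly_Mapping.keys f. Poly_Mapping.lookup f (a, k) * laurent_monom z a * x ^ k)"

definition algebraic_set :: "((complex ^ 'd::finite) \<times> complex) set \<Rightarrow> bool" where
  "algebraic_set X \<longleftrightarrow> (\<exists>S. X = {p \<in> torus_line. \<forall>f\<in>S. eval_laurent f p = 0})"

definition reducible_set :: "((complex ^ 'd::finite) \<times> complex) set \<Rightarrow> bool" where
  "reducible_set X \<longleftrightarrow>
     (\<exists>Y Z. algebraic_set Y \<and> algebraic_set Z \<and> Y \<subset> X \<and> Z \<subset> X \<and> X = Y \<union> Z)"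

definition irreducible_set :: "((complex ^ 'd::finite) \<times> complex) set \<Rightarrow> bool" where
  "irreducible_set X \<longleftrightarrow> algebraic_set X \<and> X \<noteq> {} \<and> \<not> reducible_set X"

text \<open>Polynomials on \<open>\<complex>\<^sup>N\<close> are likewise given by their coefficients, indexed by exponent vectors.\<close>

definition eval_poly :: "((nat ^ 'n::finite) \<Rightarrow>\<^sub>0 complex) \<Rightarrow> complex ^ 'n \<Rightarrow> complex" where
  "eval_poly f V =
     (\<Sum>m\<in>Poly_Mapping.keys f. Poly_Mapping.lookup f m * (\<Prod>i\<in>UNIV. (V $ i) ^ (m $ i)))"

definition zariski_open :: "(complex ^ 'n::finite) set \<Rightarrow> bool" where
  "zariski_open U \<longleftrightarrow> (\<exists>S. U = - {V. \<forall>f\<in>S. eval_poly f V = 0})"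

definition holds_generically :: "(complex ^ 'n::finite \<Rightarrow> bool) \<Rightarrow> bool" where
  "holds_generically P \<longleftrightarrow> (\<exists>U. zariski_open U \<and> U \<noteq> {} \<and> (\<forall>V\<in>U. P V))"

end

theory Submission
  imports Defs "HOL-Complex_Analysis.Great_Picard" "HOL-Computational_Algebra.Polynomial_Factorial"
    "HOL-Computational_Algebra.Field_as_Ring" "HOL-Computational_Algebra.Fundamental_Theorem_Algebra"
begin

text \<open>
  Restrict the Floquet matrix to a curve \<open>z\<^sub>k = c\<^sub>k s\<^bsup>w\<^sub>k\<^esup>\<close> in a generic direction \<open>w\<close> and multiply it by a
  power of \<open>s\<close>; its characteristic polynomial becomes a polynomial in \<open>s\<close> and \<open>x\<close>, monic in \<open>x\<close>. By
  Ruppert's criterion, irreducibility of such a polynomial is a rank condition on a linear system whose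
  coefficients are polynomials in \<open>V\<close> and \<open>c\<close>. Hence it suffices to find, whenever one of the conditions
  fails, a single potential for which the slice \<open>c = 1\<close> is irreducible: for \<open>c\<close> near \<open>1\<close> the slices are
  then irreducible as well, and they cover a neighbourhood in \<open>z\<close>, which is enough for the Bloch variety.

  The potential is found vertex by vertex. If one of the conditions fails, then it fails on two adjacent
  vertices or on an induced cycle. Letting the potential \<open>v\<close> of one vertex tend to infinity, the
  characteristic polynomial \<open>(x - l - v s\<^sup>M) F - Q\<close> becomes a monomial times the polynomial \<open>F\<close> of the
  remaining vertices. If it were reducible for all \<open>v\<close> and \<open>F\<close> is irreducible, then it would have a linear
  factor \<open>x - e\<^sub>v\<close> for which \<open>F(e\<^sub>v)\<close> divides a fixed polynomial in \<open>s\<close>; this makes the differences of the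
  \<open>e\<^sub>v\<close> monomials and forces \<open>F\<close> to be linear. Comparing coefficients in that case gives the claim for two
  vertices. For an induced cycle the characteristic polynomial is \<open>P(x) - b (s\<^sup>e + s\<^sup>-\<^sup>e)\<close>, and a similar
  limit contradicts the fact that \<open>x \<rightarrow> \<infinity>\<close> as \<open>s \<rightarrow> 0\<close> or \<open>s \<rightarrow> \<infinity>\<close>.

  If all conditions hold, conjugation by a diagonal matrix of monomials turns the Floquet matrix into
  \<open>p(z) I\<close> plus a constant matrix, so that the Bloch variety is a union of the graphs \<open>x = p(z) + \<mu>\<close>.
\<close>

section \<open>Polynomials in two variables\<close>

text \<open>Rank conditions are needed because reducibility is an existential statement about
  factors; only when it is expressed by equations can one irreducible example imply generic
  irreducibility. Irreducibility is meant in \<complex>[s][x] with x the outer variable: factors of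
  monic polynomials can be taken monic, so none depends on s alone, and multiplying the matrix by a
  power of s creates no spurious factor. On s \<noteq> 0 the polynomials without zeros are the
  monomials, which is why the limit arguments end in monomials. The direction w separates all
  exponents of the matrix, so that distinct Laurent monomials remain distinct on the curve, and it
  is not orthogonal to the total shift of an unbalanced cycle. Adjoining a vertex can destroy
  irreducibility for every potential only if the present polynomial is linear in x; the induction
  therefore cannot start from a single vertex and needs an irreducible block of at least
  two.\<close>

lemma monic_not_irreducible_factors:
  fixes D :: "'a::idom poly"
  assumes "lead_coeff D = 1" "degree D \<ge> 1" "\<not> irreducible D"
  obtains G H where "D = G * H" "lead_coeff G = 1" "lead_coeff H = 1" "degree G \<ge> 1" "degree H \<ge> 1"
proof -
  have D0: "D \<noteq> 0" using assms by auto
  have "\<not> D dvd 1" using assms(2) by (metis degree_1 degree_mult_eq dvdE le_zero_eq add_eq_0_iff_both_eq_0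
        mult_not_zero not_one_le_zero one_neq_zero)
  then obtain a b where ab: "D = a * b" "\<not> a dvd 1" "\<not> b dvd 1"
    using assms(3) D0 unfolding irreducible_def by auto
  have l: "lead_coeff a * lead_coeff b = 1" using assms(1) ab(1) by (simp add: lead_coeff_mult)
  have pos: "degree c \<ge> 1" if "\<not> c dvd 1" "lead_coeff c * d = 1" for c :: "'a poly" and d
  proof (rule ccontr)
    assume "\<not> degree c \<ge> 1"
    then obtain x where x: "c = [:x:]" by (metis degree_eq_zeroE less_one not_le)
    have "c * [:d:] = 1" using that(2) x by (simp add: one_pCons mult.commute)
    then show False using that(1) by (metis dvd_triv_left)
  qed
  define G where "G = smult (lead_coeff b) a"
  define H where "H = smult (lead_coeff a) b"
  have la: "lead_coeff a \<noteq> 0" "lead_coeff b \<noteq> 0" using l by auto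
  have "G * H = smult (lead_coeff a * lead_coeff b) (a * b)" by (simp add: G_def H_def mult.commute)
  then have 1: "D = G * H" using l ab by simp
  show ?thesis
    by (rule that[OF 1]) (use l la pos[OF ab(2) l] pos[OF ab(3)] in \<open>auto simp: G_def H_def mult.commute\<close>)
qed

text \<open>Plays the part of a resultant. Pseudo-division by an element \<open>m\<close> of least
  degree in the ideal of \<open>p\<close> and \<open>f\<close> shows that \<open>m\<close> divides
  nonzero scalar multiples of both; as \<open>p\<close> cannot divide \<open>m\<close>, the degree
  of \<open>m\<close> is 0. When \<open>r\<close> is a polynomial in \<open>s\<close>, the common
  zeros of \<open>p\<close> and \<open>f\<close> lie over finitely many \<open>s\<close>.\<close>

lemma bezout_irreducible:
  fixes p f :: "'a::{factorial_ring_gcd,semiring_gcd_mult_normalize} poly"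
  assumes irr: "irreducible p" and deg: "degree p \<ge> 1" and nd: "\<not> p dvd f"
  obtains u v r where "u * p + v * f = [:r:]" "r \<noteq> 0"
proof -
  define I where "I = {u * p + v * f | u v. True}"
  have I_add: "x - c * y \<in> I" if xy: "x \<in> I" "y \<in> I" for x y c
  proof -
    obtain u v u' v' where "x = u * p + v * f" "y = u' * p + v' * f" using xy unfolding I_def by blast
    then have "x - c * y = (u - c * u') * p + (v - c * v') * f" by (simp add: algebra_simps)
    then show ?thesis unfolding I_def by blast
  qed
  have pI: "p \<in> I" unfolding I_def by (rule CollectI, rule exI[of _ 1], rule exI[of _ 0]) simp
  have fI: "f \<in> I" unfolding I_def by (rule CollectI, rule exI[of _ 0], rule exI[of _ 1]) simp
  have I_sm: "smult c x \<in> I" if x: "x \<in> I" for x c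
  proof -
    obtain u v where "x = u * p + v * f" using x I_def by auto
    then have "smult c x = (smult c u) * p + (smult c v) * f" by (simp add: smult_add_right)
    then show ?thesis unfolding I_def by blast
  qed
  have p0: "p \<noteq> 0" using irr by auto
  have prime: "prime_elem p" using irr by (simp add: prime_elem_iff_irreducible)
  obtain m where m: "m \<in> I" "m \<noteq> 0" and min: "\<And>x. x \<in> I \<Longrightarrow> x \<noteq> 0 \<Longrightarrow> degree m \<le> degree x"
    using ex_has_least_nat[of "\<lambda>x. x \<in> I \<and> x \<noteq> 0" p degree] pI p0 by auto
  have div: "\<exists>a. a \<noteq> 0 \<and> m dvd smult a x" if "x \<in> I" for x
  proof -
    from pseudo_mod[OF m(2), of x] obtain a q where aq: "a \<noteq> 0" "smult a x = m * q + pseudo_mod x m"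
      and d: "pseudo_mod x m = 0 \<or> degree (pseudo_mod x m) < degree m" by auto
    have "pseudo_mod x m = smult a x - q * m" using aq by (simp add: mult.commute)
    then have "pseudo_mod x m \<in> I" using I_add[OF I_sm[OF that] m(1)] by metis
    then have "pseudo_mod x m = 0" using d min by fastforce
    then show ?thesis using aq by auto
  qed
  obtain a q where a: "a \<noteq> 0" "smult a p = m * q" using div[OF pI] by (auto elim!: dvdE)
  obtain b r where b: "b \<noteq> 0" "smult b f = m * r" using div[OF fI] by (auto elim!: dvdE)
  have nunit: "\<not> p dvd [:c:]" if "c \<noteq> 0" for c
    using deg that by (metis degree_pCons_0 dvd_imp_degree_le not_one_le_zero order_trans pCons_eq_0_iff)
  have "p dvd m * q" using a(2) by (metis dvd_refl dvd_smult)
  moreover have "\<not> p dvd m"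
  proof
    assume "p dvd m"
    then have "p dvd smult b f" using b(2) by simp
    then have "p dvd [:b:] * f" by simp
    then show False using prime nd nunit[OF b(1)] by (metis prime_elem_dvd_mult_iff)
  qed
  ultimately obtain q' where q': "q = p * q'" using prime by (metis prime_elem_dvd_mult_iff dvdE)
  have "p * (m * q') = p * [:a:]" using a(2) q' by (simp add: mult.commute mult.left_commute)
  then have mq: "m * q' = [:a:]" using p0 by (metis mult_left_cancel)
  then have "degree m = 0" using a(1) by (metis degree_mult_eq degree_pCons_0 add_is_0 mult_not_zero pCons_eq_0_iff)
  then obtain c where c: "m = [:c:]" by (metis degree_eq_zeroE)
  obtain u v where "m = u * p + v * f" using m(1) I_def by auto
  then have "u * p + v * f = [:c:]" "c \<noteq> 0" using c m(2) by auto
  then show ?thesis by (rule that)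
qed

lemma finite_monic_divisors:
  fixes r :: "complex poly"
  assumes "r \<noteq> 0"
  shows "finite {d. d dvd r \<and> lead_coeff d = 1}"
  using assms
proof (induction "degree r" arbitrary: r rule: less_induct)
  case less
  let ?S = "\<lambda>r::complex poly. {d. d dvd r \<and> lead_coeff d = 1}"
  have "?S r \<subseteq> {1} \<union> (\<Union>a\<in>{a. poly r a = 0}. (*) [:-a,1:] ` ?S (r div [:-a,1:]))"
  proof
    fix d assume "d \<in> ?S r"
    then have d: "d dvd r" "lead_coeff d = 1" by auto
    show "d \<in> {1} \<union> (\<Union>a\<in>{a. poly r a = 0}. (*) [:-a,1:] ` ?S (r div [:-a,1:]))"
    proof (cases "degree d = 0")
      case True
      then obtain c where "d = [:c:]" by (rule degree_eq_zeroE)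
      then show ?thesis using d by (simp add: one_pCons)
    next
      case False
      then obtain a where a: "poly d a = 0" using fundamental_theorem_of_algebra
        by (metis constant_degree)
      then obtain e where e: "d = [:-a,1:] * e" by (metis poly_eq_0_iff_dvd dvdE)
      obtain f where f: "r = d * f" using d by (auto elim: dvdE)
      have "r = [:-a,1:] * (e * f)" unfolding f e by (simp only: mult.assoc)
      then have "r div [:-a,1:] = e * f" by (metis nonzero_mult_div_cancel_left pCons_eq_0_iff one_neq_zero)
      moreover have "lead_coeff e = 1" using d(2) unfolding e lead_coeff_mult by simp
      ultimately have "e \<in> ?S (r div [:-a,1:])" by simp
      moreover have "poly r a = 0" using a f by simp
      ultimately show ?thesis unfolding e by (intro UnI2 UN_I[of a] imageI) auto
    qed
  qed
  moreover have "finite (?S (r div [:-a,1:]))" if ra: "poly r a = 0" for a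
  proof -
    obtain e where e: "r = [:-a,1:] * e" using ra by (metis poly_eq_0_iff_dvd dvdE)
    have e0: "e \<noteq> 0" using e less(2) by (metis mult_zero_right)
    have re: "r div [:-a,1:] = e" unfolding e by (metis nonzero_mult_div_cancel_left pCons_eq_0_iff one_neq_zero)
    have "degree r = degree [:-a,1:] + degree e" unfolding e by (rule degree_mult_eq) (use e0 in auto)
    then have "degree e < degree r" by simp
    then show ?thesis unfolding re using less(1) e0 by blast
  qed
  ultimately show ?case using poly_roots_finite[OF less(2)] by (auto intro: finite_subset)
qed

section \<open>Degree with respect to the inner variable\<close>

definition sdeg_le :: "nat \<Rightarrow> 'a::zero poly poly \<Rightarrow> bool" where
  "sdeg_le K p \<longleftrightarrow> (\<forall>i. degree (coeff p i) \<le> K)"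

lemma sdeg_le_mono: "sdeg_le K p \<Longrightarrow> K \<le> L \<Longrightarrow> sdeg_le L p"
  unfolding sdeg_le_def by (meson order_trans)

lemma sdeg_le_sum:
  fixes f :: "'b \<Rightarrow> 'a::comm_monoid_add poly poly"
  assumes "\<And>x. x \<in> A \<Longrightarrow> sdeg_le K (f x)"
  shows "sdeg_le K (sum f A)"
proof (cases "finite A")
  case True
  then show ?thesis using assms unfolding sdeg_le_def coeff_sum by (intro allI degree_sum_le) auto
qed (simp add: sdeg_le_def)

lemma sdeg_le_mult:
  fixes p q :: "'a::comm_semiring_0 poly poly"
  assumes "sdeg_le K p" "sdeg_le L q"
  shows "sdeg_le (K + L) (p * q)"
  unfolding sdeg_le_def coeff_mult
  by (intro allI degree_sum_le) (use assms in \<open>auto simp: sdeg_le_def intro!: order_trans[OF degree_mult_le] add_mono\<close>)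

lemma sdeg_le_prod:
  fixes f :: "'b \<Rightarrow> 'a::comm_semiring_1 poly poly"
  assumes "finite A" "\<And>x. x \<in> A \<Longrightarrow> sdeg_le K (f x)"
  shows "sdeg_le (card A * K) (prod f A)"
  using assms
proof (induction A rule: finite_induct)
  case empty then show ?case by (simp add: sdeg_le_def one_pCons coeff_pCons split: nat.split)
next
  case (insert x A)
  then show ?case using sdeg_le_mult[of K "f x" "card A * K" "prod f A"] by simp
qed

text \<open>In a domain the inner degree is additive: in each factor take the largest index whose
  coefficient attains the maximal inner degree; at the sum of these indices the product receives
  only one contribution of top degree. This bounds unknown factors uniformly in terms of the
  product.\<close>

lemma sdeg_le_factor:
  fixes G H :: "'a::idom poly poly"
  assumes "sdeg_le K (G * H)" "H \<noteq> 0"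
  shows "sdeg_le K G"
proof (cases "G = 0")
  case True then show ?thesis by (simp add: sdeg_le_def)
next
  case False
  define s where "s p = Max ((\<lambda>i. degree (coeff p i)) ` {..degree p})" for p :: "'a poly poly"
  have s_ge: "degree (coeff p i) \<le> s p" for p i
  proof (cases "i \<le> degree p")
    case True then show ?thesis unfolding s_def by (intro Max_ge) auto
  next
    case False then show ?thesis by (simp add: coeff_eq_0)
  qed
  have ex: "\<exists>i. coeff p i \<noteq> 0 \<and> degree (coeff p i) = s p \<and> (\<forall>j>i. coeff p j = 0 \<or> degree (coeff p j) < s p)"
    if "p \<noteq> 0" for p
  proof -
    let ?S = "{i. coeff p i \<noteq> 0 \<and> degree (coeff p i) = s p}"
    have "s p \<in> (\<lambda>i. degree (coeff p i)) ` {..degree p}" unfolding s_def by (intro Max_in) auto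
    then obtain i where i: "s p = degree (coeff p i)" by auto
    have ne: "?S \<noteq> {}"
    proof (cases "coeff p i = 0")
      case True
      then have "s p = 0" using i by simp
      then have "degree (lead_coeff p) = s p" using s_ge[of p "degree p"] by simp
      then have "degree p \<in> ?S" using that by simp
      then show ?thesis by blast
    next
      case False then show ?thesis using i by auto
    qed
    have fin: "finite ?S" by (rule finite_subset[of _ "{..degree p}"]) (auto intro: le_degree)
    have "Max ?S \<in> ?S" using fin ne by (rule Max_in)
    moreover have "coeff p j = 0 \<or> degree (coeff p j) < s p" if "j > Max ?S" for j
      using that fin s_ge[of p j] Max_ge[OF fin, of j] by fastforce
    ultimately show ?thesis by blast
  qed
  obtain i where i: "coeff G i \<noteq> 0" "degree (coeff G i) = s G" "\<forall>j>i. coeff G j = 0 \<or> degree (coeff G j) < s G"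
    using ex[OF False] by blast
  obtain j where j: "coeff H j \<noteq> 0" "degree (coeff H j) = s H" "\<forall>k>j. coeff H k = 0 \<or> degree (coeff H k) < s H"
    using ex[OF assms(2)] by blast
  have "coeff (coeff (G * H) (i + j)) (s G + s H) =
      (\<Sum>k\<le>i+j. coeff (coeff G k * coeff H (i + j - k)) (s G + s H))"
    by (simp add: coeff_mult coeff_sum)
  also have "\<dots> = (\<Sum>k\<in>{i}. coeff (coeff G k * coeff H (i + j - k)) (s G + s H))"
  proof (rule sum.mono_neutral_right)
    show "\<forall>k\<in>{..i+j} - {i}. coeff (coeff G k * coeff H (i + j - k)) (s G + s H) = 0"
    proof
      fix k assume k: "k \<in> {..i+j} - {i}"
      show "coeff (coeff G k * coeff H (i + j - k)) (s G + s H) = 0"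
      proof (cases "coeff G k = 0 \<or> coeff H (i + j - k) = 0")
        case True then show ?thesis by auto
      next
        case F: False
        have "degree (coeff G k) + degree (coeff H (i+j-k)) < s G + s H"
        proof (cases "k > i")
          case True then show ?thesis using i(3) F s_ge[of H "i+j-k"] by (metis add_less_le_mono)
        next
          case False
          then have "i + j - k > j" using k by auto
          then show ?thesis using j(3) F s_ge[of G k] by (metis add_le_less_mono)
        qed
        then show ?thesis by (intro coeff_eq_0) (use degree_mult_le le_less_trans in blast)
      qed
    qed
  qed auto
  also have "\<dots> = lead_coeff (coeff G i) * lead_coeff (coeff H j)"
    using i j by (simp add: coeff_mult_degree_sum flip: i(2) j(2))
  also have "\<dots> \<noteq> 0" using i(1) j(1) leading_coeff_0_iff mult_eq_0_iff by metis
  finally have "s G + s H \<le> degree (coeff (G * H) (i + j))" by (rule le_degree)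
  also have "\<dots> \<le> K" using assms(1) by (simp add: sdeg_le_def)
  finally show ?thesis using s_ge[of G] unfolding sdeg_le_def by (meson add_leE order_trans)
qed

section \<open>Evaluation, with \<open>s\<close> for the inner and \<open>x\<close> for the outer
  variable\<close>

definition eval2 :: "'a::comm_ring_1 poly poly \<Rightarrow> 'a \<Rightarrow> 'a \<Rightarrow> 'a" where
  "eval2 p s x = poly (poly p [:x:]) s"

lemma eval2_simps [simp]:
  "eval2 (p + q) s x = eval2 p s x + eval2 q s x"
  "eval2 (p - q) s x = eval2 p s x - eval2 q s x"
  "eval2 (- p) s x = - eval2 p s x"
  "eval2 (p * q) s x = eval2 p s x * eval2 q s x"
  "eval2 (p ^ n) s x = eval2 p s x ^ n"
  "eval2 (smult c p) s x = poly c s * eval2 p s x"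
  "eval2 [:c:] s x = poly c s"
  "eval2 (pCons c p) s x = poly c s + x * eval2 p s x"
  "eval2 0 s x = 0" "eval2 1 s x = 1"
  by (simp_all add: eval2_def poly_power)

lemma eval2_sum: "eval2 (sum f A) s x = (\<Sum>i\<in>A. eval2 (f i) s x)"
  by (simp add: eval2_def poly_sum)

lemma eval2_prod: "eval2 (prod f A) s x = (\<Prod>i\<in>A. eval2 (f i) s x)"
  by (simp add: eval2_def poly_prod)

lemma eval2_map_poly: "eval2 p s x = poly (map_poly (\<lambda>c. poly c s) p) x"
  by (induction p) (auto simp: map_poly_pCons)

lemma degree_map_poly_eval_monic:
  assumes "lead_coeff p = 1"
  shows "degree (map_poly (\<lambda>c. poly c s) p) = degree p" "lead_coeff (map_poly (\<lambda>c. poly c s) p) = 1"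
proof -
  have "coeff (map_poly (\<lambda>c. poly c s) p) (degree p) \<noteq> 0" using assms by (simp add: coeff_map_poly)
  then show d: "degree (map_poly (\<lambda>c. poly c s) p) = degree p"
    by (intro antisym degree_le le_degree) (auto simp: coeff_map_poly coeff_eq_0)
  show "lead_coeff (map_poly (\<lambda>c. poly c s) p) = 1" unfolding d using assms by (simp add: coeff_map_poly)
qed

text \<open>Only \<open>s \<noteq> 0\<close> is required because the identities to be compared
  involve inverse powers of \<open>s\<close>; the coefficients in \<open>x\<close> agree at
  infinitely many \<open>s\<close>.\<close>

lemma eval2_eq_imp_eq:
  fixes p q :: "complex poly poly"
  assumes "\<And>s x. s \<noteq> 0 \<Longrightarrow> eval2 p s x = eval2 q s x"
  shows "p = q"
proof (rule poly_eqI)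
  fix n
  have "poly (coeff p n) s = poly (coeff q n) s" if "s \<noteq> 0" for s
  proof -
    have "poly (map_poly (\<lambda>c. poly c s) p) = poly (map_poly (\<lambda>c. poly c s) q)"
      using assms[OF that] by (auto simp: eval2_map_poly)
    then have "map_poly (\<lambda>c. poly c s) p = map_poly (\<lambda>c. poly c s) q" by (simp add: poly_eq_poly_eq_iff)
    then have "coeff (map_poly (\<lambda>c. poly c s) p) n = coeff (map_poly (\<lambda>c. poly c s) q) n" by simp
    then show ?thesis by (simp add: coeff_map_poly)
  qed
  then have "UNIV - {0} \<subseteq> {s. poly (coeff p n - coeff q n) s = 0}" by auto
  moreover have "infinite (UNIV - {0::complex})" by (simp add: infinite_UNIV_char_0)
  ultimately have "infinite {s. poly (coeff p n - coeff q n) s = 0}" by (meson finite_subset)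
  then show "coeff p n = coeff q n" by (metis poly_roots_finite eq_iff_diff_eq_0)
qed

section \<open>Closed differential forms\<close>

definition pderiv_inner :: "complex poly poly \<Rightarrow> complex poly poly" where
  "pderiv_inner p = map_poly pderiv p"

lemma coeff_pderiv_inner [simp]: "coeff (pderiv_inner p) n = pderiv (coeff p n)"
  by (simp add: pderiv_inner_def coeff_map_poly)

lemma pderiv_inner_simps:
  "pderiv_inner (p + q) = pderiv_inner p + pderiv_inner q"
  "pderiv_inner (p - q) = pderiv_inner p - pderiv_inner q"
  "pderiv_inner (p * q) = pderiv_inner p * q + p * pderiv_inner q"
  "pderiv_inner [:c:] = [:pderiv c:]"
  "pderiv_inner 0 = 0"
  "pderiv_inner (smult [:a:] p) = smult [:a:] (pderiv_inner p)"
  "pderiv (pderiv_inner p) = pderiv_inner (pderiv p)"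
proof -
  have sumd: "pderiv (\<Sum>i\<in>A. f i) = (\<Sum>i\<in>A. pderiv (f i))" for f :: "nat \<Rightarrow> complex poly" and A
    by (induction A rule: infinite_finite_induct) (auto simp: pderiv_add)
  show "pderiv_inner (p * q) = pderiv_inner p * q + p * pderiv_inner q"
    by (rule poly_eqI, unfold coeff_add coeff_mult coeff_pderiv_inner sumd pderiv_mult sum.distrib)
       (simp add: mult.commute add.commute)
  show "pderiv (pderiv_inner p) = pderiv_inner (pderiv p)"
    by (rule poly_eqI) (simp add: coeff_pderiv pderiv_mult flip: of_nat_Suc)
qed (auto intro!: poly_eqI simp: pderiv_add pderiv_diff pderiv_smult coeff_pCons split: nat.splits)

text \<open>The Jacobian determinant of \<open>X\<close> and \<open>D\<close> in
  \<open>(s, x)\<close>, that is, the derivation along the vector field tangent to the level curves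
  of \<open>D\<close>. It kills \<open>D\<close>, so it acts on functions on the curve
  \<open>D = 0\<close>.\<close>

definition delta :: "complex poly poly \<Rightarrow> complex poly poly \<Rightarrow> complex poly poly" where
  "delta D X = pderiv_inner X * pderiv D - pderiv X * pderiv_inner D"

lemma delta_add: "delta D (X + Y) = delta D X + delta D Y"
  and delta_mult: "delta D (X * Y) = delta D X * Y + X * delta D Y"
  and delta_self: "delta D D = 0"
  by (simp_all add: delta_def pderiv_inner_simps pderiv_add pderiv_mult algebra_simps)

text \<open>Order of vanishing along the curve \<open>D = 0\<close> at a point, measured by iterated
  tangential derivatives. This takes the place of power series expansions and rests on the Leibniz
  rule alone.\<close>

primrec vanishes :: "complex poly poly \<Rightarrow> complex \<Rightarrow> complex \<Rightarrow> nat \<Rightarrow> complex poly poly \<Rightarrow> bool" where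
  "vanishes D s x 0 X = True"
| "vanishes D s x (Suc n) X = (eval2 X s x = 0 \<and> vanishes D s x n (delta D X))"

lemma vanishes_Suc: "vanishes D s x (Suc n) X \<Longrightarrow> vanishes D s x n X"
  by (induction n arbitrary: X) auto

lemma vanishes_add: "vanishes D s x n X \<Longrightarrow> vanishes D s x n Y \<Longrightarrow> vanishes D s x n (X + Y)"
  by (induction n arbitrary: X Y) (auto simp: delta_add)

lemma vanishes_mult: "vanishes D s x n X \<Longrightarrow> vanishes D s x n (X * Y)"
proof (induction n arbitrary: X Y)
  case (Suc n)
  then show ?case using vanishes_Suc[OF Suc.prems]
    by (auto simp: delta_mult intro!: vanishes_add)
qed simp

lemma vanishes_zero: "vanishes D s x n 0"
  by (induction n) (auto simp: delta_def pderiv_inner_simps)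

lemma vanishes_uminus: "vanishes D s x n X \<Longrightarrow> vanishes D s x n (- X)"
  using vanishes_mult[of D s x n X "-1"] by simp

lemma vanishes_cancel:
  "vanishes D s x n (X * Y) \<Longrightarrow> eval2 Y s x \<noteq> 0 \<Longrightarrow> vanishes D s x n X"
proof (induction n arbitrary: X)
  case (Suc n)
  have 1: "vanishes D s x n X" using Suc vanishes_Suc by blast
  have "vanishes D s x n (delta D X * Y + X * delta D Y)" using Suc.prems by (simp add: delta_mult)
  moreover have "vanishes D s x n (- (X * delta D Y))" by (intro vanishes_uminus vanishes_mult 1)
  ultimately have "vanishes D s x n (delta D X * Y + X * delta D Y + - (X * delta D Y))" by (rule vanishes_add)
  then have "vanishes D s x n (delta D X)" using Suc by simp
  then show ?case using Suc.prems by simp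
qed simp

lemma vanishes_self: "eval2 D s x = 0 \<Longrightarrow> vanishes D s x n D"
  by (cases n) (auto simp: delta_self vanishes_zero)

text \<open>Where \<open>pderiv D\<close> is nonzero, the inner variable is a local parameter of the
  curve: \<open>delta D\<close> lowers the exponent by one, up to a factor that is nonzero at the
  point.\<close>

lemma not_vanishes_power:
  assumes "eval2 (pderiv D) s x \<noteq> 0"
  shows "\<not> vanishes D s x (Suc k) [:[:-s,1:] ^ k:]"
proof (induction k)
  case (Suc k)
  show ?case
  proof
    assume "vanishes D s x (Suc (Suc k)) [:[:-s,1:] ^ Suc k:]"
    then have "vanishes D s x (Suc k) (delta D [:[:-s,1:] ^ Suc k:])" by simp
    moreover have "delta D [:[:-s,1:] ^ Suc k:] = [:[:-s,1:] ^ k:] * ([:of_nat (Suc k):] * pderiv D)"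
      unfolding delta_def pderiv_inner_simps pderiv_power_Suc of_nat_poly[of "Suc k", where 'a="complex"]
      by (simp add: pderiv_pCons mult.commute del: of_nat_Suc)
    ultimately have "vanishes D s x (Suc k) [:[:-s,1:] ^ k:]"
      by (rule_tac vanishes_cancel[where Y = "[:of_nat (Suc k):] * pderiv D"]) (use assms in \<open>simp_all del: of_nat_Suc vanishes.simps\<close>)
    then show False using Suc by blast
  qed
qed simp

lemma not_vanishes_const:
  assumes "eval2 (pderiv D) s x \<noteq> 0" "r \<noteq> 0"
  shows "\<exists>n. \<not> vanishes D s x n [:r:]"
proof -
  obtain k q where q: "r = [:-s,1:] ^ k * q" "\<not> [:-s,1:] dvd q" using order_decomp[OF assms(2)] by blast
  have "poly q s \<noteq> 0" using q by (simp add: poly_eq_0_iff_dvd)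
  moreover have "[:r:] = [:[:-s,1:] ^ k:] * [:q:]" using q(1) by (simp add: mult.commute)
  ultimately show ?thesis using vanishes_cancel[where Y = "[:q:]"] not_vanishes_power[OF assms(1)]
    by (metis eval2_simps(7))
qed

text \<open>This is \<open>D\<^sup>2\<close> times \<open>(A / D)\<^sub>s - (B / D)\<^sub>x\<close>,
  so it vanishes iff the form (A dx + B ds) / D is closed. The choice \<open>A = pderiv D\<close>,
  \<open>B = pderiv_inner D\<close> is the logarithmic differential of \<open>D\<close>.\<close>

definition closed_form :: "complex poly poly \<Rightarrow> complex poly poly \<Rightarrow> complex poly poly \<Rightarrow> complex poly poly" where
  "closed_form D A B = D * (pderiv_inner A - pderiv B) - (A * pderiv_inner D - B * pderiv D)"

lemma closed_form_linear:
  "closed_form D (A + A') (B + B') = closed_form D A B + closed_form D A' B'"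
  "closed_form D (A - A') (B - B') = closed_form D A B - closed_form D A' B'"
  "closed_form D (smult [:a:] A) (smult [:a:] B) = smult [:a:] (closed_form D A B)"
  unfolding closed_form_def pderiv_inner_simps pderiv_add pderiv_diff pderiv_smult
  by (simp_all add: algebra_simps smult_diff_right smult_add_right)

lemma closed_form_self: "closed_form D (pderiv D) (pderiv_inner D) = 0"
  by (simp add: closed_form_def pderiv_inner_simps)

text \<open>Cleared of denominators, this says that \<open>delta D\<close> kills
  \<open>A / pderiv D\<close>, the residue of the form, modulo \<open>D\<close>.\<close>

lemma closed_form_residue:
  assumes "closed_form D A B = 0"
  shows "\<exists>Z. delta D A * pderiv D = A * delta D (pderiv D) + D * Z"
proof -
  define E where "E = pderiv_inner A - pderiv B"
  have 1: "D * E = A * pderiv_inner D - B * pderiv D" using assms by (simp add: closed_form_def E_def)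
  have 2: "pderiv (D * E) = pderiv (A * pderiv_inner D - B * pderiv D)" using 1 by simp
  have 3: "pderiv_inner A = E + pderiv B" by (simp add: E_def)
  have "delta D A * pderiv D = A * delta D (pderiv D) + D * (pderiv (pderiv D) * E - pderiv E * pderiv D)"
    using 1 2 unfolding delta_def pderiv_diff pderiv_mult pderiv_inner_simps 3 by algebra
  then show ?thesis by blast
qed

lemma coeff_zero_imp_degree_less: "(\<And>i. i \<ge> N \<Longrightarrow> coeff p i = 0) \<Longrightarrow> N \<ge> 1 \<Longrightarrow> degree p < N"
  by (metis leading_coeff_0_iff degree_0 less_le_trans not_less zero_less_one)

text \<open>Eliminating \<open>x\<close> from \<open>D\<close> and \<open>pderiv D\<close> leaves a
  nonzero polynomial in \<open>s\<close>; over any \<open>s\<close> where it does not vanish, every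
  root is simple.\<close>

lemma irreducible_regular_point:
  fixes D :: "complex poly poly"
  assumes "irreducible D" "lead_coeff D = 1" "degree D \<ge> 1"
  obtains s x where "eval2 D s x = 0" "eval2 (pderiv D) s x \<noteq> 0"
proof -
  have pd0: "pderiv D \<noteq> 0" using assms by (simp add: pderiv_eq_0_iff)
  have "degree (pderiv D) < degree D" using assms by (simp add: degree_pderiv)
  then have nd: "\<not> D dvd pderiv D" using pd0 by (meson dvd_imp_degree_le not_le)
  obtain u v r where b: "u * D + v * pderiv D = [:r:]" "r \<noteq> 0" using bezout_irreducible[OF assms(1,3) nd] .
  obtain s where s: "poly r s \<noteq> 0" using b(2) by (metis poly_all_0_iff_0)
  have "degree (map_poly (\<lambda>c. poly c s) D) \<noteq> 0" using degree_map_poly_eval_monic[OF assms(2)] assms(3) by simp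
  then obtain x where x: "eval2 D s x = 0" unfolding eval2_map_poly
    using fundamental_theorem_of_algebra by (metis constant_degree)
  have "eval2 (u * D + v * pderiv D) s x = poly r s" using b by simp
  then have "eval2 (pderiv D) s x \<noteq> 0" using x s by auto
  then show ?thesis using that x by blast
qed

text \<open>The residue of the closed form \<open>(A dx + B ds) / D\<close> along the curve \<open>D = 0\<close> is a constant \<open>c\<close>.\<close>

lemma closed_form_irreducible:
  assumes irr: "irreducible D" and monic: "lead_coeff D = 1" and N: "degree D \<ge> 1"
    and cf: "closed_form D A B = 0"
    and dA: "degree A < degree D" and dB: "degree B < degree D"
    and norm: "coeff (coeff A (degree D - 1)) 0 = 0"
  shows "A = 0 \<and> B = 0"
proof -
  obtain s x where p: "eval2 D s x = 0" and px: "eval2 (pderiv D) s x \<noteq> 0"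
    using irreducible_regular_point[OF irr monic N] .
  define c where "c = eval2 A s x / eval2 (pderiv D) s x"
  define X where "X = A - smult [:c:] (pderiv D)"
  obtain Z where Z: "delta D A * pderiv D = A * delta D (pderiv D) + D * Z"
    using closed_form_residue[OF cf] by blast
  have dX: "delta D X = delta D A - smult [:c:] (delta D (pderiv D))"
    unfolding X_def delta_def pderiv_inner_simps pderiv_diff pderiv_smult
    by (simp add: algebra_simps smult_diff_right smult_add_right pderiv_pCons)
  have eq: "delta D X * pderiv D = X * delta D (pderiv D) + D * Z"
    unfolding dX using Z by (simp add: X_def algebra_simps)
  have X0: "eval2 X s x = 0" using px by (simp add: X_def c_def)
  \<comment> \<open>The residue relation raises the order of vanishing of \<open>X\<close> by one at
    each step, so \<open>X\<close> vanishes to infinite order. If \<open>D\<close> did not divide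
    \<open>X\<close>, elimination would produce a nonzero polynomial in \<open>s\<close> with the
    same property.\<close>
  have van: "vanishes D s x n X" for n
  proof (induction n)
    case (Suc n)
    have "vanishes D s x n (delta D X * pderiv D)" unfolding eq
      by (intro vanishes_add vanishes_mult Suc vanishes_self p)
    then have "vanishes D s x n (delta D X)" using px by (rule vanishes_cancel)
    then show ?case using X0 by simp
  qed simp
  have "D dvd X"
  proof (rule ccontr)
    assume nd: "\<not> D dvd X"
    obtain u v r where b: "u * D + v * X = [:r:]" "r \<noteq> 0" using bezout_irreducible[OF irr N nd] .
    have "vanishes D s x n [:r:]" for n
      unfolding b(1)[symmetric] by (simp only: mult.commute[of u] mult.commute[of v]) (intro vanishes_add vanishes_mult van vanishes_self p)
    then show False using not_vanishes_const[OF px b(2)] by blast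
  qed
  moreover have "degree X < degree D"
    unfolding X_def using dA N by (intro degree_diff_less) (auto intro: le_less_trans[OF degree_smult_le] simp: degree_pderiv)
  ultimately have "X = 0" by (meson dvd_imp_degree_le not_le)
  then have A: "A = smult [:c:] (pderiv D)" by (simp add: X_def)
  \<comment> \<open>The normalization thus rules out precisely the nonzero multiples of the
    logarithmic differential.\<close>
  have "coeff (coeff A (degree D - 1)) 0 = c * of_nat (degree D)"
    unfolding A using N monic by (simp add: coeff_pderiv of_nat_poly)
  then have "c = 0" using norm N by simp
  then have A0: "A = 0" using A by simp
  then have "D dvd B * pderiv D" using cf unfolding closed_form_def
    by (simp add: pderiv_inner_simps)
  moreover have "\<not> D dvd pderiv D"
    using N monic by (metis degree_pderiv dvd_imp_degree_le diff_less less_le_trans not_le pderiv_eq_0_iff zero_less_one not_one_le_zero)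
  ultimately have "D dvd B" using irr by (metis prime_elem_dvd_mult_iff prime_elem_iff_irreducible)
  then have "B = 0" using dB by (meson dvd_imp_degree_le not_le)
  then show ?thesis using A0 by simp
qed

lemma sdeg_le_pderiv: "sdeg_le K p \<Longrightarrow> sdeg_le K (pderiv p)"
  for p :: "complex poly poly"
  unfolding sdeg_le_def coeff_pderiv
  by (metis degree_mult_le degree_of_nat add_0 order_trans)

lemma sdeg_le_pderiv_inner: "sdeg_le K p \<Longrightarrow> sdeg_le K (pderiv_inner p)"
  unfolding sdeg_le_def coeff_pderiv_inner by (metis degree_pderiv diff_le_self order_trans)

text \<open>A proper irreducible factor \<open>p\<close> yields a closed form that is independent of
  the logarithmic differential of \<open>D\<close>: for a multiple factor an exact form, otherwise a
  combination of dp / p and dD / D in which the leading terms in \<open>x\<close> cancel. The bound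
  \<open>K + K\<close> comes from multiplying a derivative of one factor by the other
  factor.\<close>

lemma closed_form_reducible:
  fixes D :: "complex poly poly"
  assumes red: "\<not> irreducible D" and monic: "lead_coeff D = 1" and N: "degree D \<ge> 1" and K: "sdeg_le K D"
  shows "\<exists>A B. closed_form D A B = 0 \<and> degree A < degree D \<and> degree B < degree D \<and>
     coeff (coeff A (degree D - 1)) 0 = 0 \<and> sdeg_le (K + K) A \<and> sdeg_le (K + K) B \<and> \<not> (A = 0 \<and> B = 0)"
proof -
  obtain G H0 where GH: "D = G * H0" "lead_coeff G = 1" "lead_coeff H0 = 1" "degree G \<ge> 1" "degree H0 \<ge> 1"
    using monic_not_irreducible_factors[OF monic N red] .
  let ?P = "\<lambda>p. p dvd D \<and> lead_coeff p = 1 \<and> degree p \<ge> 1"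
  obtain p where p: "?P p" and pmin: "\<And>q. ?P q \<Longrightarrow> degree p \<le> degree q"
    using ex_has_least_nat[of ?P G degree] GH by auto
  have p0: "p \<noteq> 0" using p by auto
  have irr: "irreducible p"
  proof (rule ccontr)
    assume np: "\<not> irreducible p"
    obtain a b where ab: "p = a * b" "lead_coeff a = 1" "lead_coeff b = 1" "degree a \<ge> 1" "degree b \<ge> 1"
      using monic_not_irreducible_factors[OF _ _ np] p by blast
    have "?P a" using ab p by (meson dvd_mult_left)
    moreover have "degree p = degree a + degree b" unfolding ab(1) using ab by (intro degree_mult_eq) auto
    ultimately show False using pmin[of a] ab by simp
  qed
  obtain H where D: "D = p * H" using p by (auto elim: dvdE)
  have D0: "D \<noteq> 0" using N by auto
  have H0: "H \<noteq> 0" using D D0 by auto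
  have dN: "degree D = degree p + degree H" unfolding D using p0 H0 by (rule degree_mult_eq)
  \<comment> \<open>Minimality of \<open>degree p\<close> keeps the cofactor \<open>H\<close>
    nonconstant, so \<open>p\<close> is a proper factor.\<close>
  have "degree D = degree G + degree H0" unfolding GH(1) using GH by (intro degree_mult_eq) auto
  then have dH: "degree H \<ge> 1" using pmin[of G] GH dN by simp
  have pprime: "prime_elem p" using irr by (simp add: prime_elem_iff_irreducible)
  have Kp: "sdeg_le K p" using sdeg_le_factor[of K p H] K D H0 by simp
  have KH: "sdeg_le K H" using sdeg_le_factor[of K H p] K D p0 by (simp add: mult.commute)
  have px0: "pderiv p \<noteq> 0" using p by (simp add: pderiv_eq_0_iff)
  have dpx: "degree (pderiv p) < degree p" using p by (simp add: degree_pderiv)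
  have dps: "degree (pderiv_inner p) < degree p"
  proof (rule coeff_zero_imp_degree_less)
    fix i assume "i \<ge> degree p"
    then show "coeff (pderiv_inner p) i = 0" using p by (cases "i = degree p") (auto simp: coeff_eq_0)
  qed (use p in simp)
  show ?thesis
  proof (cases "p dvd H")
    case True
    then obtain R where R: "H = p * R" by (auto elim: dvdE)
    have R0: "R \<noteq> 0" using R H0 by auto
    have dR: "degree H = degree p + degree R" unfolding R using p0 R0 by (rule degree_mult_eq)
    have KR: "sdeg_le K R" using sdeg_le_factor[of K R p] KH R p0 by (simp add: mult.commute)
    \<comment> \<open>Here \<open>D = p\<^sup>2 R\<close> and the form is dp divided by the square
      of \<open>p\<close>. Its first component has degree below \<open>degree D - 1\<close>, so the
      normalization is automatic.\<close>
    have 1: "closed_form D (pderiv p * R) (pderiv_inner p * R) = 0"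
      unfolding closed_form_def D R pderiv_inner_simps pderiv_mult by algebra
    have 2: "degree (pderiv p * R) < degree D - 1"
      using degree_mult_le[of "pderiv p" R] dpx dN dR p by linarith
    have 3: "degree (pderiv_inner p * R) < degree D"
      using degree_mult_le[of "pderiv_inner p" R] dps dN dR p by linarith
    show ?thesis
      by (rule exI[of _ "pderiv p * R"], rule exI[of _ "pderiv_inner p * R"])
         (use 1 2 3 px0 R0 in \<open>auto intro!: sdeg_le_mult sdeg_le_pderiv sdeg_le_pderiv_inner Kp KR simp: coeff_eq_0\<close>)
  next
    case False
    \<comment> \<open>In degree \<open>degree D - 1\<close> the coefficients of
      \<open>pderiv p * H\<close> and \<open>pderiv D\<close> are \<open>degree p\<close> and
      \<open>degree D\<close>; these weights make them cancel.\<close>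
    define a :: complex where "a = of_nat (degree D)"
    define b :: complex where "b = of_nat (degree p)"
    define A where "A = smult [:a:] (pderiv p * H) - smult [:b:] (pderiv D)"
    define B where "B = smult [:a:] (pderiv_inner p * H) - smult [:b:] (pderiv_inner D)"
    have sm: "smult [:c:] q = [:[:c:]:] * q" for c :: complex and q by simp
    have 1: "closed_form D A B = 0"
      unfolding A_def B_def closed_form_linear closed_form_self
      unfolding closed_form_def D pderiv_inner_simps pderiv_mult by (simp add: algebra_simps)
    have 2: "degree A < degree D" unfolding A_def
      by (intro degree_diff_less le_less_trans[OF degree_smult_le])
         (use degree_mult_le[of "pderiv p" H] dpx dN N in \<open>auto simp: degree_pderiv\<close>)
    have dDs: "degree (pderiv_inner D) < degree D"
    proof (rule coeff_zero_imp_degree_less[OF _ N])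
      fix i assume "i \<ge> degree D"
      then show "coeff (pderiv_inner D) i = 0" using monic by (cases "i = degree D") (auto simp: coeff_eq_0)
    qed
    have 3: "degree B < degree D" unfolding B_def
      by (intro degree_diff_less le_less_trans[OF degree_smult_le])
         (use degree_mult_le[of "pderiv_inner p" H] dps dN dDs in auto)
    have Hm: "lead_coeff H = 1" using monic p unfolding D lead_coeff_mult by simp
    have "degree D - 1 = degree (pderiv p) + degree H" using p dN by (simp add: degree_pderiv)
    then have "coeff (pderiv p * H) (degree D - 1) = lead_coeff (pderiv p) * lead_coeff H"
      by (simp only: coeff_mult_degree_sum)
    then have "coeff (pderiv p * H) (degree D - 1) = of_nat (degree p)"
      using Hm p by (simp add: degree_pderiv coeff_pderiv)
    moreover have "coeff (pderiv D) (degree D - 1) = of_nat (degree D)" using N monic by (simp add: coeff_pderiv)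
    ultimately have 4: "coeff (coeff A (degree D - 1)) 0 = 0" unfolding A_def a_def b_def
      by (simp add: of_nat_poly)
    have 5: "A \<noteq> 0"
    proof
      assume "A = 0"
      then have "smult [:a:] (pderiv p * H) = smult [:b:] (pderiv p * H + p * pderiv H)"
        unfolding A_def by (simp add: D pderiv_mult add.commute mult.commute)
      moreover have e: "[:a - b:] = [:a:] - [:b:]" by simp
      ultimately have "smult [:a - b:] (pderiv p * H) = p * smult [:b:] (pderiv H)"
        unfolding e smult_diff_left by (simp add: smult_add_right)
      moreover have ab: "a - b \<noteq> 0" using dN dH by (simp add: a_def b_def)
      ultimately have "p dvd [:[:a - b:]:] * (pderiv p * H)" by (metis dvd_triv_left sm)
      moreover have "\<not> p dvd [:[:a-b:]:]" using p ab
        by (metis degree_pCons_0 dvd_imp_degree_le not_one_le_zero order_trans pCons_eq_0_iff)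
      moreover have "\<not> p dvd pderiv p" using px0 dpx by (meson dvd_imp_degree_le not_le)
      ultimately show False using False pprime by (metis prime_elem_dvd_mult_iff)
    qed
    have sml: "sdeg_le L q \<Longrightarrow> sdeg_le L (smult [:c:] q)" for L q and c :: complex
      unfolding sdeg_le_def by (simp add: order_trans[OF degree_smult_le])
    have dif: "sdeg_le L q \<Longrightarrow> sdeg_le L r \<Longrightarrow> sdeg_le L (q - r)" for L and q r :: "complex poly poly"
      unfolding sdeg_le_def by (simp add: degree_diff_le)
    have 6: "sdeg_le (K + K) A" "sdeg_le (K + K) B" unfolding A_def B_def
      by (intro dif sml sdeg_le_mult sdeg_le_pderiv sdeg_le_pderiv_inner Kp KH sdeg_le_mono[OF K], simp)+
    show ?thesis using 1 2 3 4 5 6 by blast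
  qed
qed

section \<open>Openness of irreducibility\<close>

text \<open>Abstracts from the kind of coefficient functions, because determinants, elimination and
  division are applied to polynomial functions of the potential, to functions of potential and base
  point that are merely continuous in the latter, to regular functions and to Laurent polynomial
  functions.\<close>

definition function_ring :: "('p \<Rightarrow> 'a::comm_ring_1) set \<Rightarrow> bool" where
  "function_ring R \<longleftrightarrow> (\<forall>c. (\<lambda>_. c) \<in> R) \<and>
     (\<forall>f\<in>R. \<forall>g\<in>R. (\<lambda>x. f x + g x) \<in> R \<and> (\<lambda>x. f x * g x) \<in> R)"

lemma function_ring_const: "function_ring R \<Longrightarrow> (\<lambda>_. c) \<in> R"
  and function_ring_add: "function_ring R \<Longrightarrow> f \<in> R \<Longrightarrow> g \<in> R \<Longrightarrow> (\<lambda>x. f x + g x) \<in> R"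
  and function_ring_mult: "function_ring R \<Longrightarrow> f \<in> R \<Longrightarrow> g \<in> R \<Longrightarrow> (\<lambda>x. f x * g x) \<in> R"
  by (auto simp: function_ring_def)

lemma function_ring_diff:
  assumes "function_ring R" "f \<in> R" "g \<in> R" shows "(\<lambda>x. f x - g x) \<in> R"
proof -
  have "(\<lambda>x. f x + (-1) * g x) \<in> R"
    by (intro function_ring_add function_ring_mult function_ring_const assms)
  then show ?thesis by simp
qed

lemma function_ring_sum:
  assumes "function_ring R" "\<And>i. i \<in> A \<Longrightarrow> f i \<in> R" shows "(\<lambda>x. \<Sum>i\<in>A. f i x) \<in> R"
  using assms(2) by (induction A rule: infinite_finite_induct)
    (auto intro: function_ring_add[OF assms(1)] function_ring_const[OF assms(1)])

text \<open>Gaussian elimination without divisions: the pivots that are nonzero at \<open>t0\<close> multiply up to \<open>P\<close>.\<close>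

lemma injective_system_open:
  fixes m :: "'j \<Rightarrow> 'i \<Rightarrow> 'p \<Rightarrow> 'a::idom"
  assumes R: "function_ring R" and "finite I" and "\<And>j i. i \<in> I \<Longrightarrow> m j i \<in> R"
    and "\<And>y. (\<And>j. (\<Sum>i\<in>I. m j i t0 * y i) = 0) \<Longrightarrow> \<forall>i\<in>I. y i = 0"
  shows "\<exists>P\<in>R. P t0 \<noteq> 0 \<and> (\<forall>t. P t \<noteq> 0 \<longrightarrow>
           (\<forall>y. (\<forall>j. (\<Sum>i\<in>I. m j i t * y i) = 0) \<longrightarrow> (\<forall>i\<in>I. y i = 0)))"
  using assms(2-)
proof (induction I arbitrary: m rule: finite_induct)
  case empty
  show ?case by (rule bexI[of _ "\<lambda>_. 1"]) (auto intro: function_ring_const[OF R])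
next
  case (insert k I)
  have "\<exists>j0. m j0 k t0 \<noteq> 0"
  proof (rule ccontr)
    assume "\<not> ?thesis"
    then have "(\<Sum>i\<in>insert k I. m j i t0 * (if i = k then 1 else 0)) = 0" for j
      by (intro sum.neutral) auto
    from insert.prems(2)[OF this] show False by auto
  qed
  then obtain j0 where j0: "m j0 k t0 \<noteq> 0" by blast
  \<comment> \<open>Cross-multiplication with the pivot row \<open>j0\<close> eliminates the unknown
    \<open>k\<close> without leaving the ring.\<close>
  define m' where "m' j i t = m j0 k t * m j i t - m j k t * m j0 i t" for j i t
  have m'R: "m' j i \<in> R" if "i \<in> I" for j i
    unfolding m'_def by (intro function_ring_diff[OF R] function_ring_mult[OF R] insert.prems(1)) (use that in auto)
  have sum': "(\<Sum>i\<in>I. m' j i t * y i) =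
      m j0 k t * (\<Sum>i\<in>I. m j i t * y i) - m j k t * (\<Sum>i\<in>I. m j0 i t * y i)" for j t y
    by (simp add: m'_def sum_distrib_left sum_subtractf algebra_simps)
  have "\<exists>P\<in>R. P t0 \<noteq> 0 \<and> (\<forall>t. P t \<noteq> 0 \<longrightarrow>
           (\<forall>y. (\<forall>j. (\<Sum>i\<in>I. m' j i t * y i) = 0) \<longrightarrow> (\<forall>i\<in>I. y i = 0)))"
  proof (rule insert.IH[OF m'R])
    fix y assume y: "\<And>j. (\<Sum>i\<in>I. m' j i t0 * y i) = 0"
    \<comment> \<open>A solution of the reduced system is scaled by the pivot, so that a matching
      value of the unknown \<open>k\<close> exists without division.\<close>
    define y' where "y' i = (if i = k then - (\<Sum>i\<in>I. m j0 i t0 * y i) else m j0 k t0 * y i)" for i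
    have "(\<Sum>i\<in>insert k I. m j i t0 * y' i) = (\<Sum>i\<in>I. m' j i t0 * y i)" for j
    proof -
      have "(\<Sum>i\<in>I. m j i t0 * y' i) = m j0 k t0 * (\<Sum>i\<in>I. m j i t0 * y i)"
        unfolding sum_distrib_left using insert.hyps by (intro sum.cong) (auto simp: y'_def)
      then show ?thesis using insert.hyps by (simp add: sum' y'_def)
    qed
    then have "\<forall>i\<in>insert k I. y' i = 0" using y by (intro insert.prems(2)) simp
    then show "\<forall>i\<in>I. y i = 0" using insert.hyps j0 by (auto simp: y'_def split: if_splits)
  qed
  then obtain P where P: "P \<in> R" "P t0 \<noteq> 0"
    and Pt: "\<And>t y. P t \<noteq> 0 \<Longrightarrow> (\<And>j. (\<Sum>i\<in>I. m' j i t * y i) = 0) \<Longrightarrow> \<forall>i\<in>I. y i = 0" by blast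
  show ?case
  proof (rule bexI[of _ "\<lambda>t. P t * m j0 k t"], intro conjI allI impI)
    show "P t0 * m j0 k t0 \<noteq> 0" using P j0 by simp
    show "(\<lambda>t. P t * m j0 k t) \<in> R" by (intro function_ring_mult[OF R] P insert.prems(1)) auto
    fix t y assume t: "P t * m j0 k t \<noteq> 0" and y: "\<forall>j. (\<Sum>i\<in>insert k I. m j i t * y i) = 0"
    have y2: "(\<Sum>i\<in>I. m j i t * y i) = - (m j k t * y k)" for j
      using y insert.hyps by (simp add: eq_neg_iff_add_eq_0 add.commute)
    have 0: "\<forall>i\<in>I. y i = 0" by (rule Pt) (use t in \<open>auto simp: sum' y2\<close>)
    then have "m j0 k t * y k = 0" using y2[of j0] by simp
    then show "\<forall>i\<in>insert k I. y i = 0" using 0 t by auto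
  qed
qed

definition coeffs_in :: "('p \<Rightarrow> 'a::comm_ring_1) set \<Rightarrow> ('p \<Rightarrow> 'a poly poly) \<Rightarrow> bool" where
  "coeffs_in R F \<longleftrightarrow> (\<forall>a b. (\<lambda>t. coeff (coeff (F t) a) b) \<in> R)"

lemma coeffs_in_const: "function_ring R \<Longrightarrow> coeffs_in R (\<lambda>_. p)"
  by (simp add: coeffs_in_def function_ring_const)

lemma coeffs_in_add:
  "function_ring R \<Longrightarrow> coeffs_in R F \<Longrightarrow> coeffs_in R G \<Longrightarrow> coeffs_in R (\<lambda>t. F t + G t)"
  by (simp add: coeffs_in_def function_ring_add)

lemma coeffs_in_diff:
  "function_ring R \<Longrightarrow> coeffs_in R F \<Longrightarrow> coeffs_in R G \<Longrightarrow> coeffs_in R (\<lambda>t. F t - G t)"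
  by (simp add: coeffs_in_def function_ring_diff)

lemma coeffs_in_mult:
  "function_ring R \<Longrightarrow> coeffs_in R F \<Longrightarrow> coeffs_in R G \<Longrightarrow> coeffs_in R (\<lambda>t. F t * G t)"
  by (auto simp: coeffs_in_def coeff_mult coeff_sum intro!: function_ring_sum function_ring_mult)

lemma coeffs_in_sum:
  assumes "function_ring R" "\<And>i. i \<in> A \<Longrightarrow> coeffs_in R (F i)" shows "coeffs_in R (\<lambda>t. \<Sum>i\<in>A. F i t)"
  using assms(2) by (induction A rule: infinite_finite_induct)
    (auto intro: coeffs_in_add[OF assms(1)] coeffs_in_const[OF assms(1)])

lemma coeffs_in_prod:
  assumes "function_ring R" "\<And>i. i \<in> A \<Longrightarrow> coeffs_in R (F i)" shows "coeffs_in R (\<lambda>t. \<Prod>i\<in>A. F i t)"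
  using assms(2) by (induction A rule: infinite_finite_induct)
    (auto intro: coeffs_in_mult[OF assms(1)] coeffs_in_const[OF assms(1)])

lemma coeffs_in_pderiv:
  assumes "function_ring R" "coeffs_in R F" shows "coeffs_in R (\<lambda>t. pderiv (F t) :: complex poly poly)"
proof -
  have "(\<lambda>t. of_nat (Suc a) * coeff (coeff (F t) (Suc a)) b) \<in> R" for a b
    using assms by (intro function_ring_mult function_ring_const) (auto simp: coeffs_in_def)
  moreover have "coeff (of_nat (Suc a) * c) b = of_nat (Suc a) * coeff c b" for a b and c :: "complex poly"
    by (simp only: of_nat_poly mult_pCons_left) simp
  ultimately show ?thesis unfolding coeffs_in_def coeff_pderiv by presburger
qed

lemma coeffs_in_pderiv_inner:
  assumes "function_ring R" "coeffs_in R F" shows "coeffs_in R (\<lambda>t. pderiv_inner (F t))"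
proof -
  have "(\<lambda>t. of_nat (Suc b) * coeff (coeff (F t) a) (Suc b)) \<in> R" for a b
    using assms by (intro function_ring_mult function_ring_const) (auto simp: coeffs_in_def)
  then show ?thesis unfolding coeffs_in_def coeff_pderiv_inner coeff_pderiv by blast
qed

lemma coeffs_in_closed_form:
  assumes R: "function_ring R" and D: "coeffs_in R D"
  shows "coeffs_in R (\<lambda>t. closed_form (D t) A B)"
  unfolding closed_form_def
  by (intro coeffs_in_diff coeffs_in_mult coeffs_in_pderiv coeffs_in_pderiv_inner coeffs_in_const R D)

text \<open>
  By Ruppert's criterion a reducible polynomial admits a closed form that is not a multiple of the
  logarithmic differential of the polynomial; the existence of such a form is a rank condition.
\<close>

lemma irreducible_open:
  fixes D :: "'p \<Rightarrow> complex poly poly"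
  assumes R: "function_ring R" and D: "coeffs_in R D"
    and monic: "\<And>t. lead_coeff (D t) = 1" and N: "\<And>t. degree (D t) = N" and N1: "N \<ge> 1"
    and K: "\<And>t. sdeg_le K (D t)" and irr: "irreducible (D t0)"
  shows "\<exists>P\<in>R. P t0 \<noteq> 0 \<and> (\<forall>t. P t \<noteq> 0 \<longrightarrow> irreducible (D t))"
proof -
  \<comment> \<open>The unknowns are the coefficients of \<open>A\<close> (for \<open>True\<close>)
    and \<open>B\<close> (for \<open>False\<close>), with exponents of \<open>x\<close> below
    \<open>N\<close> and of \<open>s\<close> up to \<open>K + K\<close>, the bounds provided by
    \<open>closed_form_reducible\<close>.\<close>
  define I where "I = (UNIV :: bool set) \<times> {..<N} \<times> {..K + K}"
  have finI: "finite I" by (simp add: I_def)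
  define bs :: "bool \<times> nat \<times> nat \<Rightarrow> complex poly poly" where "bs = (\<lambda>(k, i, j). monom (monom 1 j) i)"
  define A where "A y = (\<Sum>i\<in>I. smult [:y i:] (if fst i then bs i else 0))" for y
  define B where "B y = (\<Sum>i\<in>I. smult [:y i:] (if fst i then 0 else bs i))" for y
  have coe: "coeff (coeff (\<Sum>i\<in>I. smult [:y i:] (if fst i = k then bs i else 0)) a) b =
      (if a < N \<and> b \<le> K + K then y (k, a, b) else 0)" for k y a b
  proof -
    have "coeff (coeff (\<Sum>i\<in>I. smult [:y i:] (if fst i = k then bs i else 0)) a) b =
       (\<Sum>i\<in>I. if i = (k, a, b) then y i else 0)"
      unfolding coeff_sum by (intro sum.cong refl) (auto simp: bs_def coeff_monom split: if_splits)
    then show ?thesis using finI by (auto simp: I_def)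
  qed
  have coeA: "coeff (coeff (A y) a) b = (if a < N \<and> b \<le> K + K then y (True, a, b) else 0)" for y a b
    using coe[where k=True and y=y and a=a and b=b] by (simp add: A_def)
  have coeB: "coeff (coeff (B y) a) b = (if a < N \<and> b \<le> K + K then y (False, a, b) else 0)" for y a b
  proof -
    have "B y = (\<Sum>i\<in>I. smult [:y i:] (if fst i = False then bs i else 0))"
      unfolding B_def by (intro sum.cong) auto
    then show ?thesis using coe[where k=False and y=y and a=a and b=b] by simp
  qed
  have deg: "degree (A y) < N" "degree (B y) < N" for y
    by (rule coeff_zero_imp_degree_less[OF _ N1], rule poly_eqI, simp add: coeA coeB)+
  \<comment> \<open>The row \<open>None\<close> is the normalization of \<open>A\<close>; the row
    \<open>Some (a, b)\<close> is the coefficient with exponents \<open>a\<close> of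
    \<open>x\<close> and \<open>b\<close> of \<open>s\<close> in the closedness condition.\<close>
  define m :: "(nat \<times> nat) option \<Rightarrow> bool \<times> nat \<times> nat \<Rightarrow> 'p \<Rightarrow> complex" where
    "m j i t = (case j of None \<Rightarrow> (if i = (True, N - 1, 0) then 1 else 0)
       | Some (a, b) \<Rightarrow> coeff (coeff (closed_form (D t) (if fst i then bs i else 0) (if fst i then 0 else bs i)) a) b)" for j i t
  have mR: "m j i \<in> R" for j i
    using coeffs_in_closed_form[OF R D] function_ring_const[OF R]
    by (cases j) (auto simp: m_def[abs_def] coeffs_in_def split: prod.splits)
  have cf: "closed_form (D t) (A y) (B y) =
     (\<Sum>i\<in>I. smult [:y i:] (closed_form (D t) (if fst i then bs i else 0) (if fst i then 0 else bs i)))" for t y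
  proof -
    have "closed_form (D t) (\<Sum>i\<in>J. smult [:y i:] (if fst i then bs i else 0)) (\<Sum>i\<in>J. smult [:y i:] (if fst i then 0 else bs i)) =
     (\<Sum>i\<in>J. smult [:y i:] (closed_form (D t) (if fst i then bs i else 0) (if fst i then 0 else bs i)))" for J
    proof (induction J rule: infinite_finite_induct)
      case (insert x J)
      show ?case by (simp only: sum.insert[OF insert.hyps] closed_form_linear insert.IH)
    qed (simp_all add: closed_form_def pderiv_inner_simps)
    then show ?thesis by (simp add: A_def B_def)
  qed
  have sys: "(\<forall>j. (\<Sum>i\<in>I. m j i t * y i) = 0) \<longleftrightarrow>
     closed_form (D t) (A y) (B y) = 0 \<and> coeff (coeff (A y) (N - 1)) 0 = 0" for t y
  proof -
    have 1: "(\<Sum>i\<in>I. m None i t * y i) = coeff (coeff (A y) (N - 1)) 0"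
      using finI N1 by (simp add: m_def coeA if_distrib[of "\<lambda>x. x * _"] cong: if_cong) (simp add: I_def)
    have 2: "(\<Sum>i\<in>I. m (Some (a, b)) i t * y i) = coeff (coeff (closed_form (D t) (A y) (B y)) a) b" for a b
      unfolding cf coeff_sum by (intro sum.cong) (auto simp: m_def)
    show ?thesis
    proof
      assume "\<forall>j. (\<Sum>i\<in>I. m j i t * y i) = 0"
      then show "closed_form (D t) (A y) (B y) = 0 \<and> coeff (coeff (A y) (N - 1)) 0 = 0"
        using 1 2 by (auto intro!: poly_eqI)
    next
      assume "closed_form (D t) (A y) (B y) = 0 \<and> coeff (coeff (A y) (N - 1)) 0 = 0"
      then show "\<forall>j. (\<Sum>i\<in>I. m j i t * y i) = 0"
        using 1 2 by (intro allI, case_tac j) auto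
    qed
  qed
  have zero: "A y = 0 \<and> B y = 0 \<longleftrightarrow> (\<forall>i\<in>I. y i = 0)" for y
  proof
    assume "A y = 0 \<and> B y = 0"
    then have "y (k, a, b) = 0" if "a < N" "b \<le> K + K" for k a b
      using coeA[of y a b] coeB[of y a b] that by (cases k) auto
    then show "\<forall>i\<in>I. y i = 0" by (auto simp: I_def)
  qed (simp add: A_def B_def cong: sum.cong)
  have "\<exists>P\<in>R. P t0 \<noteq> 0 \<and> (\<forall>t. P t \<noteq> 0 \<longrightarrow>
           (\<forall>y. (\<forall>j. (\<Sum>i\<in>I. m j i t * y i) = 0) \<longrightarrow> (\<forall>i\<in>I. y i = 0)))"
  proof (rule injective_system_open[OF R finI mR])
    fix y assume "\<And>j. (\<Sum>i\<in>I. m j i t0 * y i) = 0"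
    then have "closed_form (D t0) (A y) (B y) = 0 \<and> coeff (coeff (A y) (N - 1)) 0 = 0" using sys by blast
    then have "closed_form (D t0) (A y) (B y) = 0" "coeff (coeff (A y) (degree (D t0) - 1)) 0 = 0"
      by (simp_all only: N)
    moreover have "degree (A y) < degree (D t0)" "degree (B y) < degree (D t0)" "1 \<le> degree (D t0)"
      using deg[of y] N1 by (simp_all only: N)
    ultimately have "A y = 0 \<and> B y = 0" using closed_form_irreducible[OF irr monic] by blast
    then show "\<forall>i\<in>I. y i = 0" using zero by blast
  qed
  then obtain P where P: "P \<in> R" "P t0 \<noteq> 0"
    and Pt: "\<And>t y. P t \<noteq> 0 \<Longrightarrow> (\<forall>j. (\<Sum>i\<in>I. m j i t * y i) = 0) \<Longrightarrow> \<forall>i\<in>I. y i = 0" by blast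
  have "irreducible (D t)" if t: "P t \<noteq> 0" for t
  proof (rule ccontr)
    assume "\<not> irreducible (D t)"
    from closed_form_reducible[OF this monic _ K] N1 N[of t] obtain A' B' where
      AB: "closed_form (D t) A' B' = 0" "degree A' < N" "degree B' < N"
        "coeff (coeff A' (N - 1)) 0 = 0" "sdeg_le (K + K) A'" "sdeg_le (K + K) B'" "\<not> (A' = 0 \<and> B' = 0)" by auto
    define y where "y = (\<lambda>(k, a, b). coeff (coeff (if k then A' else B') a) b)"
    have z: "coeff (coeff X a) b = 0"
      if X: "degree X < N" "sdeg_le (K + K) X" "\<not> (a < N \<and> b \<le> K + K)" for X :: "complex poly poly" and a b
    proof (cases "a < N")
      case True
      then have "degree (coeff X a) < b" using X(2,3) unfolding sdeg_le_def by (meson le_less_trans not_le)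
      then show ?thesis by (rule coeff_eq_0)
    next
      case False
      then show ?thesis using X(1) by (simp add: coeff_eq_0)
    qed
    have "A y = A'" "B y = B'"
      using z[OF AB(2,5)] z[OF AB(3,6)] by (auto intro!: poly_eqI simp: coeA coeB y_def)
    then show False using Pt[OF t, of y] sys[of t y] zero[of y] AB by auto
  qed
  then show ?thesis using P by blast
qed

section \<open>Limits of factorizations\<close>

lemma sdeg_le_exists: "\<exists>K. sdeg_le K p"
proof -
  have "degree (coeff p i) \<le> Max ((\<lambda>i. degree (coeff p i)) ` {..degree p})" for i
  proof (cases "i \<le> degree p")
    case True then show ?thesis by (intro Max_ge) auto
  next
    case False then show ?thesis by (simp add: coeff_eq_0)
  qed
  then show ?thesis unfolding sdeg_le_def by blast
qed

lemma sdeg_le_diff: "sdeg_le L q \<Longrightarrow> sdeg_le L r \<Longrightarrow> sdeg_le L (q - r)" for q r :: "'a::ab_group_add poly poly"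
  unfolding sdeg_le_def by (simp add: degree_diff_le)

definition poly_tendsto :: "(nat \<Rightarrow> complex poly) \<Rightarrow> complex poly \<Rightarrow> bool" where
  "poly_tendsto F L \<longleftrightarrow> (\<forall>b. (\<lambda>n. coeff (F n) b) \<longlonglongrightarrow> coeff L b)"

definition poly2_tendsto :: "(nat \<Rightarrow> complex poly poly) \<Rightarrow> complex poly poly \<Rightarrow> bool" where
  "poly2_tendsto F L \<longleftrightarrow> (\<forall>a. poly_tendsto (\<lambda>n. coeff (F n) a) (coeff L a))"

lemma poly_tendsto_const: "poly_tendsto (\<lambda>_. p) p"
  by (simp add: poly_tendsto_def)

lemma poly_tendsto_mult:
  "poly_tendsto F L \<Longrightarrow> poly_tendsto G M \<Longrightarrow> poly_tendsto (\<lambda>n. F n * G n) (L * M)"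
  unfolding poly_tendsto_def coeff_mult by (intro allI tendsto_intros) auto

lemma poly_tendsto_sum:
  "(\<And>i. i \<in> A \<Longrightarrow> poly_tendsto (F i) (L i)) \<Longrightarrow> poly_tendsto (\<lambda>n. \<Sum>i\<in>A. F i n) (\<Sum>i\<in>A. L i)"
  unfolding poly_tendsto_def coeff_sum by (intro allI tendsto_intros) auto

lemma poly_tendsto_smult:
  "c \<longlonglongrightarrow> l \<Longrightarrow> poly_tendsto F L \<Longrightarrow> poly_tendsto (\<lambda>n. smult (c n) (F n)) (smult l L)"
  unfolding poly_tendsto_def coeff_smult by (intro allI tendsto_intros) auto

lemma poly_tendsto_power:
  "poly_tendsto F L \<Longrightarrow> poly_tendsto (\<lambda>n. F n ^ k) (L ^ k)"
  by (induction k) (auto intro: poly_tendsto_mult poly_tendsto_const)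

lemma poly2_tendsto_mult:
  "poly2_tendsto F L \<Longrightarrow> poly2_tendsto G M \<Longrightarrow> poly2_tendsto (\<lambda>n. F n * G n) (L * M)"
  unfolding poly2_tendsto_def coeff_mult by (intro allI poly_tendsto_sum poly_tendsto_mult) auto

lemma poly2_tendsto_smult:
  "c \<longlonglongrightarrow> l \<Longrightarrow> poly2_tendsto F L \<Longrightarrow> poly2_tendsto (\<lambda>n. smult [:c n:] (F n)) (smult [:l:] L)"
  unfolding poly2_tendsto_def by (simp add: poly_tendsto_smult)

lemma poly2_tendsto_unique: "poly2_tendsto F L \<Longrightarrow> poly2_tendsto F M \<Longrightarrow> L = M"
  unfolding poly2_tendsto_def poly_tendsto_def by (intro poly_eqI) (metis LIMSEQ_unique)

lemma poly2_tendsto_subseq: "poly2_tendsto F L \<Longrightarrow> strict_mono r \<Longrightarrow> poly2_tendsto (\<lambda>n. F (r n)) L"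
  unfolding poly2_tendsto_def poly_tendsto_def using LIMSEQ_subseq_LIMSEQ unfolding o_def by blast

text \<open>A nonzero leading coefficient of the limit is already present nearby; in passing to the
  limit the degree can only drop.\<close>

lemma poly2_tendsto_degree:
  assumes "poly2_tendsto F L"
  shows "\<forall>\<^sub>F n in sequentially. degree L \<le> degree (F n)"
proof (cases "L = 0")
  case False
  obtain b where b: "coeff (lead_coeff L) b \<noteq> 0" using False by (metis leading_coeff_0_iff)
  have "(\<lambda>n. coeff (coeff (F n) (degree L)) b) \<longlonglongrightarrow> coeff (lead_coeff L) b"
    using assms by (simp add: poly2_tendsto_def poly_tendsto_def)
  then have "\<forall>\<^sub>F n in sequentially. coeff (coeff (F n) (degree L)) b \<noteq> 0"
    using b by (rule tendsto_imp_eventually_ne)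
  then show ?thesis by (rule eventually_mono) (auto intro: le_degree)
qed simp

lemma poly2_normalize:
  fixes G :: "complex poly poly"
  assumes "G \<noteq> 0" "degree G \<le> N" "sdeg_le K G"
  obtains c :: complex where "c \<noteq> 0" "(\<Sum>a\<le>N. \<Sum>b\<le>K. norm (coeff (coeff (smult [:c:] G) a) b)) = 1"
proof -
  define r where "r = (\<Sum>a\<le>N. \<Sum>b\<le>K. norm (coeff (coeff G a) b))"
  obtain b where b: "coeff (lead_coeff G) b \<noteq> 0" using assms(1) by (metis leading_coeff_0_iff)
  then have "b \<le> K" using assms(3) unfolding sdeg_le_def by (meson le_degree order_trans)
  then have "norm (coeff (lead_coeff G) b) \<le> (\<Sum>b\<le>K. norm (coeff (lead_coeff G) b))"
    by (intro member_le_sum) auto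
  also have "\<dots> \<le> r" unfolding r_def using assms(2)
    by (intro member_le_sum[where f = "\<lambda>a. \<Sum>b\<le>K. norm (coeff (coeff G a) b)"]) (auto intro: sum_nonneg)
  finally have r: "r > 0" using b by (meson zero_less_norm_iff less_le_trans)
  have "(\<Sum>a\<le>N. \<Sum>b\<le>K. norm (coeff (coeff (smult [:of_real (1 / r):] G) a) b)) =
      (1 / r) * (\<Sum>a\<le>N. \<Sum>b\<le>K. norm (coeff (coeff G a) b))"
    unfolding sum_distrib_left using r by (intro sum.cong refl) (simp add: norm_mult norm_divide)
  also have "\<dots> = 1" using r unfolding r_def[symmetric] by simp
  finally show ?thesis using that[of "of_real (1 / r)"] r by simp
qed

text \<open>Limits of factors are taken after normalizing the coefficient vectors, by compactness.\<close>

lemma factor_limit: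
  fixes D G H :: "nat \<Rightarrow> complex poly poly"
  assumes D: "\<And>n. D n = G n * H n" and G0: "\<And>n. G n \<noteq> 0" and H0: "\<And>n. H n \<noteq> 0"
    and deg: "\<And>n. degree (G n) \<le> N" "\<And>n. degree (H n) \<le> N"
    and K: "\<And>n. sdeg_le K (G n)" "\<And>n. sdeg_le K (H n)"
    and lim: "poly2_tendsto D L" and L0: "L \<noteq> 0"
  obtains r g h G' H' where "strict_mono r"
    "poly2_tendsto (\<lambda>n. smult [:g n:] (G (r n))) G'" "poly2_tendsto (\<lambda>n. smult [:h n:] (H (r n))) H'"
    "L = G' * H'"
proof -
  have "\<forall>n. \<exists>c. c \<noteq> 0 \<and> (\<Sum>a\<le>N. \<Sum>b\<le>K. norm (coeff (coeff (smult [:c:] (G n)) a) b)) = 1"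
    using poly2_normalize[OF G0 deg(1) K(1)] by metis
  then obtain x where x: "\<And>n. x n \<noteq> 0" "\<And>n. (\<Sum>a\<le>N. \<Sum>b\<le>K. norm (coeff (coeff (smult [:x n:] (G n)) a) b)) = 1"
    by metis
  have "\<forall>n. \<exists>c. c \<noteq> 0 \<and> (\<Sum>a\<le>N. \<Sum>b\<le>K. norm (coeff (coeff (smult [:c:] (H n)) a) b)) = 1"
    using poly2_normalize[OF H0 deg(2) K(2)] by metis
  then obtain y where y: "\<And>n. y n \<noteq> 0" "\<And>n. (\<Sum>a\<le>N. \<Sum>b\<le>K. norm (coeff (coeff (smult [:y n:] (H n)) a) b)) = 1"
    by metis
  define f where "f n = (\<lambda>(k, a, b). if k then coeff (coeff (smult [:x n:] (G n)) a) b
     else coeff (coeff (smult [:y n:] (H n)) a) b)" for n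
  define S where "S = (UNIV :: bool set) \<times> {..N} \<times> {..K}"
  have bound: "norm (coeff (coeff p a) b) \<le> 1"
    if "(\<Sum>a\<le>N. \<Sum>b\<le>K. norm (coeff (coeff p a) b)) = 1" "a \<le> N" "b \<le> K" for p :: "complex poly poly" and a b
  proof -
    have "norm (coeff (coeff p a) b) \<le> (\<Sum>b\<le>K. norm (coeff (coeff p a) b))"
      by (rule member_le_sum) (use that in auto)
    also have "\<dots> \<le> 1" unfolding that(1)[symmetric]
      by (rule member_le_sum[where f = "\<lambda>a. \<Sum>b\<le>K. norm (coeff (coeff p a) b)"]) (use that in \<open>auto intro: sum_nonneg\<close>)
    finally show ?thesis .
  qed
  have "countable S" by (simp add: S_def countable_finite)
  moreover have "norm (f n z) \<le> 1" if "z \<in> S" for n z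
    using bound[OF x(2)[of n]] bound[OF y(2)[of n]] that by (auto simp: f_def S_def)
  ultimately obtain r where r: "strict_mono r" and conv: "\<And>z. z \<in> S \<Longrightarrow> \<exists>l. (\<lambda>n. f (r n) z) \<longlonglongrightarrow> l"
    using function_convergent_subsequence[of S f 1] by metis
  from conv obtain l where l: "\<And>z. z \<in> S \<Longrightarrow> (\<lambda>n. f (r n) z) \<longlonglongrightarrow> l z" by metis
  define P where "P k = (\<Sum>a\<le>N. monom (\<Sum>b\<le>K. monom (l (k, a, b)) b) a)" for k
  have coeP: "coeff (coeff (P k) a) b = (if a \<le> N \<and> b \<le> K then l (k, a, b) else 0)" for k a b
  proof -
    have 1: "coeff (P k) a = (if a \<le> N then (\<Sum>b\<le>K. monom (l (k, a, b)) b) else 0)"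
      unfolding P_def coeff_sum coeff_monom by (simp add: sum.delta)
    show ?thesis unfolding 1 by (simp add: coeff_sum coeff_monom sum.delta)
  qed
  have limG: "poly2_tendsto (\<lambda>n. smult [:x (r n):] (G (r n))) (P True)"
    unfolding poly2_tendsto_def poly_tendsto_def
  proof (intro allI)
    fix a b
    show "(\<lambda>n. coeff (coeff (smult [:x (r n):] (G (r n))) a) b) \<longlonglongrightarrow> coeff (coeff (P True) a) b"
    proof (cases "a \<le> N \<and> b \<le> K")
      case True then show ?thesis using l[of "(True, a, b)"] by (simp add: coeP S_def f_def)
    next
      case False
      then have "coeff (coeff (G n) a) b = 0" for n
        using deg(1)[of n] K(1)[of n] unfolding sdeg_le_def
        by (metis coeff_0 coeff_eq_0 le_less_trans not_le)
      then show ?thesis using False by (auto simp: coeP)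
    qed
  qed
  have limH: "poly2_tendsto (\<lambda>n. smult [:y (r n):] (H (r n))) (P False)"
    unfolding poly2_tendsto_def poly_tendsto_def
  proof (intro allI)
    fix a b
    show "(\<lambda>n. coeff (coeff (smult [:y (r n):] (H (r n))) a) b) \<longlonglongrightarrow> coeff (coeff (P False) a) b"
    proof (cases "a \<le> N \<and> b \<le> K")
      case True then show ?thesis using l[of "(False, a, b)"] by (simp add: coeP S_def f_def)
    next
      case False
      then have "coeff (coeff (H n) a) b = 0" for n
        using deg(2)[of n] K(2)[of n] unfolding sdeg_le_def
        by (metis coeff_0 coeff_eq_0 le_less_trans not_le)
      then show ?thesis using False by (auto simp: coeP)
    qed
  qed
  \<comment> \<open>The normalized coefficient sums pass to the limit, so neither limit factor is
    zero.\<close>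
  have nz: "p \<noteq> 0" if "poly2_tendsto q p" "\<And>n. (\<Sum>a\<le>N. \<Sum>b\<le>K. norm (coeff (coeff (q n) a) b)) = 1" for p q
  proof
    assume "p = 0"
    then have "(\<lambda>n. \<Sum>a\<le>N. \<Sum>b\<le>K. norm (coeff (coeff (q n) a) b)) \<longlonglongrightarrow> (\<Sum>a\<le>N. \<Sum>b\<le>K. norm (0::complex))"
      using that(1) unfolding poly2_tendsto_def poly_tendsto_def by (intro tendsto_intros) auto
    then show False using that(2) by (simp add: LIMSEQ_const_iff)
  qed
  have P0: "P True \<noteq> 0" "P False \<noteq> 0" using nz[OF limG] nz[OF limH] x(2) y(2) by blast+
  \<comment> \<open>The scalar that undoes both rescalings. Comparing one coefficient at which the
    limit of the product is nonzero shows that \<open>c\<close> converges, so it can be absorbed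
    into the second factor.\<close>
  define c where "c n = 1 / (x (r n) * y (r n))" for n
  have limGH: "poly2_tendsto (\<lambda>n. smult [:x (r n):] (G (r n)) * smult [:y (r n):] (H (r n))) (P True * P False)"
    by (rule poly2_tendsto_mult[OF limG limH])
  have limD: "poly2_tendsto (\<lambda>n. D (r n)) L" by (rule poly2_tendsto_subseq[OF lim r])
  have Dc: "D (r n) = smult [:c n:] (smult [:x (r n):] (G (r n)) * smult [:y (r n):] (H (r n)))" for n
    using x(1)[of "r n"] y(1)[of "r n"] by (simp add: D c_def flip: one_pCons)
  have "lead_coeff (P True * P False) \<noteq> 0" using P0 by (metis leading_coeff_0_iff mult_eq_0_iff)
  then obtain a b where ab: "coeff (coeff (P True * P False) a) b \<noteq> 0" by (metis leading_coeff_0_iff)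
  define X where "X n = coeff (coeff (smult [:x (r n):] (G (r n)) * smult [:y (r n):] (H (r n))) a) b" for n
  have X: "X \<longlonglongrightarrow> coeff (coeff (P True * P False) a) b"
    using limGH unfolding poly2_tendsto_def poly_tendsto_def X_def by blast
  have cX: "coeff (coeff (D (r n)) a) b = c n * X n" for n unfolding Dc X_def by simp
  have "(\<lambda>n. c n * X n) \<longlonglongrightarrow> coeff (coeff L a) b"
    using limD unfolding poly2_tendsto_def poly_tendsto_def cX[symmetric] by blast
  then have "(\<lambda>n. c n * X n / X n) \<longlonglongrightarrow> coeff (coeff L a) b / coeff (coeff (P True * P False) a) b"
    using X ab by (intro tendsto_divide) auto
  moreover have "\<forall>\<^sub>F n in sequentially. c n * X n / X n = c n"
    using tendsto_imp_eventually_ne[OF X ab] by (rule eventually_mono) simp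
  ultimately have c: "c \<longlonglongrightarrow> coeff (coeff L a) b / coeff (coeff (P True * P False) a) b" (is "_ \<longlonglongrightarrow> ?c")
    by (rule Lim_transform_eventually)
  have limH2: "poly2_tendsto (\<lambda>n. smult [:c n * y (r n):] (H (r n))) (smult [:?c:] (P False))"
    using poly2_tendsto_smult[OF c limH] by (simp add: mult.commute)
  have "poly2_tendsto (\<lambda>n. D (r n)) (P True * smult [:?c:] (P False))"
    using poly2_tendsto_mult[OF limG poly2_tendsto_smult[OF c limH]] unfolding Dc by (simp add: mult_ac)
  then have "L = P True * smult [:?c:] (P False)" using poly2_tendsto_unique[OF limD] by blast
  then show ?thesis using that[OF r limG limH2] by blast
qed

lemma no_nonzero_roots_imp_monom:
  fixes d :: "complex poly"
  assumes "\<And>s. s \<noteq> 0 \<Longrightarrow> poly d s \<noteq> 0"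
  obtains a j where "a \<noteq> 0" "d = monom a j"
proof -
  have d0: "d \<noteq> 0" using assms[of 1] by auto
  obtain k e where e: "d = [:-0,1:] ^ k * e" "\<not> [:-0,1:] dvd e" using order_decomp[OF d0] by blast
  have "poly e z \<noteq> 0" for z
  proof
    assume z: "poly e z = 0"
    then have "z = 0" using assms[of z] unfolding e(1) by auto
    then show False using e(2) z by (metis poly_eq_0_iff_dvd)
  qed
  then have "degree e = 0" by (metis fundamental_theorem_of_algebra constant_degree)
  then obtain a where a: "e = [:a:]" by (rule degree_eq_zeroE)
  have d: "d = monom a k" using e a by (simp add: monom_altdef mult.commute)
  then show ?thesis using that[of a k] d0 by auto
qed

lemma dvd_monomE:
  fixes d :: "complex poly"
  assumes "d dvd monom c J" "c \<noteq> 0"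
  obtains a j where "a \<noteq> 0" "j \<le> J" "d = monom a j"
proof -
  obtain e where e: "monom c J = d * e" using assms(1) by (rule dvdE)
  have "poly d s \<noteq> 0" if "s \<noteq> 0" for s
  proof
    assume "poly d s = 0"
    then have "poly (monom c J) s = 0" by (simp add: e)
    then show False using that assms(2) by (simp add: poly_monom)
  qed
  then obtain a j where a: "a \<noteq> 0" "d = monom a j" using no_nonzero_roots_imp_monom by blast
  have "monom c J \<noteq> 0" using assms(2) by simp
  then have "j \<le> J" using dvd_imp_degree_le[OF assms(1)] assms(2) a by (simp add: degree_monom_eq)
  then show ?thesis using that a by blast
qed

text \<open>
  If \<open>p\<close> is a fixed nonzero polynomial, then its divisors fall into finitely many classes up to
  scaling, so a convergent sequence of (rescaled) divisors is eventually proportional to its limit.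
\<close>

lemma divisors_limit:
  fixes p L :: "complex poly"
  assumes "p \<noteq> 0" and dv: "\<And>n. d n dvd p" and lim: "poly_tendsto (\<lambda>n. smult (h n) (d n)) L" and "L \<noteq> 0"
  shows "infinite {n. \<exists>c. c \<noteq> 0 \<and> d n = smult c L}"
proof -
  have d0: "d n \<noteq> 0" for n using assms(1) dv[of n] by auto
  define U where "U n = smult (inverse (lead_coeff (d n))) (d n)" for n
  have dU: "d n = smult (lead_coeff (d n)) (U n)" for n using d0[of n] by (simp add: U_def)
  have "U n dvd p \<and> lead_coeff (U n) = 1" for n
    using dv[of n] d0[of n] by (simp add: U_def smult_dvd)
  then have "range U \<subseteq> {d. d dvd p \<and> lead_coeff d = 1}" by auto
  then have fin: "finite (range U)" using finite_monic_divisors[OF assms(1)] by (rule finite_subset)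
  then obtain n0 where inf: "infinite {n. U n = U n0}"
    using pigeonhole_infinite[of "UNIV :: nat set" U] by auto
  define V where "V = U n0"
  define S where "S = {n. U n = V}"
  have infS: "infinite S" using inf by (simp add: S_def V_def)
  define r where "r = enumerate S"
  have r: "strict_mono r" unfolding r_def by (rule strict_mono_enumerate[OF infS])
  have rS: "U (r n) = V" for n using enumerate_in_set[OF infS, of n] by (simp add: S_def r_def)
  define k where "k n = h (r n) * lead_coeff (d (r n))" for n
  have kV: "smult (h (r n)) (d (r n)) = smult (k n) V" for n
    by (subst dU) (simp add: rS k_def)
  have limk: "(\<lambda>n. k n * coeff V b) \<longlonglongrightarrow> coeff L b" for b
  proof -
    have "(\<lambda>n. coeff (smult (h n) (d n)) b) \<longlonglongrightarrow> coeff L b" using lim by (simp add: poly_tendsto_def)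
    from LIMSEQ_subseq_LIMSEQ[OF this r] show ?thesis by (simp add: o_def kV flip: coeff_smult)
  qed
  have lV: "lead_coeff V = 1" using d0[of n0] unfolding V_def U_def by simp
  have k: "k \<longlonglongrightarrow> coeff L (degree V)" using limk[of "degree V"] lV by simp
  have L: "L = smult (coeff L (degree V)) V"
    by (rule poly_eqI, unfold coeff_smult) (rule LIMSEQ_unique[OF limk tendsto_mult_right[OF k]])
  define q where "q = coeff L (degree V)"
  have q0: "q \<noteq> 0" using L assms(4) by (auto simp: q_def)
  have V: "V = smult (inverse q) L" using L q0 by (metis q_def smult_smult left_inverse smult_1_left)
  have "S \<subseteq> {n. \<exists>c. c \<noteq> 0 \<and> d n = smult c L}"
  proof
    fix n assume "n \<in> S"
    then have "d n = smult (lead_coeff (d n) * inverse q) L" using dU[of n] V by (simp add: S_def)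
    moreover have "lead_coeff (d n) * inverse q \<noteq> 0" using d0[of n] q0 by simp
    ultimately show "n \<in> {n. \<exists>c. c \<noteq> 0 \<and> d n = smult c L}" by blast
  qed
  then show ?thesis using infS finite_subset by blast
qed

section \<open>Pencils over an irreducible polynomial\<close>

lemma coeff_poly_const: "coeff (poly T [:x:]) b = poly (map_poly (\<lambda>c. coeff c b) T) x"
  by (induction T) (auto simp: map_poly_pCons)

lemma smult_sum: "smult c (sum f A) = (\<Sum>i\<in>A. smult c (f i))"
  by (induction A rule: infinite_finite_induct) (auto simp: smult_add_right)

lemma root_imp_linear:
  fixes F :: "complex poly poly"
  assumes "irreducible F" "lead_coeff F = 1" "poly F f = 0"
  shows "F = [:-f, 1:]"
proof -
  obtain R where R: "F = [:-f,1:] * R" using assms(3) by (metis poly_eq_0_iff_dvd dvdE)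
  have "\<not> [:-f,1:] dvd 1"
  proof
    assume "[:-f,1:] dvd 1"
    then have "degree [:-f,1:] \<le> degree (1 :: complex poly poly)" by (intro dvd_imp_degree_le) auto
    then show False by simp
  qed
  then have "R dvd 1" using irreducibleD[OF assms(1) R] by blast
  then have "degree R = 0" using dvd_imp_degree_le[of R 1] by simp
  then obtain a where a: "R = [:a:]" by (rule degree_eq_zeroE)
  have "lead_coeff R = 1" using assms(2) unfolding R lead_coeff_mult by simp
  then show ?thesis using R a by (simp add: one_pCons)
qed

text \<open>Each coefficient of \<open>poly F (e + monom d i)\<close> is a polynomial in
  \<open>d\<close>. Those of degree other than \<open>J\<close> vanish for infinitely many
  \<open>d\<close>, hence identically, while the one of degree \<open>J\<close> is not constant and
  has a zero. There \<open>F\<close> has a root in the coefficient ring, and an irreducible monic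
  polynomial with a root is linear.\<close>

lemma constant_on_line_imp_linear:
  fixes F :: "complex poly poly"
  assumes irr: "irreducible F" and monic: "lead_coeff F = 1"
    and inf: "infinite {c. \<exists>d. poly F (e + monom d i) = monom c J}"
  shows "\<exists>f. F = [:-f, 1:]"
proof -
  define T where "T = pcompose F [:e, monom 1 i:]"
  have T: "poly T [:d:] = poly F (e + monom d i)" for d
    by (simp add: T_def poly_pcompose smult_monom)
  define q where "q b = map_poly (\<lambda>c. coeff c b) T" for b
  have q: "coeff (poly F (e + monom d i)) b = poly (q b) d" for d b
    unfolding T[symmetric] q_def by (rule coeff_poly_const)
  define S where "S = {d. \<exists>c. poly F (e + monom d i) = monom c J}"
  have sub: "{c. \<exists>d. poly F (e + monom d i) = monom c J} \<subseteq> poly (q J) ` S"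
  proof
    fix c assume "c \<in> {c. \<exists>d. poly F (e + monom d i) = monom c J}"
    then obtain d where d: "poly F (e + monom d i) = monom c J" by blast
    then have "poly (q J) d = c" using q[of d J] by simp
    then show "c \<in> poly (q J) ` S" using d S_def by blast
  qed
  then have infS: "infinite S" using inf by (meson finite_imageI finite_subset)
  have q0: "q b = 0" if b: "b \<noteq> J" for b
  proof (rule ccontr)
    assume "q b \<noteq> 0"
    then have "finite {d. poly (q b) d = 0}" by (rule poly_roots_finite)
    moreover have "S \<subseteq> {d. poly (q b) d = 0}"
    proof
      fix d assume "d \<in> S"
      then obtain c where "poly F (e + monom d i) = monom c J" by (auto simp: S_def)
      then show "d \<in> {d. poly (q b) d = 0}" using q[of d b] b by simp
    qed
    ultimately show False using infS by (meson finite_subset)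
  qed
  have "degree (q J) \<noteq> 0"
  proof
    assume "degree (q J) = 0"
    then obtain a where "q J = [:a:]" by (rule degree_eq_zeroE)
    then have "poly (q J) ` S \<subseteq> {a}" by auto
    then show False using sub inf by (meson finite.emptyI finite_insert finite_subset)
  qed
  then obtain d where d: "poly (q J) d = 0" by (metis fundamental_theorem_of_algebra constant_degree)
  have "poly F (e + monom d i) = 0"
    by (rule poly_eqI) (use q q0 d in \<open>metis coeff_0 poly_0\<close>)
  then show ?thesis using root_imp_linear[OF irr monic] by blast
qed

text \<open>For two arguments \<open>e\<close>, \<open>e0\<close> the difference
  \<open>e - e0\<close> divides the difference of the values, which is a monomial of degree
  \<open>J\<close>. So \<open>e - e0\<close> is a monomial of degree at most \<open>J\<close>; by
  the pigeonhole principle one degree \<open>i\<close> serves infinitely many values, and the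
  arguments lie on a line.\<close>

lemma monomial_values_imp_linear:
  fixes F :: "complex poly poly"
  assumes irr: "irreducible F" and monic: "lead_coeff F = 1"
    and inf: "infinite {c. \<exists>e. poly F e = monom c J}"
  shows "\<exists>f. F = [:-f, 1:]"
proof -
  define C where "C = {c. \<exists>e. poly F e = monom c J}"
  obtain c0 where c0: "c0 \<in> C" using inf unfolding C_def by (metis finite.emptyI ex_in_conv)
  then obtain e0 where e0: "poly F e0 = monom c0 J" by (auto simp: C_def)
  have "\<exists>i\<le>J. \<exists>d. poly F (e0 + monom d i) = monom c J" if c: "c \<in> C - {c0}" for c
  proof -
    obtain e where e: "poly F e = monom c J" using c by (auto simp: C_def)
    have "[:-e0, 1:] dvd F - [:poly F e0:]" by (simp flip: poly_eq_0_iff_dvd)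
    then obtain R where R: "F - [:poly F e0:] = [:-e0,1:] * R" by (rule dvdE)
    have "poly (F - [:poly F e0:]) e = (e - e0) * poly R e" unfolding R by (simp add: algebra_simps)
    then have "monom (c - c0) J = (e - e0) * poly R e" using e e0 by (simp add: diff_monom)
    then have "e - e0 dvd monom (c - c0) J" by simp
    then obtain d i where "i \<le> J" "e - e0 = monom d i" using c by (auto elim!: dvd_monomE)
    then have "i \<le> J" "e = e0 + monom d i" by (simp_all add: algebra_simps)
    then show ?thesis using e by blast
  qed
  then obtain i where i: "\<And>c. c \<in> C - {c0} \<Longrightarrow> i c \<le> J \<and> (\<exists>d. poly F (e0 + monom d (i c)) = monom c J)"
    by metis
  have infC: "infinite (C - {c0})" using inf by (simp add: C_def)
  have "finite (i ` (C - {c0}))" by (rule finite_subset[of _ "{..J}"]) (use i in auto)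
  then obtain a where a: "infinite {c \<in> C - {c0}. i c = i a}"
    using pigeonhole_infinite[OF infC] by blast
  have "{c \<in> C - {c0}. i c = i a} \<subseteq> {c. \<exists>d. poly F (e0 + monom d (i a)) = monom c J}" using i by fastforce
  then have "infinite {c. \<exists>d. poly F (e0 + monom d (i a)) = monom c J}" using a finite_subset by blast
  then show ?thesis by (rule constant_on_line_imp_linear[OF irr monic])
qed

text \<open>Divided by \<open>v\<close>, the pencil tends to the coefficient of \<open>v\<close> as
  \<open>v\<close> tends to infinity. The monic factors of its members have bounded degrees in both
  variables, so suitably rescaled factors converge along a subsequence.\<close>

lemma reducible_pencil_limit:
  fixes D :: "complex \<Rightarrow> complex poly poly"
  assumes monic: "\<And>v. lead_coeff (D v) = 1" and deg: "\<And>v. degree (D v) = m" and m: "m \<ge> 1"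
    and affine: "\<And>v. D v = A - [:monom v M:] * B" and B: "B \<noteq> 0"
    and red: "\<And>v. \<not> irreducible (D v)"
  obtains v G H g G' h H' where "\<And>i :: nat. D (v i) = G i * H i"
    "\<And>i. lead_coeff (G i) = 1" "\<And>i. lead_coeff (H i) = 1"
    "\<And>i. degree (G i) \<ge> 1" "\<And>i. degree (H i) \<ge> 1" "\<And>i. degree (G i) \<le> m" "\<And>i. degree (H i) \<le> m"
    "poly2_tendsto (\<lambda>i. smult [:g i:] (G i)) G'" "poly2_tendsto (\<lambda>i. smult [:h i:] (H i)) H'"
    "[:monom (-1) M:] * B = G' * H'"
proof -
  have "\<exists>K. \<forall>v. sdeg_le K (D v)"
  proof -
    obtain kA where kA: "sdeg_le kA A" using sdeg_le_exists by blast
    obtain kB where kB: "sdeg_le kB B" using sdeg_le_exists by blast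
    have "sdeg_le M [:monom v M:]" for v :: complex
      by (auto simp: sdeg_le_def coeff_pCons degree_monom_le split: nat.splits)
    then have k1: "sdeg_le (M + kB) ([:monom v M:] * B)" for v using kB by (rule sdeg_le_mult)
    then have "sdeg_le (kA + (M + kB)) (D v)" for v unfolding affine
      by (intro sdeg_le_diff sdeg_le_mono[OF kA] sdeg_le_mono[OF k1]) simp_all
    then show ?thesis by blast
  qed
  then obtain K where K: "\<And>v. sdeg_le K (D v)" by blast
  define w :: "nat \<Rightarrow> complex" where "w i = of_nat (Suc i)" for i
  have w0: "w i \<noteq> 0" for i unfolding w_def by (simp only: of_nat_eq_0_iff)
  have "\<forall>i. \<exists>G H. D (w i) = G * H \<and> lead_coeff G = 1 \<and> lead_coeff H = 1 \<and> degree G \<ge> 1 \<and> degree H \<ge> 1"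
  proof
    fix i
    obtain G H where "D (w i) = G * H" "lead_coeff G = 1" "lead_coeff H = 1" "degree G \<ge> 1" "degree H \<ge> 1"
      by (rule monic_not_irreducible_factors[of "D (w i)"]) (use monic deg m red in auto)
    then show "\<exists>G H. D (w i) = G * H \<and> lead_coeff G = 1 \<and> lead_coeff H = 1 \<and> degree G \<ge> 1 \<and> degree H \<ge> 1" by blast
  qed
  then obtain G H where GH: "\<And>i. D (w i) = G i * H i" "\<And>i. lead_coeff (G i) = 1" "\<And>i. lead_coeff (H i) = 1"
    "\<And>i. degree (G i) \<ge> 1" "\<And>i. degree (H i) \<ge> 1" by metis
  have nz: "G i \<noteq> 0" "H i \<noteq> 0" for i using GH(4,5)[of i] by auto
  have degs: "degree (G i) \<le> m" "degree (H i) \<le> m" for i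
    using deg[of "w i"] degree_mult_eq[OF nz, of i i] GH(1)[of i] by auto
  have Ks: "sdeg_le K (G i)" "sdeg_le K (H i)" for i
    using sdeg_le_factor[of K "G i" "H i"] sdeg_le_factor[of K "H i" "G i"] K[of "w i"] GH(1)[of i] nz[of i]
    by (auto simp: mult.commute)
  have winv: "(\<lambda>i. inverse (w i)) \<longlonglongrightarrow> 0"
    unfolding w_def by (rule LIMSEQ_Suc[OF lim_inverse_n])
  define L where "L = [:monom (-1) M:] * B"
  have limD: "poly2_tendsto (\<lambda>i. smult [:inverse (w i):] (D (w i))) L"
    unfolding poly2_tendsto_def poly_tendsto_def
  proof (intro allI)
    fix c d
    have split: "smult [:inverse v:] (D v) = smult [:inverse v:] A + L" if "v \<noteq> 0" for v
    proof -
      have "smult [:inverse v:] ([:monom v M:] * B) = - L"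
        using that by (simp add: smult_monom minus_monom[symmetric] L_def)
      then show ?thesis unfolding affine smult_diff_right by simp
    qed
    have "(\<lambda>i. inverse (w i) * coeff (coeff A c) d + coeff (coeff L c) d)
        \<longlonglongrightarrow> 0 * coeff (coeff A c) d + coeff (coeff L c) d"
      by (intro tendsto_intros winv)
    then show "(\<lambda>i. coeff (coeff (smult [:inverse (w i):] (D (w i))) c) d) \<longlonglongrightarrow> coeff (coeff L c) d"
      unfolding split[OF w0] by simp
  qed
  have L0: "L \<noteq> 0" using B by (simp add: L_def)
  \<comment> \<open>The scalar is put on the second factor, so that the product is the normalized
    member of the pencil.\<close>
  let ?H = "\<lambda>i. smult [:inverse (w i):] (H i)"
  obtain r g h G' H' where lim: "strict_mono r"
    "poly2_tendsto (\<lambda>n. smult [:g n:] (G (r n))) G'" "poly2_tendsto (\<lambda>n. smult [:h n:] (?H (r n))) H'"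
    "L = G' * H'"
  proof (rule factor_limit[where G = G and H = ?H and N = m and K = K, OF _ _ _ _ _ _ _ limD L0])
    show "sdeg_le K (?H n)" for n using Ks(2)[of n] unfolding sdeg_le_def
      by (simp add: order_trans[OF degree_smult_le])
  qed (use GH nz degs Ks w0 in auto)
  show ?thesis
    by (rule that[of "\<lambda>i. w (r i)" "\<lambda>i. G (r i)" "\<lambda>i. H (r i)" g G' "\<lambda>i. h i * inverse (w (r i))" H'])
       (use GH degs lim L_def in \<open>simp_all add: mult.commute\<close>)
qed

text \<open>
  In the limit \<open>v \<rightarrow> \<infinity>\<close> the pencil becomes a monomial times \<open>F\<close>; as \<open>F\<close> is irreducible, one of the two
  factors must be linear, \<open>x - e\<close> say, and then \<open>F(e)\<close> divides a fixed polynomial in \<open>s\<close>.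
\<close>

lemma pencil_linear_factors:
  fixes F Q :: "complex poly poly" and D :: "nat \<Rightarrow> complex poly poly"
  assumes irr: "irreducible F" and monic: "lead_coeff F = 1" and n: "degree F \<ge> 1"
    and DGH: "\<And>i. D i = G i * H i"
    and GH: "\<And>i. lead_coeff (H i) = 1" "\<And>i. degree (H i) \<ge> 1" "\<And>i. degree (D i) = Suc (degree F)" "\<And>i. G i \<noteq> 0"
    and lim: "poly2_tendsto (\<lambda>i. smult [:g i:] (G i)) G'" "poly2_tendsto (\<lambda>i. smult [:h i:] (H i)) H'"
    and L: "[:monom (-1) M:] * F = G' * H'" and FG: "F dvd G'"
  obtains i0 e t a j where "a \<noteq> 0" "\<And>i. i \<ge> i0 \<Longrightarrow> poly (D i) (e i) = 0"
    "t \<longlonglongrightarrow> 0" "poly_tendsto (\<lambda>i. smult (t i) (e i)) (monom a j)"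
proof -
  have F0: "F \<noteq> 0" using irr by auto
  obtain K where K: "G' = F * K" using FG by (rule dvdE)
  \<comment> \<open>All of \<open>F\<close> goes into \<open>G'\<close>, so \<open>H'\<close>
    divides a power of \<open>s\<close> and is free of \<open>x\<close>. Since \<open>G i\<close>
    eventually has at least the degree of its rescaled limit, \<open>H i\<close> is eventually
    linear.\<close>
  have KH: "K * H' = [:monom (-1) M:]"
  proof -
    have "F * (K * H') = F * [:monom (-1) M:]" using L K by (metis mult.assoc mult.commute)
    then show ?thesis using F0 by (metis mult_left_cancel)
  qed
  have nz: "K \<noteq> 0" "H' \<noteq> 0" using KH by auto
  have "degree K + degree H' = 0" using degree_mult_eq[OF nz] KH by simp
  then obtain k h' where kh: "K = [:k:]" "H' = [:h':]" by (metis add_is_0 degree_eq_zeroE)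
  have "h' dvd monom (-1) M" proof -
    have "k * h' = monom (-1) M" using KH unfolding kh by (simp add: mult.commute)
    then show ?thesis by (metis dvd_triv_right)
  qed
  then obtain a j where a: "a \<noteq> 0" "h' = monom a j" by (auto elim: dvd_monomE)
  have degG': "degree F \<le> degree G'" using K nz by (simp add: degree_mult_eq F0)
  have "\<forall>\<^sub>F i in sequentially. degree G' \<le> degree (smult [:g i:] (G i))" by (rule poly2_tendsto_degree[OF lim(1)])
  then obtain i0 where i0: "\<And>i. i \<ge> i0 \<Longrightarrow> degree G' \<le> degree (smult [:g i:] (G i))"
    unfolding eventually_sequentially by blast
  define e where "e i = - coeff (H i) 0" for i
  define t where "t i = - h i" for i
  have Hlin: "H i = [:- e i, 1:]" if "i \<ge> i0" for i
  proof -
    have "degree F \<le> degree (G i)" using i0[OF that] degG' by (meson degree_smult_le order_trans)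
    moreover have "degree (D i) = degree (G i) + degree (H i)"
      unfolding DGH using GH(1)[of i] GH(4)[of i] by (intro degree_mult_eq) auto
    ultimately have "degree (H i) = 1" using GH(2,3)[of i] by linarith
    then show ?thesis using GH(1)[of i]
      by (intro poly_eqI) (auto simp: e_def coeff_pCons coeff_eq_0 split: nat.split)
  qed
  have ev: "poly (D i) (e i) = 0" if "i \<ge> i0" for i
    unfolding DGH poly_mult Hlin[OF that] by simp
  have "(\<lambda>i. coeff (coeff (smult [:h i:] (H i)) 1) 0) \<longlonglongrightarrow> coeff (coeff H' 1) 0"
    using lim(2) by (simp add: poly2_tendsto_def poly_tendsto_def)
  moreover have "\<forall>\<^sub>F i in sequentially. coeff (coeff (smult [:h i:] (H i)) 1) 0 = h i"
    unfolding eventually_sequentially using Hlin by (intro exI[of _ i0]) auto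
  ultimately have "h \<longlonglongrightarrow> coeff (coeff H' 1) 0" by (rule Lim_transform_eventually)
  \<comment> \<open>\<open>h i\<close> is eventually the leading coefficient of the rescaled linear
    factor, whose limit \<open>H'\<close> has no term in \<open>x\<close>.\<close>
  then have "h \<longlonglongrightarrow> 0" using kh by simp
  then have t: "t \<longlonglongrightarrow> 0" unfolding t_def using tendsto_minus by fastforce
  have "poly_tendsto (\<lambda>i. coeff (smult [:h i:] (H i)) 0) (coeff H' 0)"
    using lim(2) by (simp add: poly2_tendsto_def)
  then have "poly_tendsto (\<lambda>i. smult (t i) (e i)) (monom a j)"
    using a kh by (simp add: e_def t_def)
  then show ?thesis using that[OF a(1) ev t] by blast
qed

text \<open>The roots satisfy \<open>(e - l - v s^M) F(e) = Q(e)\<close>, and elimination between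
  \<open>F\<close> and \<open>Q\<close> makes every \<open>F(e)\<close> divide one polynomial
  \<open>\<rho>\<close>. Rescaled, these values tend to a monomial, so infinitely many of them are
  multiples of it, with infinitely many different scalars; hence \<open>F\<close> is linear. Then
  \<open>e = f + c s^j\<close>, and comparing coefficients for infinitely many \<open>c\<close>
  leaves only monomials of degrees \<open>M\<close> and \<open>2 M\<close>.\<close>

lemma pencil_reducible:
  fixes F Q :: "complex poly poly" and l :: "complex poly"
  assumes irr: "irreducible F" and monic: "lead_coeff F = 1" and n: "degree F \<ge> 1"
    and Q: "Q \<noteq> 0" "degree Q < degree F"
    and red: "\<And>v. \<not> irreducible ([:- (l + monom v M), 1:] * F - Q)"
  shows "\<exists>f. F = [:-f, 1:] \<and> (\<exists>c. f - l = monom c M) \<and> (\<exists>c. Q = [:monom c (2 * M):])"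
proof -
  define D where "D v = [:- (l + monom v M), 1:] * F - Q" for v
  have F0: "F \<noteq> 0" using irr by auto
  have lin: "degree ([:- (l + monom v M), 1:] * F) = Suc (degree F)" for v
    using F0 by (subst degree_mult_eq) auto
  have degD: "degree (D v) = Suc (degree F)" for v
  proof -
    have "degree (- Q) < degree ([:- (l + monom v M), 1:] * F)" using Q(2) unfolding lin by simp
    then show ?thesis unfolding D_def using lin[of v] degree_add_eq_left[of "- Q" "[:- (l + monom v M), 1:] * F"] by simp
  qed
  have "coeff ([:- (l + monom v M), 1:] * F) (Suc (degree F)) = 1" for v
    using lin[of v] lead_coeff_mult[of "[:- (l + monom v M), 1:]" F] monic by simp
  then have monD: "lead_coeff (D v) = 1" for v
    unfolding degD using Q(2) by (simp add: D_def coeff_eq_0)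
  have affine: "D v = ([:-l, 1:] * F - Q) - [:monom v M:] * F" for v
  proof -
    have "[:- (l + monom v M), 1:] = [:-l, 1:] - [:monom v M:]" by simp
    moreover have "a - c - b = a - b - c" for a b c :: "complex poly poly" by simp
    ultimately show ?thesis by (simp only: D_def left_diff_distrib)
  qed
  have redD: "\<not> irreducible (D v)" for v using red by (simp only: D_def not_False_eq_True)
  have "1 \<le> Suc (degree F)" by simp
  note lim = reducible_pencil_limit[OF monD degD this affine F0 redD]
  obtain w G H g G' h H' where GH: "\<And>i :: nat. D (w i) = G i * H i" "\<And>i. lead_coeff (G i) = 1"
    "\<And>i. lead_coeff (H i) = 1" "\<And>i. degree (G i) \<ge> 1" "\<And>i. degree (H i) \<ge> 1"
    and "\<And>i. degree (G i) \<le> Suc (degree F)" "\<And>i. degree (H i) \<le> Suc (degree F)"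
    and r: "poly2_tendsto (\<lambda>i. smult [:g i:] (G i)) G'" "poly2_tendsto (\<lambda>i. smult [:h i:] (H i)) H'"
      "[:monom (-1) M:] * F = G' * H'"
    by (rule lim) (rule that)
  have nz: "G i \<noteq> 0" "H i \<noteq> 0" for i using GH(4,5)[of i] by auto
  have prime: "prime_elem F" using irr by (simp add: prime_elem_iff_irreducible)
  have "F dvd G' * H'" unfolding r(3)[symmetric] by (rule dvd_triv_right)
  then consider "F dvd G'" | "F dvd H'" using prime by (auto simp: prime_elem_dvd_mult_iff)
  then have "\<exists>i0 e t a j. a \<noteq> 0 \<and> (\<forall>i\<ge>i0. poly (D (w i)) (e i) = 0) \<and> t \<longlonglongrightarrow> 0 \<and>
    poly_tendsto (\<lambda>i. smult (t i) (e i)) (monom a j)"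
  proof cases
    case 1
    show ?thesis
      by (rule pencil_linear_factors[OF irr monic n, of "\<lambda>i. D (w i)" "\<lambda>i. G i" "\<lambda>i. H i" g G' h H' M])
         (use 1 r GH nz degD in blast)+
  next
    case 2
    show ?thesis
      by (rule pencil_linear_factors[OF irr monic n, of "\<lambda>i. D (w i)" "\<lambda>i. H i" "\<lambda>i. G i" h H' g G' M])
         (use 2 r GH nz degD in \<open>blast | simp add: mult.commute\<close>)+
  qed
  then obtain i0 e t a j where a0: "a \<noteq> 0" and root: "\<And>i. i \<ge> i0 \<Longrightarrow> poly (D (w i)) (e i) = 0"
    and t: "t \<longlonglongrightarrow> 0" and e: "poly_tendsto (\<lambda>i. smult (t i) (e i)) (monom a j)" by blast
  have FQ: "(e i - l - monom (w i) M) * poly F (e i) = poly Q (e i)" if "i \<ge> i0" for i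
    using root[OF that] by (simp add: D_def algebra_simps)
  have "\<not> F dvd Q" using Q by (meson dvd_imp_degree_le not_le)
  then obtain u u' \<rho> where bez: "u * F + u' * Q = [:\<rho>:]" and \<rho>: "\<rho> \<noteq> 0" using bezout_irreducible[OF irr n] by blast
  have Fdvd: "poly F (e i) dvd \<rho>" if "i \<ge> i0" for i
  proof -
    define X where "X = e i - l - monom (w i) M"
    have "poly (u * F + u' * Q) (e i) = \<rho>" using bez by simp
    then have "poly u (e i) * poly F (e i) + poly u' (e i) * (X * poly F (e i)) = \<rho>"
      using FQ[OF that] by (simp add: X_def)
    then have "poly F (e i) * (poly u (e i) + poly u' (e i) * X) = \<rho>" by (simp add: algebra_simps)
    then show ?thesis by (metis dvd_triv_left)
  qed
  define n0 where "n0 = degree F"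
  define J where "J = n0 * j"
  \<comment> \<open>The leading term of \<open>F\<close> dominates: every other term carries a
    positive power of \<open>t i\<close>, which tends to 0.\<close>
  have limF: "poly_tendsto (\<lambda>i. smult (t i ^ n0) (poly F (e i))) (monom (a ^ n0) J)"
  proof -
    have "smult (t i ^ n0) (poly F (e i)) = (\<Sum>k\<le>n0. smult (t i ^ (n0 - k)) (coeff F k) * smult (t i) (e i) ^ k)" for i
      unfolding poly_altdef n0_def smult_sum
      by (intro sum.cong refl) (simp add: smult_power power_add[symmetric])
    moreover have "poly_tendsto (\<lambda>i. (\<Sum>k\<le>n0. smult (t i ^ (n0 - k)) (coeff F k) * smult (t i) (e i) ^ k))
      (\<Sum>k\<le>n0. smult (0 ^ (n0 - k)) (coeff F k) * monom a j ^ k)"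
      by (intro poly_tendsto_sum poly_tendsto_mult poly_tendsto_smult poly_tendsto_power e poly_tendsto_const tendsto_power t)
    moreover have "(\<Sum>k\<le>n0. smult (0 ^ (n0 - k)) (coeff F k) * monom a j ^ k) = monom (a ^ n0) J"
    proof -
      have "(\<Sum>k\<le>n0. smult (0 ^ (n0 - k)) (coeff F k) * monom a j ^ k) = (\<Sum>k\<in>{n0}. smult (0 ^ (n0 - k)) (coeff F k) * monom a j ^ k)"
        by (rule sum.mono_neutral_right) (auto simp: power_0_left)
      then show ?thesis using monic by (simp add: n0_def monom_power J_def mult.commute)
    qed
    ultimately show ?thesis by simp
  qed
  have mono0: "monom (a ^ n0) J \<noteq> 0" using a0 by simp
  define C where "C = {c. \<exists>e v. c \<noteq> 0 \<and> poly F e = monom c J \<and> (e - l - monom v M) * poly F e = poly Q e}"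
  \<comment> \<open>With finitely many scalars the sequence \<open>c (s i)\<close> would be bounded,
    and its product with a power of \<open>t\<close> would tend to 0 instead of
    \<open>a ^ n0\<close>.\<close>
  have infC: "infinite C"
  proof
    assume fin: "finite C"
    define S where "S = {i. \<exists>c. c \<noteq> 0 \<and> poly F (e (i + i0)) = smult c (monom (a ^ n0) J)}"
    have "infinite S" unfolding S_def
    proof (rule divisors_limit[OF \<rho> _ _ mono0])
      show "poly F (e (i + i0)) dvd \<rho>" for i by (rule Fdvd) simp
      show "poly_tendsto (\<lambda>i. smult (t (i + i0) ^ n0) (poly F (e (i + i0)))) (monom (a ^ n0) J)"
        using limF unfolding poly_tendsto_def by (intro allI LIMSEQ_ignore_initial_segment[where k = i0]) auto
    qed
    define c where "c i = coeff (poly F (e (i + i0))) J" for i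
    have cC: "c i \<in> C" if "i \<in> S" for i
      using that FQ[of "i + i0"] a0 by (auto simp: S_def C_def c_def smult_monom)
    have "(\<lambda>i. t i ^ n0 * coeff (poly F (e i)) J) \<longlonglongrightarrow> a ^ n0"
      using limF unfolding poly_tendsto_def by (auto dest!: spec[of _ J])
    then have lim1: "(\<lambda>i. t (i + i0) ^ n0 * c i) \<longlonglongrightarrow> a ^ n0"
      unfolding c_def by (rule LIMSEQ_ignore_initial_segment)
    define s where "s = enumerate S"
    have s: "strict_mono s" "\<And>i. s i \<in> S" unfolding s_def using \<open>infinite S\<close>
      by (auto intro: strict_mono_enumerate enumerate_in_set)
    have lim2: "(\<lambda>i. t (s i + i0) ^ n0 * c (s i)) \<longlonglongrightarrow> a ^ n0"
      using LIMSEQ_subseq_LIMSEQ[OF lim1 s(1)] by (simp add: o_def)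
    have "(\<lambda>i. t (i + i0) ^ n0) \<longlonglongrightarrow> 0 ^ n0"
      by (intro tendsto_power LIMSEQ_ignore_initial_segment t)
    then have "(\<lambda>i. t (i + i0) ^ n0) \<longlonglongrightarrow> 0" using n by (simp add: n0_def power_0_left)
    from LIMSEQ_subseq_LIMSEQ[OF this s(1)]
    have lim3: "(\<lambda>i. t (s i + i0) ^ n0) \<longlonglongrightarrow> 0" by (simp add: o_def)
    have "finite (range (\<lambda>i. c (s i)))" using fin by (rule finite_subset[rotated]) (use cC s(2) in auto)
    then have "bounded (range (\<lambda>i. c (s i)))" by (rule finite_imp_bounded)
    then have "Bfun (\<lambda>i. c (s i)) sequentially" by (simp add: Bseq_eq_bounded)
    then have "(\<lambda>i. t (s i + i0) ^ n0 * c (s i)) \<longlonglongrightarrow> 0"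
      using lim3 unfolding tendsto_Zfun_iff by (simp add: bounded_bilinear.Zfun_prod_Bfun[OF bounded_bilinear_mult])
    then have "a ^ n0 = 0" using lim2 LIMSEQ_unique by blast
    then show False using a0 by simp
  qed
  have "C \<subseteq> {c. \<exists>e. poly F e = monom c J}" by (auto simp: C_def)
  then have "infinite {c. \<exists>e. poly F e = monom c J}" using infC finite_subset by blast
  then obtain f where f: "F = [:-f, 1:]" using monomial_values_imp_linear[OF irr monic] by blast
  then have "degree Q = 0" using Q(2) by simp
  then obtain q where q: "Q = [:q:]" by (rule degree_eq_zeroE)
  have J: "J = j" using f by (simp add: J_def n0_def)
  define p where "p = f - l"
  have eq: "\<exists>v. p * monom c j + monom (c ^ 2) (2 * j) - monom (v * c) (M + j) = q" if cC: "c \<in> C" for c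
  proof -
    obtain e v where ev: "c \<noteq> 0" "poly F e = monom c j" "(e - l - monom v M) * poly F e = poly Q e"
      using cC by (auto simp: C_def J)
    have "e = f + monom c j" using ev(2) f by (simp add: algebra_simps)
    then have "e - l - monom v M = p + monom c j - monom v M" by (simp add: p_def)
    then have "(p + monom c j - monom v M) * monom c j = q" using ev(2,3) q by simp
    then have "p * monom c j + monom (c ^ 2) (2 * j) - monom (v * c) (M + j) = q"
      by (simp add: algebra_simps mult_monom power2_eq_square mult_2 mult_2_right)
    then show ?thesis by blast
  qed
  have pc: "coeff (p * monom c j) m = c * (if j \<le> m then coeff p (m - j) else 0)" for c m
    by (subst mult.commute) (simp add: coeff_monom_mult)
  \<comment> \<open>If \<open>j \<noteq> M\<close>, the unknown \<open>v\<close> does not enter the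
    coefficient of degree \<open>2 * j\<close>, which becomes a monic quadratic equation satisfied
    by infinitely many \<open>c\<close>.\<close>
  have jM: "j = M"
  proof (rule ccontr)
    assume ne: "j \<noteq> M"
    have "poly [:- coeff q (2 * j), coeff p j, 1:] c = 0" if cC: "c \<in> C" for c
    proof -
      obtain v where "p * monom c j + monom (c ^ 2) (2 * j) - monom (v * c) (M + j) = q" using eq[OF cC] by blast
      then have "coeff (p * monom c j + monom (c ^ 2) (2 * j) - monom (v * c) (M + j)) (2 * j) = coeff q (2 * j)" by simp
      then have "c * coeff p j + c ^ 2 = coeff q (2 * j)" using ne by (simp add: pc)
      then show ?thesis by (simp add: power2_eq_square algebra_simps)
    qed
    then have "C \<subseteq> {c. poly [:- coeff q (2 * j), coeff p j, 1:] c = 0}" by blast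
    moreover have "finite {c. poly [:- coeff q (2 * j), coeff p j, 1:] c = 0}" by (rule poly_roots_finite) simp
    ultimately show False using infC finite_subset by blast
  qed
  obtain c1 where c1: "c1 \<in> C" using infC by (metis finite.emptyI ex_in_conv)
  have "infinite (C - {c1})" using infC by simp
  then obtain c2 where c2: "c2 \<in> C" "c2 \<noteq> c1" by (metis finite.emptyI ex_in_conv DiffE insertI1)
  have c0: "c1 \<noteq> 0" using c1 by (auto simp: C_def)
  have co: "c * (if j \<le> m then coeff p (m - j) else 0) = coeff q m" if cC: "c \<in> C" and m: "m \<noteq> 2 * j" for c m
  proof -
    obtain v where "p * monom c j + monom (c ^ 2) (2 * j) - monom (v * c) (M + j) = q" using eq[OF cC] by blast
    then have "coeff (p * monom c j + monom (c ^ 2) (2 * j) - monom (v * c) (M + j)) m = coeff q m" by simp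
    then show ?thesis using m jM pc[of c m] by simp
  qed
  \<comment> \<open>Outside degree \<open>2 * j\<close> a fixed coefficient of \<open>q\<close>
    equals \<open>c\<close> times a fixed coefficient of \<open>p\<close>, for every
    \<open>c\<close> in \<open>C\<close>; two different \<open>c\<close> make both vanish.\<close>
  have pz: "(if j \<le> m then coeff p (m - j) else 0) = 0" if "m \<noteq> 2 * j" for m
  proof -
    have "(c1 - c2) * (if j \<le> m then coeff p (m - j) else 0) = 0"
      using co[OF c1 that] co[OF c2(1) that] by (simp only: left_diff_distrib diff_self)
    then show ?thesis using c2(2) by simp
  qed
  have "p = monom (coeff p M) M"
  proof (rule poly_eqI)
    fix m
    show "coeff p m = coeff (monom (coeff p M) M) m"
      using pz[of "m + j"] jM by (cases "m = M") (auto simp: coeff_monom)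
  qed
  then have "f - l = monom (coeff p M) M" by (simp only: p_def)
  moreover have "q = monom (coeff q (2 * M)) (2 * M)"
  proof (rule poly_eqI)
    fix m
    show "coeff q m = coeff (monom (coeff q (2 * M)) (2 * M)) m"
      using co[OF c1, of m] pz[of m] jM by (cases "m = 2 * M") (auto simp: coeff_monom)
  qed
  then have "Q = [:monom (coeff q (2 * M)) (2 * M):]" using q by simp
  ultimately show ?thesis using f by blast
qed

section \<open>Pencils over a cycle\<close>

lemma eval2_poly: "eval2 p s (poly t s) = poly (poly p t) s"
  by (induction p) auto

lemma poly_eq_sum_atMost: "degree p \<le> N \<Longrightarrow> poly p x = (\<Sum>i\<le>N. coeff p i * x ^ i)"
  for p :: "'a::comm_semiring_1 poly"
  unfolding poly_altdef by (rule sum.mono_neutral_left) (auto simp: coeff_eq_0)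

lemma poly2_tendsto_eval:
  assumes lim: "poly2_tendsto F L" and deg: "\<And>n. degree (F n) \<le> N"
  shows "poly_tendsto (\<lambda>n. poly (F n) t) (poly L t)"
proof -
  have "\<exists>n. degree L \<le> degree (F n)" using poly2_tendsto_degree[OF lim]
    by (metis eventually_sequentially order_refl)
  then have "degree L \<le> N" using deg order_trans by blast
  then show ?thesis unfolding poly_eq_sum_atMost[OF deg] poly_eq_sum_atMost[OF \<open>degree L \<le> N\<close>]
    using lim by (intro poly_tendsto_sum poly_tendsto_mult poly_tendsto_const) (auto simp: poly2_tendsto_def)
qed

text \<open>The value of a monic polynomial is the product of the differences between the argument
  and the roots.\<close>

lemma norm_poly_ge_root_distance:
  fixes q :: "complex poly"
  assumes "lead_coeff q = 1" "R \<ge> 0" "\<And>z. poly q z = 0 \<Longrightarrow> norm (z - y) \<ge> R"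
  shows "norm (poly q y) \<ge> R ^ degree q"
  using assms
proof (induction "degree q" arbitrary: q)
  case 0
  then obtain a where "q = [:a:]" by (metis degree_eq_zeroE)
  then show ?case using 0 by simp
next
  case (Suc n)
  then obtain z where z: "poly q z = 0" by (metis fundamental_theorem_of_algebra constant_degree nat.distinct(1))
  then obtain e where e: "q = [:-z,1:] * e" by (metis poly_eq_0_iff_dvd dvdE)
  have le: "lead_coeff e = 1" using Suc.prems(1) unfolding e lead_coeff_mult by simp
  then have e0: "e \<noteq> 0" by auto
  have dq: "degree q = Suc (degree e)" unfolding e using e0 by (subst degree_mult_eq) auto
  have rt: "norm (x - y) \<ge> R" if "poly e x = 0" for x
    by (rule Suc.prems(3)) (simp add: e that)
  have "norm (poly e y) \<ge> R ^ degree e"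
    by (rule Suc.hyps(1)[OF _ le Suc.prems(2) rt]) (use dq Suc.hyps(2) in auto)
  moreover have "norm (y - z) \<ge> R" using Suc.prems(3)[OF z] by (simp add: norm_minus_commute)
  ultimately have "R * R ^ degree e \<le> norm (y - z) * norm (poly e y)"
    using Suc.prems(2) by (intro mult_mono) auto
  also have "norm (y - z) * norm (poly e y) = norm (poly q y)"
    by (simp add: e norm_mult[symmetric] algebra_simps)
  finally show ?case by (simp add: dq)
qed

text \<open>
  On a component of the curve \<open>P(x) = \<beta> (s\<^sup>e + s\<^sup>-\<^sup>e)\<close> the coordinate \<open>x\<close> tends to infinity as \<open>s\<close> tends to
  \<open>0\<close> or \<open>\<infinity>\<close>, so \<open>\<Prod>(y - x)\<close> over the sheets of the component cannot be a monomial in \<open>s\<close>.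
\<close>

lemma component_norm_not_monom:
  fixes H :: "complex poly poly"
  assumes ev: "\<And>s x. s \<noteq> 0 \<Longrightarrow> eval2 H s (s ^ M * x + poly ph s) = 0 \<Longrightarrow>
      poly P x = b * (s ^ e + inverse (s ^ e))"
    and b: "b \<noteq> 0" and e: "e \<ge> 1" and H: "lead_coeff H = 1" "degree H \<ge> 1"
  shows "poly H (monom y M + ph) \<noteq> monom c j"
proof
  assume Hc: "poly H (monom y M + ph) = monom c j"
  \<comment> \<open>At least 1 and larger than \<open>norm c\<close>, so that every positive power
    of \<open>R\<close> exceeds \<open>norm c\<close>.\<close>
  define R where "R = norm c + 2"
  have R: "R \<ge> 1" "R > norm c" by (simp_all add: R_def)
  obtain B where B: "\<And>z. norm (z - y) \<le> R \<Longrightarrow> norm (poly P z) \<le> B"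
  proof -
    have "compact (poly P ` cball y R)" by (intro compact_continuous_image continuous_intros) auto
    then have "bounded (poly P ` cball y R)" by (rule compact_imp_bounded)
    then obtain B where "\<forall>x\<in>poly P ` cball y R. norm x \<le> B" unfolding bounded_iff by blast
    then show ?thesis using that[of B] by (auto simp: dist_norm norm_minus_commute)
  qed
  \<comment> \<open>For \<open>s = t\<close> and for \<open>s = 1 / t\<close> the right-hand side of
    the curve equation exceeds all values of \<open>P\<close> on the disc of radius \<open>R\<close>
    around \<open>y\<close>; so no point of the curve over such \<open>s\<close> lies in that
    disc.\<close>
  define t where "t = max 1 ((B + 1) / norm b)"
  have t1: "t \<ge> 1" by (simp add: t_def)
  have "norm b * t \<ge> B + 1" using b by (simp add: t_def max_def field_simps)
  then have tB: "norm b * t > B" by simp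
  have big: "norm (b * (s ^ e + inverse (s ^ e))) > B" if "s = of_real t \<or> s = of_real (1 / t)" for s
  proof -
    have "s ^ e + inverse (s ^ e) = of_real (t ^ e + inverse (t ^ e))"
      using that by (rule disjE) (simp_all add: power_one_over inverse_eq_divide)
    moreover have "t ^ e + inverse (t ^ e) \<ge> t"
    proof -
      have "t \<le> t ^ e" using t1 e by (intro self_le_power) auto
      moreover have "0 \<le> inverse (t ^ e)" using t1 by simp
      ultimately show ?thesis by linarith
    qed
    ultimately have "norm (s ^ e + inverse (s ^ e)) \<ge> t" using t1 by (simp only: norm_of_real)
    then have "norm b * norm (s ^ e + inverse (s ^ e)) \<ge> norm b * t" by (intro mult_left_mono) auto
    then show ?thesis using tB by (simp add: norm_mult)
  qed
  define h where "h = degree H"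
  \<comment> \<open>The end of the curve is chosen according to the sign of
    \<open>j - M * h\<close>, to make the quotient of \<open>norm s ^ j\<close> by
    \<open>norm s ^ (M * h)\<close> at most 1.\<close>
  define s :: complex where "s = (if j \<le> M * h then of_real t else of_real (1 / t))"
  have s0: "s \<noteq> 0" using t1 by (auto simp: s_def)
  have sbig: "norm (b * (s ^ e + inverse (s ^ e))) > B" by (rule big) (simp add: s_def)
  define Hs where "Hs = map_poly (\<lambda>c. poly c s) H"
  have Hs: "degree Hs = h" "lead_coeff Hs = 1" unfolding Hs_def h_def using degree_map_poly_eval_monic[OF H(1)] by auto
  \<comment> \<open>The fibre of \<open>H\<close> over \<open>s\<close>, written in the argument of
    \<open>P\<close> and divided by \<open>s ^ (M * h)\<close> to become monic; its roots lie on the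
    curve.\<close>
  define q where "q = smult (inverse (s ^ (M * h))) (pcompose Hs [:poly ph s, s ^ M:])"
  have dq0: "degree (pcompose Hs [:poly ph s, s ^ M:]) = h" using Hs s0 by (simp add: degree_pcompose)
  have dq: "degree q = h" unfolding q_def using s0 dq0 by simp
  have "lead_coeff (pcompose Hs [:poly ph s, s ^ M:]) = lead_coeff Hs * lead_coeff [:poly ph s, s ^ M:] ^ degree Hs"
    by (rule lead_coeff_comp) (use s0 in simp)
  then have lq: "lead_coeff q = 1" unfolding q_def using Hs s0 by (simp add: power_mult)
  have qev: "poly q x = inverse (s ^ (M * h)) * eval2 H s (s ^ M * x + poly ph s)" for x
    by (simp add: q_def poly_pcompose eval2_map_poly Hs_def algebra_simps)
  have "norm (z - y) \<ge> R" if "poly q z = 0" for z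
  proof (rule ccontr)
    assume "\<not> norm (z - y) \<ge> R"
    then have "norm (poly P z) \<le> B" by (intro B) simp
    moreover have "poly P z = b * (s ^ e + inverse (s ^ e))"
      by (rule ev[OF s0]) (use that s0 in \<open>simp add: qev\<close>)
    ultimately show False using sbig by simp
  qed
  then have "R ^ h \<le> norm (poly q y)" using norm_poly_ge_root_distance[OF lq] R unfolding dq by simp
  moreover have "R \<le> R ^ h" using R H(2) by (intro self_le_power) (auto simp: h_def)
  moreover have "norm (poly q y) \<le> norm c"
  proof -
    have "eval2 H s (s ^ M * y + poly ph s) = c * s ^ j"
      using eval2_poly[of H s "monom y M + ph"] unfolding Hc by (simp add: poly_monom mult.commute)
    then have "norm (poly q y) = norm c * (norm s ^ j / norm s ^ (M * h))"
      by (simp add: qev norm_mult norm_inverse norm_power norm_divide field_simps)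
    also have "norm s ^ j / norm s ^ (M * h) \<le> 1"
    proof (cases "j \<le> M * h")
      case True
      then have "norm s \<ge> 1" using t1 by (simp add: s_def)
      then show ?thesis using True power_increasing[OF True] s0 by (simp add: divide_le_eq)
    next
      case False
      then have "norm s \<le> 1" using t1 by (simp add: s_def norm_divide)
      then show ?thesis using False power_decreasing[of "M * h" j "norm s"] s0 by (simp add: divide_le_eq)
    qed
    then have "norm c * (norm s ^ j / norm s ^ (M * h)) \<le> norm c * 1" by (intro mult_left_mono) auto
    finally show ?thesis by simp
  qed
  ultimately show False using R by linarith
qed

text \<open>On the section \<open>s^M y + ph\<close> every \<open>D i\<close> restricts to
  \<open>psi\<close>, which the restriction of \<open>H i\<close> therefore divides. As
  \<open>G'\<close> vanishes on the section and \<open>X\<close> has nonzero derivative at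
  \<open>y\<close>, the restriction of \<open>H'\<close> has no zero with
  \<open>s \<noteq> 0\<close> and is a monomial. By \<open>divisors_limit\<close> some
  \<open>H i\<close> restricts to a monomial as well, against
  \<open>component_norm_not_monom\<close>.\<close>

lemma cycle_factor_contradiction:
  fixes D G H :: "nat \<Rightarrow> complex poly poly"
  assumes DGH: "\<And>i. D i = G i * H i"
    and H: "\<And>i. lead_coeff (H i) = 1" "\<And>i. degree (H i) \<ge> 1" "\<And>i. degree (H i) \<le> N"
    and ev: "\<And>i s x. s \<noteq> 0 \<Longrightarrow> eval2 (D i) s (s ^ M * x + poly ph s) =
        s ^ k * (poly (P i) x - b * (s ^ e + inverse (s ^ e)))"
    and b: "b \<noteq> 0" and e: "e \<ge> 1"
    and psi: "\<And>i. poly (D i) (monom y M + ph) = psi" "psi \<noteq> 0"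
    and lim: "poly2_tendsto (\<lambda>i. smult [:h i:] (H i)) H'"
    and evL: "\<And>s x. s \<noteq> 0 \<Longrightarrow> eval2 (G' * H') s (s ^ M * x + poly ph s) = s ^ k * poly X x"
    and X: "poly (pderiv X) y \<noteq> 0"
    and G': "poly G' (monom y M + ph) = 0"
  shows False
proof -
  let ?t = "monom y M + ph"
  have "poly (poly H' ?t) s \<noteq> 0" if s: "s \<noteq> 0" for s
  proof
    assume 0: "poly (poly H' ?t) s = 0"
    define l where "l = [:poly ph s, s ^ M:]"
    define Gs where "Gs = pcompose (map_poly (\<lambda>c. poly c s) G') l"
    define Hs where "Hs = pcompose (map_poly (\<lambda>c. poly c s) H') l"
    have Gs: "poly Gs x = eval2 G' s (s ^ M * x + poly ph s)" for x
      by (simp add: Gs_def poly_pcompose eval2_map_poly l_def algebra_simps)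
    have Hs: "poly Hs x = eval2 H' s (s ^ M * x + poly ph s)" for x
      by (simp add: Hs_def poly_pcompose eval2_map_poly l_def algebra_simps)
    have "poly (Gs * Hs) x = poly (smult (s ^ k) X) x" for x using evL[OF s, of x] by (simp add: Gs Hs)
    then have "Gs * Hs = smult (s ^ k) X" using poly_eq_poly_eq_iff by blast
    then have "poly (pderiv (Gs * Hs)) y = s ^ k * poly (pderiv X) y" by (simp only: pderiv_smult poly_smult)
    moreover have "poly Gs y = 0"
      using eval2_poly[of G' s ?t] G' by (simp add: Gs poly_monom mult.commute)
    moreover have "poly Hs y = 0"
      using eval2_poly[of H' s ?t] 0 by (simp add: Hs poly_monom mult.commute)
    ultimately have "s ^ k * poly (pderiv X) y = 0" by (simp only: pderiv_mult poly_add poly_mult) simp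
    then show False using X s by simp
  qed
  then obtain a j where a: "a \<noteq> 0" "poly H' ?t = monom a j" using no_nonzero_roots_imp_monom by blast
  have "poly_tendsto (\<lambda>n. poly (smult [:h n:] (H n)) ?t) (poly H' ?t)"
    by (rule poly2_tendsto_eval[OF lim, of N]) (use H(3) in \<open>auto intro: order_trans[OF degree_smult_le]\<close>)
  then have lim': "poly_tendsto (\<lambda>n. smult (h n) (poly (H n) ?t)) (monom a j)" using a by simp
  have "poly (H n) ?t dvd psi" for n unfolding psi(1)[of n, symmetric] DGH by simp
  then have "infinite {n. \<exists>c. c \<noteq> 0 \<and> poly (H n) ?t = smult c (monom a j)}"
    using divisors_limit[OF psi(2) _ lim'] a by simp
  from infinite_imp_nonempty[OF this] obtain n c where "poly (H n) ?t = smult c (monom a j)" by blast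
  moreover have "poly (H n) ?t \<noteq> monom (c * a) j"
  proof (rule component_norm_not_monom[OF _ b e H(1,2)])
    fix s x assume s: "s \<noteq> 0" and "eval2 (H n) s (s ^ M * x + poly ph s) = 0"
    then have "eval2 (D n) s (s ^ M * x + poly ph s) = 0" by (simp add: DGH)
    then show "poly (P n) x = b * (s ^ e + inverse (s ^ e))" using ev[OF s] s by simp
  qed
  ultimately show False by (simp add: smult_monom)
qed

text \<open>On the section through a root \<open>y\<close> of \<open>X\<close> the pencil does not
  depend on \<open>v\<close>, while its rescaled limit vanishes there. So one of the two limit
  factors vanishes on the section, and \<open>cycle_factor_contradiction\<close> applies to the
  other one; simplicity of the root keeps both from vanishing.\<close>

lemma cycle_pencil_irreducible:
  fixes D :: "complex \<Rightarrow> complex poly poly" and X P0 :: "complex poly"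
  assumes monic: "\<And>v. lead_coeff (D v) = 1" and deg: "\<And>v. degree (D v) = m" and m: "m \<ge> 1"
    and affine: "\<And>v. D v = A - [:monom v M:] * B"
    and ev: "\<And>v s x. s \<noteq> 0 \<Longrightarrow> eval2 (D v) s (s ^ M * x + poly ph s) =
        s ^ k * (poly P0 x - v * poly X x - b * (s ^ e + inverse (s ^ e)))"
    and b: "b \<noteq> 0" and e: "e \<ge> 1"
    and y: "poly X y = 0" "poly (pderiv X) y \<noteq> 0"
  shows "\<exists>v. irreducible (D v)"
proof (rule ccontr)
  assume "\<not> ?thesis"
  then have red: "\<not> irreducible (D v)" for v by blast
  let ?t = "monom y M + ph"
  have "B \<noteq> 0"
  proof
    assume "B = 0"
    then have "D 0 = D 1" by (simp add: affine)
    then have "poly X x = 0" for x using ev[of 1 0 x] ev[of 1 1 x] by simp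
    then have "X = 0" by (metis poly_all_0_iff_0)
    then show False using y by simp
  qed
  note lim = reducible_pencil_limit[OF monic deg m affine this red]
  obtain w G H g G' h H' where GH: "\<And>i :: nat. D (w i) = G i * H i" "\<And>i. lead_coeff (G i) = 1"
    "\<And>i. lead_coeff (H i) = 1" "\<And>i. degree (G i) \<ge> 1" "\<And>i. degree (H i) \<ge> 1"
    and degs: "\<And>i. degree (G i) \<le> m" "\<And>i. degree (H i) \<le> m"
    and r: "poly2_tendsto (\<lambda>i. smult [:g i:] (G i)) G'" "poly2_tendsto (\<lambda>i. smult [:h i:] (H i)) H'"
    and L: "[:monom (-1) M:] * B = G' * H'"
    by (rule lim) (rule that)
  define L where "L = G' * H'"
  have evL: "eval2 L s (s ^ M * x + poly ph s) = s ^ k * poly (- X) x" if "s \<noteq> 0" for s x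
  proof -
    have "D 1 - D 0 = L" by (simp add: affine L_def minus_monom[symmetric] flip: L)
    then have "eval2 L s (s ^ M * x + poly ph s) = eval2 (D 1) s (s ^ M * x + poly ph s) - eval2 (D 0) s (s ^ M * x + poly ph s)"
      by (simp only: eval2_simps(2)[symmetric])
    then show ?thesis unfolding ev[OF that] by (simp add: algebra_simps)
  qed
  have X': "poly (pderiv (- X)) y \<noteq> 0" using y by (simp add: pderiv_minus)
  define psi where "psi = poly (D 0) ?t"
  have tev: "poly ?t s = s ^ M * y + poly ph s" for s by (simp add: poly_monom mult.commute)
  have psi_ev: "poly (poly (D v) ?t) s = s ^ k * (poly P0 y - b * (s ^ e + inverse (s ^ e)))" if "s \<noteq> 0" for v s
    using ev[OF that, of v y] y unfolding eval2_poly[symmetric] tev by simp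
  have psi: "poly (D v) ?t = psi" for v
  proof -
    have "[:poly (D v) ?t:] = [:psi:]"
      by (rule eval2_eq_imp_eq) (simp add: psi_ev psi_def)
    then show ?thesis by simp
  qed
  \<comment> \<open>The sum of \<open>s ^ e\<close> and its inverse is not constant: equal values at
    1 and 2 would give \<open>z + inverse z = 2\<close>, hence \<open>z = 1\<close>, for
    \<open>z = 2 ^ e\<close>.\<close>
  have psi0: "psi \<noteq> 0"
  proof
    assume "psi = 0"
    then have eq: "poly P0 y = b * (s ^ e + inverse (s ^ e))" if "s \<noteq> 0" for s
      using psi_ev[OF that, of 0] that unfolding psi_def by simp
    have "b * (1 ^ e + inverse (1 ^ e)) = b * (2 ^ e + inverse (2 ^ e))" using eq[of 1] eq[of 2] by simp
    define z :: complex where "z = 2 ^ e"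
    have z0: "z \<noteq> 0" by (simp add: z_def)
    have "z + inverse z = 2" using \<open>b * (1 ^ e + inverse (1 ^ e)) = _\<close> b by (simp add: z_def)
    then have "z * (z + inverse z) = z * 2" by simp
    then have "z * z + 1 = z * 2" using z0 by (simp add: distrib_left)
    then have "(z - 1) * (z - 1) = 0" by (simp add: algebra_simps)
    then have "(2 ^ e :: complex) = 1" by (simp add: z_def)
    then have "norm (2 ^ e :: complex) = 1" by simp
    then have "(2::real) ^ e = 1" by (simp add: norm_power)
    moreover have "(2::real) ^ 1 \<le> 2 ^ e" using e by (intro power_increasing) auto
    ultimately show False by simp
  qed
  have "poly (poly L ?t) s = 0" if "s \<noteq> 0" for s
    using evL[OF that, of y] y unfolding eval2_poly[symmetric] tev by simp
  then have "[:poly L ?t:] = [:0:]" by (intro eval2_eq_imp_eq) simp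
  then have "poly G' ?t * poly H' ?t = 0" using L_def by simp
  then consider "poly G' ?t = 0" | "poly H' ?t = 0" by auto
  then show False
  proof cases
    case 1
    have evL': "eval2 (G' * H') s (s ^ M * x + poly ph s) = s ^ k * poly (- X) x" if "s \<noteq> 0" for s x
      using evL[OF that] L_def by simp
    have ev': "eval2 (D (w i)) s (s ^ M * x + poly ph s) =
        s ^ k * (poly (P0 - smult (w i) X) x - b * (s ^ e + inverse (s ^ e)))" if "s \<noteq> 0" for i s x
      using ev[OF that] by simp
    show False
      by (rule cycle_factor_contradiction[OF GH(1) GH(3) GH(5) degs(2) ev' b e psi psi0 r(2) evL' X' 1])
  next
    case 2
    have evL': "eval2 (H' * G') s (s ^ M * x + poly ph s) = s ^ k * poly (- X) x" if "s \<noteq> 0" for s x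
      using evL[OF that] L_def by (simp add: mult.commute)
    have ev': "eval2 (D (w i)) s (s ^ M * x + poly ph s) =
        s ^ k * (poly (P0 - smult (w i) X) x - b * (s ^ e + inverse (s ^ e)))" if "s \<noteq> 0" for i s x
      using ev[OF that] by simp
    have "D (w i) = H i * G i" for i using GH(1) by (simp add: mult.commute)
    from cycle_factor_contradiction[OF this GH(2) GH(4) degs(1) ev' b e psi psi0 r(1) evL' X' 2]
    show False .
  qed
qed

section \<open>Polynomial functions and block determinants\<close>

definition polyfun :: "(complex ^ 'n::finite \<Rightarrow> complex) \<Rightarrow> bool" where
  "polyfun g \<longleftrightarrow> (\<exists>f. \<forall>V. eval_poly f V = g V)"

lemma eval_poly_superset:
  assumes "finite S" "Poly_Mapping.keys f \<subseteq> S"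
  shows "eval_poly f V = (\<Sum>m\<in>S. Poly_Mapping.lookup f m * (\<Prod>i\<in>UNIV. (V $ i) ^ (m $ i)))"
  unfolding eval_poly_def
  by (rule sum.mono_neutral_left) (use assms in \<open>auto simp: in_keys_iff\<close>)

lemma eval_poly_add: "eval_poly (f + g) V = eval_poly f V + eval_poly g V"
proof -
  let ?S = "Poly_Mapping.keys f \<union> Poly_Mapping.keys g"
  show ?thesis
    unfolding eval_poly_superset[of ?S "f + g", OF _ Poly_Mapping.keys_add, simplified]
      eval_poly_superset[of ?S f, simplified] eval_poly_superset[of ?S g, simplified]
    by (simp add: Poly_Mapping.lookup_add algebra_simps sum.distrib)
qed

lemma polyfun_monomial: "polyfun (\<lambda>V. c * (\<Prod>i\<in>UNIV. (V $ i) ^ (m $ i)))"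
proof -
  have "eval_poly (Poly_Mapping.single m c) V = c * (\<Prod>i\<in>UNIV. (V $ i) ^ (m $ i))" for V
    by (subst eval_poly_superset[of "{m}"]) auto
  then show ?thesis unfolding polyfun_def by blast
qed

lemma polyfun_add: "polyfun f \<Longrightarrow> polyfun g \<Longrightarrow> polyfun (\<lambda>V. f V + g V)"
  unfolding polyfun_def by (metis eval_poly_add)

lemma polyfun_const: "polyfun (\<lambda>_. c)"
  using polyfun_monomial[of c 0] by simp

lemma polyfun_sum: "(\<And>i. i \<in> A \<Longrightarrow> polyfun (f i)) \<Longrightarrow> polyfun (\<lambda>V. \<Sum>i\<in>A. f i V)"
  by (induction A rule: infinite_finite_induct) (auto intro: polyfun_add polyfun_const)

lemma polyfun_mult:
  assumes "polyfun f" "polyfun g" shows "polyfun (\<lambda>V. f V * g V)"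
proof -
  obtain p q where "\<And>V. eval_poly p V = f V" "\<And>V. eval_poly q V = g V" using assms by (auto simp: polyfun_def)
  then have "f V * g V = (\<Sum>m\<in>Poly_Mapping.keys p. \<Sum>n\<in>Poly_Mapping.keys q.
      (Poly_Mapping.lookup p m * Poly_Mapping.lookup q n) * (\<Prod>i\<in>UNIV. (V $ i) ^ ((m + n) $ i)))" for V
    by (simp add: eval_poly_def sum_product power_add prod.distrib mult_ac flip: \<open>\<And>V. eval_poly p V = f V\<close> \<open>\<And>V. eval_poly q V = g V\<close>)
  then show ?thesis by (simp only:) (intro polyfun_sum polyfun_monomial)
qed

lemma polyfun_ring: "function_ring {g. polyfun g}"
  unfolding function_ring_def by (auto intro: polyfun_const polyfun_add polyfun_mult)

lemma polyfun_nth: "polyfun (\<lambda>V. V $ k)" for k :: "'n::finite"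
proof -
  have "(\<Prod>i\<in>UNIV. (V $ i) ^ ((\<chi> i::'n. if i = k then 1 else 0) $ i)) = V $ k" for V :: "complex ^ 'n"
    by (simp add: if_distrib[of "\<lambda>n. _ ^ n"] prod.delta cong: if_cong)
  then show ?thesis using polyfun_monomial[of 1 "\<chi> i. if i = k then 1 else 0"] by simp
qed

lemma polyfun_line:
  assumes "polyfun q" obtains p where "\<And>t. q (x + t *s y) = poly p t"
proof -
  obtain f where f: "\<And>V. eval_poly f V = q V" using assms by (auto simp: polyfun_def)
  have "q (x + t *s y) = poly (\<Sum>m\<in>Poly_Mapping.keys f. smult (Poly_Mapping.lookup f m) (\<Prod>i\<in>UNIV. [:x $ i, y $ i:] ^ (m $ i))) t" for t
    unfolding f[symmetric] eval_poly_def by (simp add: poly_sum poly_prod poly_power)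
  then show ?thesis using that by blast
qed

text \<open>On the line joining the two points both functions become nonzero polynomials in one
  variable.\<close>

lemma polyfun_common_nonzero:
  assumes f: "polyfun f" "f x \<noteq> 0" and g: "polyfun g" "g y \<noteq> 0"
  obtains z where "f z \<noteq> 0" "g z \<noteq> 0"
proof -
  obtain p where p: "\<And>t. f (x + t *s (y - x)) = poly p t" using polyfun_line[OF f(1), of x "y - x"] by blast
  obtain q where q: "\<And>t. g (x + t *s (y - x)) = poly q t" using polyfun_line[OF g(1), of x "y - x"] by blast
  have "p \<noteq> 0" using p[of 0] f(2) by auto
  moreover have "q \<noteq> 0" using q[of 1] g(2) by auto
  ultimately have "p * q \<noteq> 0" by simp
  then obtain t where "poly (p * q) t \<noteq> 0" using poly_all_0_iff_0 by blast
  then show ?thesis using that[of "x + t *s (y - x)"] p q by simp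
qed

lemma polyfun_zero_if_locally_zero:
  assumes "polyfun f" and "eventually (\<lambda>z. f z = 0) (nhds x)"
  shows "f y = 0"
proof -
  obtain p where p: "\<And>t. f (x + t *s (y - x)) = poly p t" using polyfun_line[OF assms(1), of x "y - x"] by blast
  have "((\<lambda>t. x + t *s (y - x)) \<longlongrightarrow> x + 0 *s (y - x)) (at 0)"
    unfolding vector_scalar_mult_def by (intro vec_tendstoI) (auto intro!: tendsto_eq_intros)
  then have "eventually (\<lambda>t. f (x + t *s (y - x)) = 0) (at 0)"
    using assms(2) by (auto simp: filterlim_iff)
  then have ev: "eventually (\<lambda>t. poly p t = 0) (at 0)" by (simp only: p)
  have "p = 0"
  proof (rule ccontr)
    assume "p \<noteq> 0"
    then have "finite {t. poly p t = 0}" by (rule poly_roots_finite)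
    moreover obtain d where d: "d > 0" "\<And>t. t \<noteq> 0 \<Longrightarrow> dist t 0 < d \<Longrightarrow> poly p t = 0"
      using ev unfolding eventually_at by blast
    moreover have "of_real ` {0<..<d} \<subseteq> {t. poly p t = 0}" using d(2) by auto
    moreover have "infinite (of_real ` {0<..<d} :: complex set)"
      using d(1) infinite_Ioo[of 0 d] by (simp add: finite_image_iff inj_on_def)
    ultimately show False by (meson finite_subset)
  qed
  then show ?thesis using p[of 1] by simp
qed

text \<open>The determinant of a principal submatrix, indexed by a subset of a fixed type, so that
  vertices can be added one at a time without changing types; the entries may lie in any commutative
  ring.\<close>

definition block_det :: "'n set \<Rightarrow> ('n \<Rightarrow> 'n \<Rightarrow> 'a::comm_ring_1) \<Rightarrow> 'a" where
  "block_det S X = (\<Sum>p | p permutes S. of_int (sign p) * (\<Prod>i\<in>S. X i (p i)))"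

lemma det_eq_block_det: "det A = block_det UNIV (\<lambda>i j. A $ i $ j)"
  by (simp add: det_def block_det_def)

lemma block_det_cong:
  assumes "\<And>i j. i \<in> S \<Longrightarrow> j \<in> S \<Longrightarrow> X i j = Y i j"
  shows "block_det S X = block_det S Y"
  unfolding block_det_def
  by (intro sum.cong refl arg_cong2[of _ _ _ _ "(*)"] prod.cong assms) (auto simp: permutes_in_image)

lemma block_det_scale:
  "block_det S (\<lambda>i j. c * X i j) = c ^ card S * block_det S X"
  by (simp add: block_det_def prod.distrib sum_distrib_left mult_ac)

text \<open>Only the permutations fixing \<open>k\<close> see the changed entry, and they are the
  permutations of \<open>S - {k}\<close>.\<close>

lemma block_det_add_diagonal:
  assumes "finite S" "k \<in> S"
  shows "block_det S (\<lambda>i j. X i j + (if i = k \<and> j = k then t else 0)) = block_det S X + t * block_det (S - {k}) X"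
proof -
  have prod: "(\<Prod>i\<in>S. X i (p i) + (if i = k \<and> p i = k then t else 0)) =
     (\<Prod>i\<in>S. X i (p i)) + (if p k = k then t * (\<Prod>i\<in>S - {k}. X i (p i)) else 0)" for p
  proof -
    have "(\<Prod>i\<in>S - {k}. X i (p i) + (if i = k \<and> p i = k then t else 0)) = (\<Prod>i\<in>S - {k}. X i (p i))"
      by (intro prod.cong) auto
    then show ?thesis unfolding prod.remove[OF assms] by (simp add: algebra_simps)
  qed
  have set: "{p. p permutes S \<and> p k = k} = {p. p permutes (S - {k})}"
  proof (intro set_eqI iffI; clarsimp)
    fix p assume p: "p permutes S" "p k = k"
    show "p permutes (S - {k})" by (rule permutes_superset[OF p(1)]) (use p in auto)
  next
    fix p assume p: "p permutes (S - {k})"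
    then show "p permutes S \<and> p k = k"
      by (metis DiffD2 Diff_subset permutes_def permutes_subset insertI1)
  qed
  have "(\<Sum>p | p permutes S. of_int (sign p) * (if p k = k then t * (\<Prod>i\<in>S - {k}. X i (p i)) else 0)) =
     (\<Sum>p | p permutes S \<and> p k = k. of_int (sign p) * (t * (\<Prod>i\<in>S - {k}. X i (p i))))"
    by (rule sum.mono_neutral_cong_right) (use assms finite_permutations in auto)
  then show ?thesis
    by (simp add: block_det_def prod distrib_left sum.distrib set sum_distrib_left mult_ac)
qed

lemma block_det_pair:
  assumes "b \<noteq> k"
  shows "block_det {b, k} X = X b b * X k k - X b k * X k b"
proof -
  have "{p. p permutes {b, k}} = {id, Transposition.transpose b k}" by (auto simp: permutes_doubleton_iff)
  moreover have "id \<noteq> Transposition.transpose b k" using assms by (metis id_apply transpose_apply_first)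
  ultimately show ?thesis using assms by (simp add: block_det_def sign_swap_id sign_id)
qed

text \<open>A permutation other than the identity moves at least two indices, so at most
  \<open>card S - 2\<close> of its factors are diagonal and can have degree 1.\<close>

lemma block_det_off_diagonal_degree:
  fixes X :: "'n \<Rightarrow> 'n \<Rightarrow> 'a::comm_ring_1 poly"
  assumes fin: "finite S" and X: "\<And>i j. degree (X i j) \<le> (if i = j then 1 else 0)"
    and m: "m + 1 \<ge> card S"
  shows "coeff (block_det S X - (\<Prod>i\<in>S. X i i)) m = 0"
proof -
  have finp: "finite {p. p permutes S}" by (rule finite_permutations[OF fin])
  have "block_det S X = (\<Prod>i\<in>S. X i i) + (\<Sum>p\<in>{p. p permutes S} - {id}. of_int (sign p) * (\<Prod>i\<in>S. X i (p i)))"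
    unfolding block_det_def by (subst sum.remove[OF finp, of id]) (auto simp: permutes_id)
  then have "block_det S X - (\<Prod>i\<in>S. X i i) = (\<Sum>p\<in>{p. p permutes S} - {id}. of_int (sign p) * (\<Prod>i\<in>S. X i (p i)))" by simp
  moreover have "coeff (of_int (sign p) * (\<Prod>i\<in>S. X i (p i))) m = 0" if p: "p permutes S" "p \<noteq> id" for p
  proof -
    obtain i where i: "p i \<noteq> i" using p(2) by (auto simp: fun_eq_iff)
    have iS: "i \<in> S" using i p(1) by (meson permutes_not_in)
    have pi: "p i \<in> S" using iS p(1) by (simp add: permutes_in_image)
    have ppi: "p (p i) \<noteq> p i" using i p(1) by (metis permutes_inj injD)
    have "{j \<in> S. p j = j} \<subseteq> S - {i, p i}" using i ppi by auto
    then have "card {j \<in> S. p j = j} \<le> card (S - {i, p i})" using fin by (intro card_mono) auto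
    also have "\<dots> = card S - 2" using iS pi i by (subst card_Diff_subset) auto
    finally have c: "card {j \<in> S. p j = j} \<le> card S - 2" .
    have "card {i, p i} \<le> card S" using iS pi by (intro card_mono fin) auto
    then have "card S \<ge> 2" using i by auto
    then have lt: "card {j \<in> S. p j = j} < m" using c m by linarith
    have "degree (of_int (sign p) * (\<Prod>i\<in>S. X i (p i))) \<le> degree (\<Prod>i\<in>S. X i (p i))"
      by (rule order_trans[OF degree_mult_le]) simp
    also have "\<dots> \<le> (\<Sum>i\<in>S. degree (X i (p i)))" using degree_prod_sum_le[OF fin] by (simp add: o_def)
    also have "\<dots> \<le> (\<Sum>i\<in>S. if p i = i then 1 else 0)" by (intro sum_mono order_trans[OF X]) auto
    also have "\<dots> = card {j \<in> S. p j = j}" using fin by (simp add: sum.If_cases Int_def)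
    finally show ?thesis using lt by (intro coeff_eq_0) linarith
  qed
  ultimately show ?thesis by (simp add: coeff_sum)
qed

lemma prod_monic_linear:
  fixes f :: "'n \<Rightarrow> 'a::idom"
  shows "degree (\<Prod>i\<in>S. [:f i, 1:]) = card S" "lead_coeff (\<Prod>i\<in>S. [:f i, 1:]) = 1"
  using lead_coeff_prod[of "\<lambda>i. [:f i, 1:]" S] by (auto simp: degree_prod_eq_sum_degree)

lemma block_det_char_monic:
  fixes a :: "'n \<Rightarrow> 'n \<Rightarrow> 'a::idom"
  assumes fin: "finite S"
  shows "degree (block_det S (\<lambda>i j. if i = j then [:- a i j, 1:] else [:- a i j:])) = card S"
    and "lead_coeff (block_det S (\<lambda>i j. if i = j then [:- a i j, 1:] else [:- a i j:])) = 1"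
proof -
  let ?X = "\<lambda>i j. if i = j then [:- a i j, 1:] else [:- a i j:]"
  let ?P = "\<Prod>i\<in>S. [:- a i i, 1:]"
  define R where "R = block_det S ?X - ?P"
  have R: "coeff R m = 0" if "m + 1 \<ge> card S" for m
    using block_det_off_diagonal_degree[OF fin _ that, of ?X] by (simp add: R_def)
  have eq: "block_det S ?X = ?P + R" by (simp add: R_def)
  have 1: "coeff (block_det S ?X) (card S) = 1"
    using prod_monic_linear[of "\<lambda>i. - a i i" S] R[of "card S"] by (simp add: eq)
  have "coeff (block_det S ?X) m = 0" if "m > card S" for m
    using prod_monic_linear(1)[of "\<lambda>i. - a i i" S] R[of m] that by (simp add: eq coeff_eq_0)
  then have "degree (block_det S ?X) \<le> card S" by (intro degree_le) auto
  moreover have "card S \<le> degree (block_det S ?X)" using 1 by (intro le_degree) simp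
  ultimately show 2: "degree (block_det S ?X) = card S" by simp
  show "lead_coeff (block_det S ?X) = 1" unfolding 2 by (rule 1)
qed

lemma block_det_zero_diagonal_degree:
  fixes X :: "'n \<Rightarrow> 'n \<Rightarrow> 'a::comm_ring_1 poly"
  assumes fin: "finite S" and k: "k \<in> S" "X k k = 0" and X: "\<And>i j. degree (X i j) \<le> (if i = j then 1 else 0)"
    and S: "card S \<ge> 2"
  shows "degree (block_det S X) < card S - 1"
proof -
  have "(\<Prod>i\<in>S. X i i) = 0"
    by (subst prod.remove[OF fin k(1)]) (simp add: k)
  then have "coeff (block_det S X) m = 0" if "m + 1 \<ge> card S" for m
    using block_det_off_diagonal_degree[OF fin X that] by simp
  then have z: "coeff (block_det S X) m = 0" if "m \<ge> card S - 1" for m using that by simp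
  show ?thesis
  proof (rule ccontr)
    assume n: "\<not> degree (block_det S X) < card S - 1"
    then have "block_det S X = 0" using z[of "degree (block_det S X)"] by simp
    then show False using n S by simp
  qed
qed

lemma sdeg_le_block_det:
  assumes "finite S" "\<And>i j. sdeg_le K (X i j)"
  shows "sdeg_le (card S * K) (block_det S X)"
proof -
  have "sdeg_le (0 + card S * K) (of_int (sign p) * (\<Prod>i\<in>S. X i (p i)))" for p
    by (intro sdeg_le_mult sdeg_le_prod assms)
       (auto simp: sdeg_le_def sign_def coeff_pCons one_pCons split: nat.splits)
  then show ?thesis unfolding block_det_def by (intro sdeg_le_sum) simp
qed

lemma eval2_of_int: "eval2 (of_int z) s x = of_int z"
  by (simp add: eval2_def of_int_poly)

lemma eval2_block_det: "eval2 (block_det S X) s x = block_det S (\<lambda>i j. eval2 (X i j) s x)"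
  by (simp add: block_det_def eval2_sum eval2_prod eval2_of_int)

lemma coeffs_in_block_det:
  assumes R: "function_ring R" and X: "\<And>i j. coeffs_in R (\<lambda>t. X t i j)"
  shows "coeffs_in R (\<lambda>t. block_det S (X t))"
  unfolding block_det_def
  by (intro coeffs_in_sum coeffs_in_mult coeffs_in_prod coeffs_in_const R X)

section \<open>Characteristic polynomials of polynomial matrices\<close>

definition update :: "'a ^ 'n \<Rightarrow> 'n \<Rightarrow> 'a \<Rightarrow> 'a ^ 'n" where
  "update V k v = (\<chi> i. if i = k then v else V $ i)"

lemma update_nth: "update V k v $ i = (if i = k then v else V $ i)"
  by (simp add: update_def)

text \<open>Entries of \<open>x I - (l + s^M diag V)\<close>. The potential carries the power of
  \<open>s\<close> because \<open>l\<close> will be the rest of the Floquet matrix already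
  multiplied by it.\<close>

definition char_entry ::
    "('n \<Rightarrow> 'n \<Rightarrow> complex poly) \<Rightarrow> nat \<Rightarrow> complex ^ 'n \<Rightarrow> 'n \<Rightarrow> 'n \<Rightarrow> complex poly poly" where
  "char_entry l M V i j = (if i = j then [:- (l i j + monom (V $ i) M), 1:] else [:- l i j:])"

definition char_det ::
    "('n \<Rightarrow> 'n \<Rightarrow> complex poly) \<Rightarrow> nat \<Rightarrow> 'n set \<Rightarrow> complex ^ 'n \<Rightarrow> complex poly poly" where
  "char_det l M S V = block_det S (char_entry l M V)"

text \<open>With the entry at \<open>(k, k)\<close> removed, the determinant is the part of the
  characteristic polynomial that does not contain the factor \<open>x - l k k - v s^M\<close>; up to
  sign it is the polynomial \<open>Q\<close> of the pencil.\<close>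

definition char_entry0 ::
    "('n \<Rightarrow> 'n \<Rightarrow> complex poly) \<Rightarrow> nat \<Rightarrow> 'n \<Rightarrow> complex ^ 'n \<Rightarrow> 'n \<Rightarrow> 'n \<Rightarrow> complex poly poly" where
  "char_entry0 l M k V i j = (if i = k \<and> j = k then 0 else char_entry l M V i j)"

lemma char_det_monic:
  fixes l :: "'n::finite \<Rightarrow> 'n \<Rightarrow> complex poly"
  shows "degree (char_det l M S V) = card S" "lead_coeff (char_det l M S V) = 1"
proof -
  have "char_entry l M V = (\<lambda>i j. if i = j then [:- (l i j + (if i = j then monom (V $ i) M else 0)), 1:]
      else [:- (l i j + (if i = j then monom (V $ i) M else 0)):])"
    by (auto simp: char_entry_def fun_eq_iff)
  then show "degree (char_det l M S V) = card S" "lead_coeff (char_det l M S V) = 1"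
    unfolding char_det_def
    using block_det_char_monic[of S "\<lambda>i j. l i j + (if i = j then monom (V $ i) M else 0)"] by simp_all
qed

lemma coeffs_in_char_entry: "coeffs_in {g. polyfun g} (\<lambda>V. char_entry l M V i j)"
proof -
  have "(\<lambda>V. coeff (coeff (char_entry l M V i j) a) b) =
     (\<lambda>V. coeff (coeff (if i = j then [:- l i j, 1:] else [:- l i j:]) a) b +
        (if i = j \<and> a = 0 \<and> b = M then -1 else 0) * V $ i)" for a b
    by (rule ext) (auto simp: char_entry_def coeff_pCons split: nat.splits)
  moreover have "polyfun (\<lambda>V. coeff (coeff (if i = j then [:- l i j, 1:] else [:- l i j:]) a) b +
        (if i = j \<and> a = 0 \<and> b = M then -1 else 0) * V $ i)" for a b
    by (intro polyfun_add polyfun_mult polyfun_const polyfun_nth)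
  ultimately show ?thesis by (simp add: coeffs_in_def)
qed

lemma coeffs_in_char_entry0: "coeffs_in {g. polyfun g} (\<lambda>V. char_entry0 l M k V i j)"
  using coeffs_in_char_entry[of l M i j] coeffs_in_const[OF polyfun_ring]
  by (cases "i = k \<and> j = k") (auto simp: char_entry0_def)

lemma coeffs_in_char_det: "coeffs_in {g. polyfun g} (char_det l M S)"
  unfolding char_det_def[abs_def] by (intro coeffs_in_block_det polyfun_ring coeffs_in_char_entry)

lemma sdeg_le_char_det:
  fixes l :: "'n::finite \<Rightarrow> 'n \<Rightarrow> complex poly"
  assumes "\<And>i j. degree (l i j) \<le> K" "M \<le> K"
  shows "sdeg_le (card S * K) (char_det l M S V)"
  unfolding char_det_def
proof (rule sdeg_le_block_det)
  fix i j
  have "degree (- l i j - monom (V $ i) M) \<le> K"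
    by (rule degree_diff_le) (use assms in \<open>auto intro: order_trans[OF degree_monom_le]\<close>)
  then show "sdeg_le K (char_entry l M V i j)" using assms
    by (auto simp: sdeg_le_def char_entry_def coeff_pCons split: nat.splits)
qed simp

lemma sdeg_le_char_det_exists:
  fixes l :: "'n::finite \<Rightarrow> 'n \<Rightarrow> complex poly"
  shows "\<exists>K. \<forall>V. sdeg_le K (char_det l M S V)"
proof -
  let ?K = "M + Max (range (\<lambda>(i, j). degree (l i j)))"
  have "degree (l i j) \<le> Max (range (\<lambda>(i, j). degree (l i j)))" for i j
    by (rule Max_ge) (auto intro: rev_image_eqI[of "(i, j)"])
  then have "degree (l i j) \<le> ?K" for i j by (simp add: trans_le_add2)
  then show ?thesis using sdeg_le_char_det[of l ?K M S] by auto
qed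

lemma char_det_update:
  fixes l :: "'n::finite \<Rightarrow> 'n \<Rightarrow> complex poly"
  assumes "k \<in> S"
  shows "char_det l M S (update V k v) =
     [:- (l k k + monom v M), 1:] * char_det l M (S - {k}) V + block_det S (char_entry0 l M k V)"
proof -
  have "char_entry l M (update V k v) = (\<lambda>i j. char_entry0 l M k V i j +
     (if i = k \<and> j = k then [:- (l k k + monom v M), 1:] else 0))"
    by (auto simp: fun_eq_iff char_entry_def char_entry0_def update_nth)
  then have "char_det l M S (update V k v) = block_det S (char_entry0 l M k V) +
     [:- (l k k + monom v M), 1:] * block_det (S - {k}) (char_entry0 l M k V)"
    unfolding char_det_def by (simp only:) (rule block_det_add_diagonal[OF _ assms], simp)
  moreover have "block_det (S - {k}) (char_entry0 l M k V) = char_det l M (S - {k}) V"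
    unfolding char_det_def by (rule block_det_cong) (auto simp: char_entry0_def)
  ultimately show ?thesis by simp
qed

text \<open>On \<open>{b, k}\<close> the determinant is minus the product of the two off-diagonal
  entries. The potential at a further vertex enters affinely, with the previous nonzero determinant
  times a monomial as coefficient, so one of the values 0 and 1 keeps the determinant
  nonzero.\<close>

lemma char_entry0_det_nonzero:
  fixes l :: "'n::finite \<Rightarrow> 'n \<Rightarrow> complex poly"
  assumes bk: "b \<noteq> k" "l b k \<noteq> 0" "l k b \<noteq> 0"
  shows "\<exists>V. block_det ({b, k} \<union> U) (char_entry0 l M k V) \<noteq> 0"
proof -
  have "finite U" by simp
  then show ?thesis
  proof (induction U rule: finite_induct)
    case empty
    have "block_det {b, k} (char_entry0 l M k 0) = - [:l b k * l k b:]"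
      using bk by (simp add: block_det_pair char_entry0_def char_entry_def)
    then show ?case using bk by (intro exI[of _ 0]) simp
  next
    case (insert c U)
    then obtain V where V: "block_det ({b, k} \<union> U) (char_entry0 l M k V) \<noteq> 0" by blast
    show ?case
    proof (cases "c \<in> {b, k}")
      case True
      then have "{b, k} \<union> insert c U = {b, k} \<union> U" by auto
      then show ?thesis using V by auto
    next
      case False
      let ?T = "insert c ({b, k} \<union> U)"
      have c: "c \<notin> {b, k} \<union> U" using False insert by auto
      have ent: "char_entry0 l M k (update V c t) = (\<lambda>i j. char_entry0 l M k (update V c 0) i j +
         (if i = c \<and> j = c then [:- monom t M:] else 0))" for t
        using False by (auto simp: fun_eq_iff char_entry_def char_entry0_def update_nth)
      have "block_det ?T (char_entry0 l M k (update V c 1)) = block_det ?T (char_entry0 l M k (update V c 0)) +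
         [:- monom 1 M:] * block_det (?T - {c}) (char_entry0 l M k (update V c 0))"
        by (subst ent) (rule block_det_add_diagonal, auto)
      moreover have "block_det (?T - {c}) (char_entry0 l M k (update V c 0)) = block_det ({b, k} \<union> U) (char_entry0 l M k V)"
      proof -
        have "?T - {c} = {b, k} \<union> U" using c by auto
        moreover have "block_det ({b, k} \<union> U) (char_entry0 l M k (update V c 0)) = block_det ({b, k} \<union> U) (char_entry0 l M k V)"
          by (rule block_det_cong) (use c in \<open>auto simp: char_entry0_def char_entry_def update_nth\<close>)
        ultimately show ?thesis by simp
      qed
      ultimately have "block_det ?T (char_entry0 l M k (update V c 1)) \<noteq> 0 \<or> block_det ?T (char_entry0 l M k (update V c 0)) \<noteq> 0"
        using V by auto
      then show ?thesis by auto
    qed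
  qed
qed

lemma char_entry0_degree:
  "degree (char_entry0 l M k V i j) \<le> (if i = j then 1 else 0)"
  by (auto simp: char_entry0_def char_entry_def)

text \<open>Irreducibility on \<open>S\<close> and nonvanishing of \<open>Q\<close> both contain the
  nonvanishing of a nonzero polynomial in the potential, so one \<open>V\<close> satisfies both.
  Varying the potential at \<open>k\<close> then gives a pencil over an irreducible \<open>F\<close>
  of degree at least 2, and by \<open>pencil_reducible\<close> not all its members are
  reducible.\<close>

lemma char_det_grow:
  fixes l :: "'n::finite \<Rightarrow> 'n \<Rightarrow> complex poly"
  assumes irr: "irreducible (char_det l M S V0)" and S: "card S \<ge> 2"
    and k: "k \<notin> S" and b: "b \<in> S" "l b k \<noteq> 0" "l k b \<noteq> 0"
  shows "\<exists>V. irreducible (char_det l M (insert k S) V)"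
proof (rule ccontr)
  assume "\<not> ?thesis"
  then have red: "\<not> irreducible (char_det l M (insert k S) V)" for V by blast
  obtain K where K: "\<And>V. sdeg_le K (char_det l M S V)" using sdeg_le_char_det_exists by blast
  have "\<exists>P\<in>{g. polyfun g}. P V0 \<noteq> 0 \<and> (\<forall>V. P V \<noteq> 0 \<longrightarrow> irreducible (char_det l M S V))"
    by (rule irreducible_open[OF polyfun_ring coeffs_in_char_det char_det_monic(2) char_det_monic(1) _ K irr])
       (use S in simp)
  then obtain P where P: "polyfun P" "P V0 \<noteq> 0" "\<And>V. P V \<noteq> 0 \<Longrightarrow> irreducible (char_det l M S V)" by blast
  have bk: "b \<noteq> k" using b k by auto
  obtain V1 where "block_det ({b, k} \<union> S) (char_entry0 l M k V1) \<noteq> 0"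
    using char_entry0_det_nonzero[OF bk b(2,3)] by blast
  moreover have "{b, k} \<union> S = insert k S" using b by auto
  ultimately have "block_det (insert k S) (char_entry0 l M k V1) \<noteq> 0" by simp
  then obtain i j where ij: "coeff (coeff (block_det (insert k S) (char_entry0 l M k V1)) i) j \<noteq> 0"
    by (metis leading_coeff_0_iff)
  have "coeffs_in {g. polyfun g} (\<lambda>V. block_det (insert k S) (char_entry0 l M k V))"
    by (intro coeffs_in_block_det polyfun_ring coeffs_in_char_entry0)
  then have "polyfun (\<lambda>V. coeff (coeff (block_det (insert k S) (char_entry0 l M k V)) i) j)"
    by (simp add: coeffs_in_def)
  then obtain V where V: "P V \<noteq> 0" "coeff (coeff (block_det (insert k S) (char_entry0 l M k V)) i) j \<noteq> 0"
    using polyfun_common_nonzero[OF P(1,2), of _ V1] ij by blast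
  define F where "F = char_det l M S V"
  define Q where "Q = - block_det (insert k S) (char_entry0 l M k V)"
  have "\<exists>f. F = [:-f, 1:] \<and> (\<exists>c. f - l k k = monom c M) \<and> (\<exists>c. Q = [:monom c (2 * M):])"
  proof (rule pencil_reducible)
    show "irreducible F" using P(3)[OF V(1)] by (simp add: F_def)
    show "lead_coeff F = 1" unfolding F_def by (rule char_det_monic)
    show "1 \<le> degree F" unfolding F_def char_det_monic using S by simp
    show "Q \<noteq> 0" using V(2) by (auto simp: Q_def)
    have "degree (block_det (insert k S) (char_entry0 l M k V)) < card (insert k S) - 1"
      by (rule block_det_zero_diagonal_degree[where k = k, OF _ _ _ char_entry0_degree])
         (use k S in \<open>auto simp: char_entry0_def\<close>)
    then show "degree Q < degree F" unfolding F_def Q_def char_det_monic using k by simp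
    fix v
    have "insert k S - {k} = S" using k by auto
    then have "char_det l M (insert k S) (update V k v) = [:- (l k k + monom v M), 1:] * F - Q"
      using char_det_update[of k "insert k S" l M V v] by (simp add: F_def Q_def)
    then show "\<not> irreducible ([:- (l k k + monom v M), 1:] * F - Q)" using red by metis
  qed
  then have "degree F = 1" by auto
  then show False using S unfolding F_def char_det_monic by simp
qed

text \<open>A single vertex has a linear characteristic polynomial, which is the exceptional case of
  \<open>pencil_reducible\<close>; its conclusions on \<open>f - l\<close> and \<open>Q\<close> are
  read off for zero potential at \<open>b\<close>.\<close>

lemma char_det_pair:
  fixes l :: "'n::finite \<Rightarrow> 'n \<Rightarrow> complex poly"
  assumes bk: "b \<noteq> k" "l b k \<noteq> 0" "l k b \<noteq> 0"
    and red: "\<And>V. \<not> irreducible (char_det l M {b, k} V)"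
  shows "\<exists>c. l b b - l k k = monom c M" "\<exists>c. l b k * l k b = monom c (2 * M)"
proof -
  define F where "F = [:- l b b, 1:]"
  define Q where "Q = [:- (l b k * l k b):]"
  have F: "lead_coeff F = 1" "degree F = 1" by (simp_all add: F_def)
  have irr: "irreducible F"
  proof (rule ccontr)
    assume "\<not> irreducible F"
    then obtain G H where GH: "F = G * H" "lead_coeff G = 1" "lead_coeff H = 1" "degree G \<ge> 1" "degree H \<ge> 1"
      using monic_not_irreducible_factors[OF F(1)] F(2) by auto
    then have "degree F = degree G + degree H" unfolding GH(1) by (intro degree_mult_eq) auto
    then show False using F GH by simp
  qed
  have b: "{b, k} - {k} = {b}" using bk by auto
  have 1: "char_det l M {b} 0 = F"
    by (simp add: char_det_def block_det_def char_entry_def F_def)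
  have 2: "block_det {b, k} (char_entry0 l M k 0) = [:- (l b k * l k b):]"
    using bk by (simp add: block_det_pair char_entry0_def char_entry_def)
  have "\<exists>f. F = [:-f, 1:] \<and> (\<exists>c. f - l k k = monom c M) \<and> (\<exists>c. - Q = [:monom c (2 * M):])"
  proof (rule ex_forward[OF pencil_reducible[OF irr F(1), of "- Q" "l k k" M]])
    show "degree F \<ge> 1" "- Q \<noteq> 0" "degree (- Q) < degree F" using bk F by (simp_all add: Q_def)
    fix v
    have "char_det l M {b, k} (update 0 k v) = [:- (l k k + monom v M), 1:] * F - (- Q)"
      using char_det_update[of k "{b, k}" l M 0 v] unfolding b 1 2 by (simp add: Q_def)
    then show "\<not> irreducible ([:- (l k k + monom v M), 1:] * F - (- Q))" using red by metis
  qed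
  then show "\<exists>c. l b b - l k k = monom c M" "\<exists>c. l b k * l k b = monom c (2 * M)"
    by (auto simp: F_def Q_def)
qed

lemma char_det_irreducible_extend:
  fixes l :: "'n::finite \<Rightarrow> 'n \<Rightarrow> complex poly"
  assumes conn: "\<And>S. S \<noteq> {} \<Longrightarrow> S \<noteq> UNIV \<Longrightarrow> \<exists>b\<in>S. \<exists>k. k \<notin> S \<and> l b k \<noteq> 0 \<and> l k b \<noteq> 0"
    and irr: "irreducible (char_det l M S V)" and S: "card S \<ge> 2"
  shows "\<exists>V. irreducible (char_det l M UNIV V)"
  using irr S
proof (induction "card (- S)" arbitrary: S V rule: less_induct)
  case less
  show ?case
  proof (cases "S = UNIV")
    case True then show ?thesis using less by auto
  next
    case False
    moreover have "S \<noteq> {}" using less by auto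
    ultimately obtain b k where bk: "b \<in> S" "k \<notin> S" "l b k \<noteq> 0" "l k b \<noteq> 0" using conn by blast
    obtain V' where V': "irreducible (char_det l M (insert k S) V')"
      using char_det_grow[OF less.prems bk(2,1,3,4)] by blast
    have "card (- insert k S) < card (- S)" using bk by (intro psubset_card_mono) auto
    moreover have "card (insert k S) \<ge> 2" using less.prems bk by simp
    ultimately show ?thesis using less.hyps V' by blast
  qed
qed

section \<open>Induced cycles\<close>

text \<open>Moving forward propagates: if \<open>p\<close> sends \<open>j\<close> to
  \<open>r j\<close> without exchanging the two, injectivity forbids \<open>p\<close> to fix
  \<open>r j\<close> or to send it back, so \<open>r j\<close> is moved forward too. The orbit
  condition spreads this over all of \<open>S\<close>.\<close>

lemma permutation_eq_rotation:
  assumes p: "p permutes S" and r: "r permutes S" and r2: "\<And>i. i \<in> S \<Longrightarrow> r (r i) \<noteq> i"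
    and orbit: "\<And>A. A \<subseteq> S \<Longrightarrow> A \<noteq> {} \<Longrightarrow> r ` A \<subseteq> A \<Longrightarrow> A = S"
    and adj: "\<And>i. i \<in> S \<Longrightarrow> p i = i \<or> p i = r i \<or> r (p i) = i"
    and i: "i \<in> S" "p i = r i" "p (p i) \<noteq> i"
  shows "p = r"
proof -
  have injp: "p x = p y \<Longrightarrow> x = y" for x y using p by (metis permutes_inj injD)
  have injr: "r x = r y \<Longrightarrow> x = y" for x y using r by (metis permutes_inj injD)
  have rS: "j \<in> S \<Longrightarrow> r j \<in> S" for j using r by (simp add: permutes_in_image)
  define A where "A = {j \<in> S. p j = r j \<and> p (p j) \<noteq> j}"
  have "r j \<in> A" if "j \<in> A" for j
  proof -
    have j: "j \<in> S" "p j = r j" "p (p j) \<noteq> j" using that by (auto simp: A_def)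
    have rj: "r j \<noteq> j" using r2[OF j(1)] by metis
    have 1: "p (r j) \<noteq> r j" using injp[of "r j" j] j(2) rj by auto
    have 2: "r (p (r j)) \<noteq> r j" using injr[of "p (r j)" j] j by auto
    have 3: "p (r j) = r (r j)" using adj[OF rS[OF j(1)]] 1 2 by blast
    have "p (p (r j)) \<noteq> r j"
    proof
      assume "p (p (r j)) = r j"
      then have "p (r j) = j" using injp j(2) by metis
      then show False using 3 r2[OF j(1)] by simp
    qed
    then show ?thesis using 3 rS[OF j(1)] by (simp add: A_def)
  qed
  then have "A = S" using i by (intro orbit) (auto simp: A_def)
  then have "p j = r j" if "j \<in> S" for j using that by (auto simp: A_def)
  moreover have "p j = r j" if "j \<notin> S" for j using that p r by (simp add: permutes_not_in)
  ultimately show ?thesis by blast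
qed

text \<open>The Wronskian \<open>W\<close> of \<open>A\<close> and \<open>C\<close> is nonzero
  because the degrees differ. At a point \<open>y\<close> where neither \<open>W\<close> nor
  \<open>C\<close> vanishes, choose \<open>t\<close> so that \<open>y\<close> becomes a root; the
  derivative there is \<open>W / C\<close>.\<close>

lemma simple_root_in_pencil:
  fixes A C :: "complex poly"
  assumes "lead_coeff A = 1" "lead_coeff C = 1" "degree A = Suc (degree C)"
  shows "\<exists>t y. poly (A - smult t C) y = 0 \<and> poly (pderiv (A - smult t C)) y \<noteq> 0"
proof -
  define W where "W = pderiv A * C - A * pderiv C"
  have lp: "lead_coeff (pderiv p) = of_nat (degree p) * lead_coeff p" for p :: "complex poly"
    by (cases "degree p = 0") (auto simp: degree_pderiv coeff_pderiv pderiv_eq_0_iff coeff_eq_0)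
  have "W \<noteq> 0"
  proof
    assume "W = 0"
    then have "lead_coeff (pderiv A * C) = lead_coeff (A * pderiv C)" by (simp add: W_def)
    then have "of_nat (degree A) = (of_nat (degree C) :: complex)"
      unfolding lead_coeff_mult lp assms(1,2) by simp
    then show False using assms(3) by simp
  qed
  moreover have "C \<noteq> 0" using assms(2) by auto
  ultimately have "W * C \<noteq> 0" by simp
  then obtain y where y: "poly (W * C) y \<noteq> 0" using poly_all_0_iff_0 by blast
  define t where "t = poly A y / poly C y"
  have "poly (A - smult t C) y = 0" using y by (simp add: t_def)
  moreover have "poly (pderiv (A - smult t C)) y = poly W y / poly C y"
    using y by (simp add: t_def W_def pderiv_diff pderiv_smult field_simps)
  ultimately show ?thesis using y by (intro exI[of _ t] exI[of _ y]) simp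
qed

text \<open>
  For an induced cycle only the two rotations contribute to the dependence of the determinant on \<open>s\<close>:
  every other contributing permutation is an involution, whose monomials cancel in pairs.
\<close>

lemma block_det_cycle:
  fixes c :: "'n::finite \<Rightarrow> 'n \<Rightarrow> complex" and d :: "'n \<Rightarrow> 'n \<Rightarrow> int"
  assumes r: "r permutes S" and r2: "\<And>i. i \<in> S \<Longrightarrow> r (r i) \<noteq> i"
    and orbit: "\<And>A. A \<subseteq> S \<Longrightarrow> A \<noteq> {} \<Longrightarrow> r ` A \<subseteq> A \<Longrightarrow> A = S"
    and S: "S \<noteq> {}"
    and c0: "\<And>i j. i \<in> S \<Longrightarrow> j \<in> S \<Longrightarrow> c i j \<noteq> 0 \<Longrightarrow> i \<noteq> j \<Longrightarrow> j = r i \<or> i = r j"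
    and d: "\<And>i j. i \<in> S \<Longrightarrow> j \<in> S \<Longrightarrow> d j i = - d i j"
    and sym: "\<And>i. i \<in> S \<Longrightarrow> c (r i) i = c i (r i)"
    and E: "(\<Sum>i\<in>S. d i (r i)) = E" and s: "s \<noteq> 0"
  shows "block_det S (\<lambda>i j. c i j * s powi d i j) =
     block_det S c + of_int (sign r) * (\<Prod>i\<in>S. c i (r i)) * (s powi E + s powi (- E) - 2)"
proof -
  let ?P = "{p. p permutes S}"
  define q where "q = inv r"
  have q: "q permutes S" unfolding q_def by (rule permutes_inv[OF r])
  have rq: "r (q i) = i" "q (r i) = i" for i unfolding q_def using r by (simp_all add: permutes_inverses)
  have finP: "finite ?P" by (rule finite_permutations) simp
  define D where "D p = (\<Sum>i\<in>S. d i (p i))" for p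
  have pw: "(\<Prod>i\<in>S. s powi f i) = s powi (\<Sum>i\<in>S. f i)" for f :: "'n \<Rightarrow> int"
    using finite[of S] by (induction S rule: finite_induct) (use s in \<open>auto simp: power_int_add\<close>)
  have trm: "(\<Prod>i\<in>S. c i (p i) * s powi d i (p i)) = (\<Prod>i\<in>S. c i (p i)) * s powi D p" for p
    by (simp add: prod.distrib pw D_def)
  have reindex: "(\<Sum>i\<in>S. f (p i)) = (\<Sum>i\<in>S. f i)" if "p permutes S" for p and f :: "'n \<Rightarrow> int"
    using sum.permute[OF that, of f] by (simp add: o_def)
  have qS: "i \<in> S \<Longrightarrow> q i \<in> S" and rS: "i \<in> S \<Longrightarrow> r i \<in> S" for i using q r by (simp_all add: permutes_in_image)
  have Dr: "D r = E" using E by (simp add: D_def)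
  have Dq: "D q = - E"
  proof -
    have "D q = (\<Sum>i\<in>S. d (r i) (q (r i)))" unfolding D_def by (rule reindex[OF r, symmetric])
    also have "\<dots> = (\<Sum>i\<in>S. - d i (r i))" unfolding rq by (intro sum.cong refl d rS)
    finally show ?thesis using E by (simp add: sum_negf)
  qed
  have cq: "(\<Prod>i\<in>S. c i (q i)) = (\<Prod>i\<in>S. c i (r i))"
  proof -
    have "(\<Prod>i\<in>S. c i (q i)) = (\<Prod>i\<in>S. c (r i) (q (r i)))"
      using prod.permute[OF r, of "\<lambda>i. c i (q i)"] by (simp add: o_def)
    then show ?thesis by (simp add: rq sym cong: prod.cong)
  qed
  have neq: "r \<noteq> q" using S r2 rq by (metis ex_in_conv)
  have orbit_q: "A = S" if A: "A \<subseteq> S" "A \<noteq> {}" "q ` A \<subseteq> A" for A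
  proof -
    have fin: "finite A" by simp
    have "inj_on q A" using q by (metis permutes_inj inj_on_subset subset_UNIV)
    then have "q ` A = A" by (rule endo_inj_surj[OF fin A(3)])
    then have "r ` A = r ` q ` A" by (simp only:)
    also have "\<dots> = A" by (simp add: image_image rq)
    finally show ?thesis using A orbit by blast
  qed
  have zero: "(\<Prod>i\<in>S. c i (p i)) = 0 \<or> D p = 0" if p: "p permutes S" "p \<noteq> r" "p \<noteq> q" for p
  proof (cases "\<forall>i\<in>S. c i (p i) \<noteq> 0")
    case False
    then show ?thesis by (auto simp: prod_zero_iff)
  next
    case True
    have pS: "i \<in> S \<Longrightarrow> p i \<in> S" for i using p(1) by (simp add: permutes_in_image)
    have adj: "p i = i \<or> p i = r i \<or> r (p i) = i" if "i \<in> S" for i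
      using c0[OF that pS[OF that]] True that by metis
    then have adj': "p i = i \<or> p i = q i \<or> q (p i) = i" if "i \<in> S" for i
      using that rq by metis
    have q2: "q (q i) \<noteq> i" if "i \<in> S" for i using r2[OF that] rq by metis
    have inv: "p (p i) = i" if i: "i \<in> S" for i
    proof (rule ccontr)
      assume n: "p (p i) \<noteq> i"
      then have "p i \<noteq> i" by metis
      then consider "p i = r i" | "p i = q i" using adj[OF i] rq by metis
      then show False
      proof cases
        case 1
        then show ?thesis using permutation_eq_rotation[OF p(1) r r2 orbit adj i 1 n] p by blast
      next
        case 2
        then show ?thesis using permutation_eq_rotation[OF p(1) q q2 orbit_q adj' i 2 n] p by blast
      qed
    qed
    \<comment> \<open>For an involution, reindexing by \<open>p\<close> and antisymmetry of
      \<open>d\<close> give \<open>D p = - D p\<close>.\<close>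
    have "D p = (\<Sum>i\<in>S. d (p i) (p (p i)))" unfolding D_def by (rule reindex[OF p(1), symmetric])
    also have "\<dots> = (\<Sum>i\<in>S. - d i (p i))"
    proof (rule sum.cong[OF refl])
      fix i assume "i \<in> S"
      then show "d (p i) (p (p i)) = - d i (p i)" using inv d[OF _ pS] by simp
    qed
    finally have "D p = - D p" by (simp add: D_def sum_negf)
    then show ?thesis by simp
  qed
  \<comment> \<open>Subtracting the value at \<open>s = 1\<close> leaves
    \<open>s powi D p - 1\<close> for each permutation; the two rotations together account for the
    \<open>- 2\<close> in the statement.\<close>
  have "block_det S (\<lambda>i j. c i j * s powi d i j) - block_det S c =
     (\<Sum>p\<in>?P. of_int (sign p) * (\<Prod>i\<in>S. c i (p i)) * (s powi D p - 1))"
    unfolding block_det_def trm by (simp add: sum_subtractf[symmetric] algebra_simps)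
  also have "\<dots> = (\<Sum>p\<in>{r, q}. of_int (sign p) * (\<Prod>i\<in>S. c i (p i)) * (s powi D p - 1))"
  proof (rule sum.mono_neutral_right[OF finP])
    show "{r, q} \<subseteq> ?P" using r q by simp
    show "\<forall>p\<in>?P - {r, q}. of_int (sign p) * (\<Prod>i\<in>S. c i (p i)) * (s powi D p - 1) = 0"
    proof
      fix p assume "p \<in> ?P - {r, q}"
      then have "(\<Prod>i\<in>S. c i (p i)) = 0 \<or> D p = 0" using zero by blast
      then show "of_int (sign p) * (\<Prod>i\<in>S. c i (p i)) * (s powi D p - 1) = 0" by (rule disjE) simp_all
    qed
  qed
  also have "\<dots> = of_int (sign r) * (\<Prod>i\<in>S. c i (r i)) * (s powi E + s powi (- E) - 2)"
  proof -
    have "permutation r" using r by (metis finite permutation_permutes)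
    then have "sign q = sign r" unfolding q_def by (rule sign_inverse)
    then show ?thesis using neq by (simp add: Dr Dq cq algebra_simps)
  qed
  finally show ?thesis by (simp only: diff_eq_eq add.commute)
qed

text \<open>The substitution of \<open>s^M x + ph\<close> for \<open>x\<close> removes the common
  loop part and the scaling. What remains is the constant matrix \<open>Y V\<close> with powers of
  \<open>s\<close> on the edges of the cycle, and these matter only through their total
  exponent.\<close>

lemma char_det_cycle:
  fixes l :: "'n::finite \<Rightarrow> 'n \<Rightarrow> complex poly" and g :: "'n \<Rightarrow> complex" and eps :: "'n \<Rightarrow> int"
  assumes r: "r permutes S" and r2: "\<And>i. i \<in> S \<Longrightarrow> r (r i) \<noteq> i"
    and orbit: "\<And>A. A \<subseteq> S \<Longrightarrow> A \<noteq> {} \<Longrightarrow> r ` A \<subseteq> A \<Longrightarrow> A = S"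
    and S: "S \<noteq> {}"
    and diag: "\<And>i. i \<in> S \<Longrightarrow> l i i = ph"
    and off: "\<And>i j. i \<in> S \<Longrightarrow> j \<in> S \<Longrightarrow> i \<noteq> j \<Longrightarrow> j \<noteq> r i \<Longrightarrow> i \<noteq> r j \<Longrightarrow> l i j = 0"
    and fwd: "\<And>i. i \<in> S \<Longrightarrow> l i (r i) = monom (g i) (nat (int M + eps i))"
    and bwd: "\<And>i. i \<in> S \<Longrightarrow> l (r i) i = monom (g i) (nat (int M - eps i))"
    and eps: "\<And>i. i \<in> S \<Longrightarrow> \<bar>eps i\<bar> \<le> int M" and g: "\<And>i. i \<in> S \<Longrightarrow> g i \<noteq> 0"
    and E: "(\<Sum>i\<in>S. eps i) \<noteq> 0"
  shows "\<exists>V. irreducible (char_det l M S V)"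
proof -
  define E where "E = (\<Sum>i\<in>S. eps i)"
  define m where "m = card S"
  have r1: "r i \<noteq> i" if "i \<in> S" for i using r2[OF that] by metis
  have rinj: "r i = r j \<Longrightarrow> i = j" for i j using r by (metis permutes_inj injD)
  have rS: "i \<in> S \<Longrightarrow> r i \<in> S" for i using r by (simp add: permutes_in_image)
  define c where "c i j = (if j = r i then - g i else if i = r j then - g j else 0)" for i j
  define d where "d i j = (if i = j then 0 else if j = r i then eps i else if i = r j then - eps j else 0)" for i j
  define Y where "Y V i j = (if i = j then [:- (V $ i), 1:] else [:- (- c i j):])" for V :: "complex ^ 'n" and i j
  have Y: "Y V = (\<lambda>i j. if i = j then [:- (if i = j then V $ i else - c i j), 1:] else [:- (if i = j then V $ i else - c i j):])" for V
    by (auto simp: Y_def fun_eq_iff)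
  have Ymonic: "degree (block_det T (Y V)) = card T" "lead_coeff (block_det T (Y V)) = 1" for V and T :: "'n set"
    unfolding Y using block_det_char_monic[of T "\<lambda>i j. if i = j then V $ i else - c i j"] by simp_all
  have Yupd: "block_det T (Y (update V k v)) = block_det T (Y (update V k 0)) - smult v (block_det (T - {k}) (Y V))"
    if "k \<in> T" for T V k v
  proof -
    have "Y (update V k v) = (\<lambda>i j. Y (update V k 0) i j + (if i = k \<and> j = k then [:-v:] else 0))"
      by (auto simp: fun_eq_iff Y_def update_nth)
    then have "block_det T (Y (update V k v)) = block_det T (Y (update V k 0)) + [:-v:] * block_det (T - {k}) (Y (update V k 0))"
      by (simp only:) (rule block_det_add_diagonal, use that in auto)
    also have "block_det (T - {k}) (Y (update V k 0)) = block_det (T - {k}) (Y V)"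
      by (rule block_det_cong) (auto simp: Y_def update_nth)
    finally show ?thesis by simp
  qed
  define T where "T = of_int (sign r) * (\<Prod>i\<in>S. c i (r i))"
  have T0: "T \<noteq> 0" using g by (simp add: T_def c_def sign_def prod_zero_iff)
  have ev: "eval2 (char_det l M S V) s (s ^ M * x + poly ph s) =
      s ^ (M * m) * (poly (block_det S (Y V)) x + T * (s powi E + s powi (- E) - 2))" if s: "s \<noteq> 0" for V s x
  proof -
    have mon: "poly (monom a (nat (int M + k))) s = s ^ M * (a * s powi k)" if k: "\<bar>k\<bar> \<le> int M" for a k
    proof -
      have "s ^ nat (int M + k) = s powi (int M + k)" using k by (simp add: power_int_def)
      also have "\<dots> = s ^ M * s powi k" using s by (simp add: power_int_add)
      finally show ?thesis by (simp add: poly_monom)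
    qed
    define c' where "c' i j = poly (Y V i j) x" for i j
    have "eval2 (char_entry l M V i j) s (s ^ M * x + poly ph s) = s ^ M * (c' i j * s powi d i j)"
      if ij: "i \<in> S" "j \<in> S" for i j
    proof -
      consider "i = j" | "j = r i" "i \<noteq> j" | "i = r j" "i \<noteq> j" | "i \<noteq> j" "j \<noteq> r i" "i \<noteq> r j" by blast
      then show ?thesis
      proof cases
        case 1
        then show ?thesis using diag[OF ij(1)]
          by (simp add: char_entry_def c'_def Y_def d_def poly_monom algebra_simps)
      next
        case 2
        then show ?thesis using fwd[OF ij(1)] mon[OF eps[OF ij(1)], of "g i"]
          by (simp add: char_entry_def c'_def Y_def d_def c_def)
      next
        case 3
        have "j \<noteq> r i" using 3 r2[OF ij(2)] by metis
        then show ?thesis using 3 bwd[OF ij(2)] mon[of "- eps j" "g j"] eps[OF ij(2)]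
          by (simp add: char_entry_def c'_def Y_def d_def c_def)
      next
        case 4
        then show ?thesis using off[OF ij] by (simp add: char_entry_def c'_def Y_def c_def)
      qed
    qed
    then have "eval2 (char_det l M S V) s (s ^ M * x + poly ph s) = block_det S (\<lambda>i j. s ^ M * (c' i j * s powi d i j))"
      unfolding char_det_def eval2_block_det by (rule block_det_cong)
    also have "\<dots> = (s ^ M) ^ m * block_det S (\<lambda>i j. c' i j * s powi d i j)"
      unfolding m_def by (rule block_det_scale)
    also have "block_det S (\<lambda>i j. c' i j * s powi d i j) = block_det S c' +
       of_int (sign r) * (\<Prod>i\<in>S. c' i (r i)) * (s powi E + s powi (- E) - 2)"
    proof (rule block_det_cycle[OF r r2 orbit S _ _ _ _ s])
      show "j = r i \<or> i = r j" if "i \<in> S" "j \<in> S" "c' i j \<noteq> 0" "i \<noteq> j" for i j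
        using that by (auto simp: c'_def Y_def c_def split: if_splits)
      show "d j i = - d i j" if "i \<in> S" "j \<in> S" for i j
        using that r2[of i] r2[of j] by (auto simp: d_def)
      show "c' (r i) i = c' i (r i)" if "i \<in> S" for i
        using that r1[OF that] r2[OF that] by (auto simp: c'_def Y_def c_def)
      show "(\<Sum>i\<in>S. d i (r i)) = E" unfolding E_def
        by (intro sum.cong refl) (simp add: d_def r1[THEN not_sym])
    qed
    also have "block_det S c' = poly (block_det S (Y V)) x"
      by (simp add: block_det_def c'_def[abs_def] poly_sum poly_prod)
    also have "(\<Prod>i\<in>S. c' i (r i)) = (\<Prod>i\<in>S. c i (r i))"
      by (intro prod.cong refl) (simp add: c'_def Y_def r1[THEN not_sym])
    finally show ?thesis by (simp add: T_def power_mult mult.assoc)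
  qed
  obtain k where k: "k \<in> S" using S by auto
  \<comment> \<open>The potential at this second vertex is used to give the minor without
    \<open>k\<close> a simple root; the potential at \<open>k\<close> stays free as the parameter of
    the pencil.\<close>
  define b where "b = r k"
  have b: "b \<in> S - {k}" using k r1 rS by (auto simp: b_def)
  obtain t y where ty: "poly (block_det (S - {k}) (Y (update 0 b t))) y = 0"
      "poly (pderiv (block_det (S - {k}) (Y (update 0 b t)))) y \<noteq> 0"
  proof -
    have "\<exists>t y. poly (block_det (S - {k}) (Y (update 0 b 0)) - smult t (block_det (S - {k} - {b}) (Y 0))) y = 0 \<and>
       poly (pderiv (block_det (S - {k}) (Y (update 0 b 0)) - smult t (block_det (S - {k} - {b}) (Y 0)))) y \<noteq> 0"
    proof (rule simple_root_in_pencil)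
      show "degree (block_det (S - {k}) (Y (update 0 b 0))) = Suc (degree (block_det (S - {k} - {b}) (Y 0)))"
        unfolding Ymonic(1) using b by (metis card_Suc_Diff1 finite)
    qed (rule Ymonic)+
    then show ?thesis using that unfolding Yupd[OF b, symmetric] by blast
  qed
  define V where "V = update 0 b t"
  have "\<exists>v. irreducible (char_det l M S (update V k v))"
  proof (rule cycle_pencil_irreducible)
    show "lead_coeff (char_det l M S (update V k v)) = 1" for v by (rule char_det_monic)
    show "degree (char_det l M S (update V k v)) = m" for v unfolding m_def by (rule char_det_monic)
    show "m \<ge> 1" using S by (simp add: m_def Suc_leI card_gt_0_iff)
    show "char_det l M S (update V k v) =
      ([:- l k k, 1:] * char_det l M (S - {k}) V + block_det S (char_entry0 l M k V)) - [:monom v M:] * char_det l M (S - {k}) V" for v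
    proof -
      have "[:- (l k k + monom v M), 1:] = [:- l k k, 1:] - [:monom v M:]" by simp
      then show ?thesis unfolding char_det_update[OF k] by (simp only: left_diff_distrib diff_add_eq)
    qed
    show "- T \<noteq> 0" using T0 by simp
    show "nat \<bar>E\<bar> \<ge> 1" using assms(11) by (simp add: E_def)
    show "poly (block_det (S - {k}) (Y V)) y = 0" "poly (pderiv (block_det (S - {k}) (Y V))) y \<noteq> 0"
      using ty by (simp_all add: V_def)
    fix v s x :: complex assume s: "s \<noteq> 0"
    \<comment> \<open>The sum is symmetric in the sign of \<open>E\<close>, hence the exponent
      \<open>nat \<bar>E\<bar>\<close>; the constant \<open>2 * T\<close> is moved into the
      polynomial in \<open>x\<close>.\<close>
    have "s powi E + s powi (- E) = s ^ nat \<bar>E\<bar> + inverse (s ^ nat \<bar>E\<bar>)"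
      by (cases "E \<ge> 0") (auto simp: power_int_def power_inverse)
    then show "eval2 (char_det l M S (update V k v)) s (s ^ M * x + poly ph s) =
       s ^ (M * m) * (poly (block_det S (Y (update V k 0)) - [:2 * T:]) x - v * poly (block_det (S - {k}) (Y V)) x
         - (- T) * (s ^ nat \<bar>E\<bar> + inverse (s ^ nat \<bar>E\<bar>)))"
      unfolding ev[OF s] by (subst Yupd[OF k, of V v]) (simp add: algebra_simps)
  qed
  then show ?thesis by blast
qed

section \<open>Closed walks\<close>

fun walk_sum :: "('n \<Rightarrow> 'n \<Rightarrow> 'a::comm_monoid_add) \<Rightarrow> 'n list \<Rightarrow> 'a" where
  "walk_sum f (x # y # xs) = f x y + walk_sum f (y # xs)"
| "walk_sum f _ = 0"

lemma walk_sum_append: "walk_sum f (xs @ y # ys) = walk_sum f (xs @ [y]) + walk_sum f (y # ys)"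
  by (induction f xs rule: walk_sum.induct) (auto simp: add.assoc)

lemma walk_sum_conv_sum: "walk_sum f xs = (\<Sum>j<length xs - 1. f (xs ! j) (xs ! Suc j))"
proof (induction f xs rule: walk_sum.induct)
  case (1 f x y xs)
  then show ?case by (simp add: sum.lessThan_Suc_shift del: sum.lessThan_Suc)
qed auto

lemma walk_sum_join:
  "xs \<noteq> [] \<Longrightarrow> ys \<noteq> [] \<Longrightarrow> walk_sum f (xs @ ys) = walk_sum f xs + f (last xs) (hd ys) + walk_sum f ys"
proof (induction f xs rule: walk_sum.induct)
  case (1 f x y xs)
  then show ?case by (simp add: add.assoc)
next
  case ("2_2" f x)
  then show ?case by (cases ys) auto
qed auto

lemma walk_sum_rev:
  fixes f :: "'n \<Rightarrow> 'n \<Rightarrow> 'a::ab_group_add"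
  assumes "successively G xs" "\<And>x y. G x y \<Longrightarrow> f y x = - f x y"
  shows "walk_sum f (rev xs) = - walk_sum f xs"
  using assms(1)
proof (induction xs)
  case (Cons x xs)
  show ?case
  proof (cases xs)
    case Nil then show ?thesis by simp
  next
    case (Cons y ys)
    then have "walk_sum f (rev (x # xs)) = walk_sum f (rev xs) + f y x"
      using walk_sum_join[of "rev xs" "[x]" f] by simp
    also have "\<dots> = - walk_sum f xs - f x y" using Cons.IH Cons.prems Cons assms(2) by simp
    finally show ?thesis using Cons by simp
  qed
qed simp

text \<open>The list does not repeat its starting vertex; the return to it is supplied by
  \<open>xs @ [hd xs]\<close>.\<close>

definition closed_walk :: "('n \<Rightarrow> 'n \<Rightarrow> bool) \<Rightarrow> 'n list \<Rightarrow> bool" where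
  "closed_walk G xs \<longleftrightarrow> xs \<noteq> [] \<and> successively G (xs @ [hd xs])"

lemma nth_append_hd:
  assumes "c \<noteq> []" "j < length c"
  shows "(c @ [hd c]) ! Suc j = c ! (Suc j mod length c)"
  using assms by (cases "Suc j = length c") (auto simp: nth_append hd_conv_nth)

lemma successively_append_hd:
  assumes "c \<noteq> []"
  shows "successively G (c @ [hd c]) \<longleftrightarrow> (\<forall>j<length c. G (c ! j) (c ! (Suc j mod length c)))"
proof -
  have "G ((c @ [hd c]) ! j) ((c @ [hd c]) ! Suc j) \<longleftrightarrow> G (c ! j) (c ! (Suc j mod length c))"
    if "j < length c" for j
    unfolding nth_append_hd[OF assms that] using that by (simp add: nth_append)
  then show ?thesis unfolding successively_conv_nth by auto
qed

lemma walk_sum_append_hd: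
  assumes "c \<noteq> []"
  shows "walk_sum f (c @ [hd c]) = (\<Sum>j<length c. f (c ! j) (c ! (Suc j mod length c)))"
  unfolding walk_sum_conv_sum
proof (rule sum.cong)
  fix j assume "j \<in> {..<length c}"
  then have j: "j < length c" by simp
  show "f ((c @ [hd c]) ! j) ((c @ [hd c]) ! Suc j) = f (c ! j) (c ! (Suc j mod length c))"
    unfolding nth_append_hd[OF assms j] using j by (simp add: nth_append)
qed simp

text \<open>A shortest closed walk with nonzero sum works. A repeated vertex or a chord splits it
  into two shorter closed walks whose sums add up to the whole, the chord being traversed once in
  each direction and cancelling by antisymmetry; so one of them would still have nonzero
  sum.\<close>

lemma induced_cycle_exists:
  fixes f :: "'n \<Rightarrow> 'n \<Rightarrow> 'a::ab_group_add"
  assumes irrefl: "\<And>x. \<not> G x x" and sym: "\<And>x y. G x y \<Longrightarrow> G y x"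
    and anti: "\<And>x y. G x y \<Longrightarrow> f y x = - f x y"
    and ex: "closed_walk G ws" "walk_sum f (ws @ [hd ws]) \<noteq> 0"
  obtains c where "3 \<le> length c" "distinct c"
    "\<And>j. j < length c \<Longrightarrow> G (c ! j) (c ! (Suc j mod length c))"
    "\<And>i j. i < length c \<Longrightarrow> j < length c \<Longrightarrow> G (c ! i) (c ! j) \<Longrightarrow>
       j = Suc i mod length c \<or> i = Suc j mod length c"
    "(\<Sum>j<length c. f (c ! j) (c ! (Suc j mod length c))) \<noteq> 0"
proof -
  let ?P = "\<lambda>xs. closed_walk G xs \<and> walk_sum f (xs @ [hd xs]) \<noteq> 0"
  obtain c where c: "?P c" and min: "\<And>xs. ?P xs \<Longrightarrow> length c \<le> length xs"
    using ex_has_least_nat[of ?P ws length] ex by auto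
  have ne: "c \<noteq> []" and suc: "successively G (c @ [hd c])" and nz: "walk_sum f (c @ [hd c]) \<noteq> 0"
    using c by (auto simp: closed_walk_def)
  have zero: "walk_sum f (xs @ [hd xs]) = 0" if "xs \<noteq> []" "successively G (xs @ [hd xs])" "length xs < length c" for xs
    using min[of xs] that by (auto simp: closed_walk_def not_le)
  have dist: "distinct c"
  proof (rule ccontr)
    assume "\<not> distinct c"
    then obtain A B D y where c': "c = A @ [y] @ B @ [y] @ D" by (metis not_distinct_decomp)
    have h: "hd c = hd (A @ y # D)" by (simp add: c' hd_append)
    have "successively G (A @ (y # B @ [y]) @ (D @ [hd c]))" using suc by (simp add: c')
    then have s1: "successively G (y # B @ [y])" by (simp only: successively_append_iff)
    have "successively G ((A @ [y]) @ (B @ [y] @ D @ [hd c]))" using suc by (simp add: c')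
    then have s2: "successively G (A @ [y])" by (simp only: successively_append_iff)
    have "successively G ((A @ [y] @ B) @ (y # D @ [hd c]))" using suc by (simp add: c')
    then have s3: "successively G (y # D @ [hd c])" by (simp only: successively_append_iff)
    have s4: "successively G (A @ (y # D @ [hd c]))" using s2 s3 by (simp add: successively_append_iff)
    have "walk_sum f ((y # B) @ [hd (y # B)]) = 0"
      by (rule zero) (use s1 in \<open>auto simp: c'\<close>)
    moreover have "walk_sum f ((A @ y # D) @ [hd (A @ y # D)]) = 0"
      by (rule zero) (use s4 in \<open>auto simp: c' h[unfolded c', simplified]\<close>)
    moreover have "walk_sum f (c @ [hd c]) = walk_sum f (A @ [y]) + (walk_sum f (y # B @ [y]) + walk_sum f (y # D @ [hd c]))"
      using walk_sum_append[of f A y "B @ y # D @ [hd c]"] walk_sum_append[of f "y # B" y "D @ [hd c]"] by (simp add: c')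
    moreover have "walk_sum f ((A @ y # D) @ [hd c]) = walk_sum f (A @ [y]) + walk_sum f (y # D @ [hd c])"
      using walk_sum_append[of f A y "D @ [hd c]"] by simp
    ultimately show False using nz h by simp
  qed
  define m where "m = length c"
  have len: "3 \<le> length c"
  proof (rule ccontr)
    assume "\<not> 3 \<le> length c"
    moreover have "length c \<noteq> 0" using ne by simp
    ultimately have "length c = 1 \<or> length c = 2" by linarith
    then consider x where "c = [x]" | x y where "c = [x, y]"
      by (auto simp: length_Suc_conv numeral_2_eq_2)
    then show False
    proof cases
      case 1 then show False using suc irrefl by simp
    next
      case 2 then show False using suc nz anti[of x y] by simp
    qed
  qed
  have edge: "G (c ! j) (c ! (Suc j mod m))" if "j < m" for j
    using suc that unfolding successively_append_hd[OF ne] m_def by blast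
  have sum: "walk_sum f (c @ [hd c]) = (\<Sum>j<m. f (c ! j) (c ! (Suc j mod m)))"
    unfolding m_def by (rule walk_sum_append_hd[OF ne])
  \<comment> \<open>For \<open>i < j\<close> the second alternative is the closing edge of the
    cycle.\<close>
  have chord: "j = Suc i \<or> i = 0 \<and> Suc j = m" if ij: "i < j" "j < m" and G: "G (c ! i) (c ! j)" for i j
  proof (rule ccontr)
    assume n: "\<not> ?thesis"
    define A where "A = take i c"
    define B where "B = drop (Suc i) (take j c)"
    define D where "D = drop (Suc j) c"
    define p where "p = c ! i"
    define q where "q = c ! j"
    have "c = take j c @ q # D" unfolding q_def D_def using ij by (simp add: id_take_nth_drop m_def)
    moreover have "take j c = A @ p # B"
      using id_take_nth_drop[of i "take j c"] ij by (simp add: A_def B_def p_def m_def min_def)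
    ultimately have c': "c = A @ p # B @ q # D" by simp
    have "length B = j - Suc i" using ij by (simp add: B_def m_def)
    then have B: "B \<noteq> []" using n ij by auto
    have AD: "A \<noteq> [] \<or> D \<noteq> []" using n ij by (auto simp: A_def D_def m_def)
    have Gpq: "G p q" using G by (simp add: p_def q_def)
    have h: "hd c = hd (A @ p # q # D)" by (simp add: c' hd_append)
    have "successively G (A @ (p # B @ [q]) @ (D @ [hd c]))" using suc by (simp add: c')
    then have s1: "successively G (p # B @ [q])" by (simp only: successively_append_iff)
    have "successively G ((A @ [p]) @ (B @ [q] @ D @ [hd c]))" using suc by (simp add: c')
    then have s2: "successively G (A @ [p])" by (simp only: successively_append_iff)
    have "successively G ((A @ [p] @ B) @ (q # D @ [hd c]))" using suc by (simp add: c')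
    then have s3: "successively G (q # D @ [hd c])" by (simp only: successively_append_iff)
    have s4: "successively G ((A @ [p]) @ (q # D @ [hd c]))"
      using s2 s3 Gpq by (simp add: successively_append_iff)
    have s5: "successively G ((p # B @ [q]) @ [p])"
      by (rule successively_append_iff[THEN iffD2]) (use s1 sym[OF Gpq] in auto)
    have "walk_sum f ((p # B @ [q]) @ [hd (p # B @ [q])]) = 0"
      by (rule zero) (use s5 AD in \<open>auto simp: c' Suc_le_eq\<close>)
    then have z1: "walk_sum f (p # B @ [q]) + f q p = 0"
      using walk_sum_join[of "p # B @ [q]" "[p]" f] by simp
    have "walk_sum f ((A @ p # q # D) @ [hd (A @ p # q # D)]) = 0"
      by (rule zero) (use s4 B in \<open>auto simp: c' h[unfolded c', simplified]\<close>)
    moreover have "walk_sum f ((A @ p # q # D) @ [hd c]) = walk_sum f (A @ [p]) + (f p q + walk_sum f (q # D @ [hd c]))"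
      using walk_sum_append[of f A p "q # D @ [hd c]"] by simp
    ultimately have z2: "walk_sum f (A @ [p]) + (f p q + walk_sum f (q # D @ [hd c])) = 0" using h by simp
    have "walk_sum f (c @ [hd c]) = walk_sum f (A @ [p]) + (walk_sum f (p # B @ [q]) + walk_sum f (q # D @ [hd c]))"
      using walk_sum_append[of f A p "B @ q # D @ [hd c]"] walk_sum_append[of f "p # B" q "D @ [hd c]"] by (simp add: c')
    then have "walk_sum f (c @ [hd c]) = (walk_sum f (A @ [p]) + (f p q + walk_sum f (q # D @ [hd c]))) + (walk_sum f (p # B @ [q]) + f q p)"
      using anti[OF Gpq] by (simp add: algebra_simps)
    then show False using z1 z2 nz by simp
  qed
  have "j = Suc i mod m \<or> i = Suc j mod m" if ij: "i < m" "j < m" and G: "G (c ! i) (c ! j)" for i j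
  proof -
    have "i \<noteq> j" using G irrefl by auto
    then consider "i < j" | "j < i" by linarith
    then show ?thesis
    proof cases
      case 1 then show ?thesis using chord[OF 1 ij(2) G] ij by (auto simp: mod_Suc)
    next
      case 2 then show ?thesis using chord[OF 2 ij(1) sym[OF G]] ij by (auto simp: mod_Suc)
    qed
  qed
  then show ?thesis using that[OF len dist] edge sum nz by (simp add: m_def)
qed

text \<open>The potential of a vertex is the sum along a chosen walk from a base vertex. For an edge
  from \<open>x\<close> to \<open>y\<close>, the walk to \<open>x\<close>, the edge and the reversed
  walk to \<open>y\<close> form a closed walk.\<close>

lemma potential_exists:
  fixes f :: "'n \<Rightarrow> 'n \<Rightarrow> 'a::ab_group_add"
  assumes sym: "\<And>x y. G x y \<Longrightarrow> G y x" and anti: "\<And>x y. G x y \<Longrightarrow> f y x = - f x y"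
    and conn: "\<And>x y. (x, y) \<in> {(x, y). G x y}\<^sup>*"
    and zero: "\<And>xs. closed_walk G xs \<Longrightarrow> walk_sum f (xs @ [hd xs]) = 0"
  obtains phi where "\<And>x y. G x y \<Longrightarrow> f x y = phi y - phi x"
proof -
  define r :: 'n where "r = undefined"
  have "\<exists>xs. xs \<noteq> [] \<and> hd xs = r \<and> last xs = y \<and> successively G xs" for y
    using conn[of r y]
  proof (induction rule: rtrancl_induct)
    case base then show ?case by (intro exI[of _ "[r]"]) simp
  next
    case (step y z)
    then obtain xs where "xs \<noteq> []" "hd xs = r" "last xs = y" "successively G xs" by blast
    then show ?case using step by (intro exI[of _ "xs @ [z]"]) (auto simp: successively_append_iff)
  qed
  then obtain W where W: "\<And>y. W y \<noteq> []" "\<And>y. hd (W y) = r" "\<And>y. last (W y) = y" "\<And>y. successively G (W y)"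
    by metis
  have pot: "f x y = walk_sum f (W y) - walk_sum f (W x)" if G: "G x y" for x y
  proof -
    let ?zs = "W x @ rev (W y)"
    have rev: "successively G (rev (W y))"
      unfolding successively_rev using W(4)[of y] by (rule successively_mono) (use sym in auto)
    have s: "successively G ?zs"
      using W G rev by (auto simp: successively_append_iff hd_rev)
    have last: "last ?zs = r" using W by (simp add: last_rev)
    have zs: "?zs = butlast ?zs @ [hd (butlast ?zs)]"
    proof -
      obtain z zs where Wy: "W y = z # zs" using W(1) by (cases "W y") auto
      have "z = r" using W(2)[of y] Wy by simp
      then show ?thesis using W(1,2)[of x] Wy by (simp add: butlast_append hd_append)
    qed
    have "closed_walk G (butlast ?zs)"
      unfolding closed_walk_def zs[symmetric] using s W(1)[of x] W(1)[of y] by (auto simp: butlast_append)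
    then have "walk_sum f ?zs = 0" using zero zs by metis
    then have "walk_sum f (W x) + f x y - walk_sum f (W y) = 0"
      using walk_sum_join[of "W x" "rev (W y)" f] W walk_sum_rev[OF W(4) anti] by (simp add: hd_rev)
    then show ?thesis by (simp add: algebra_simps)
  qed
  show ?thesis by (rule that[of "\<lambda>y. walk_sum f (W y)"]) (rule pot)
qed

text \<open>The successor map along the cycle. The last two properties express that the cycle is
  longer than two and that the map is transitive on it, in the form used by the determinant
  expansion.\<close>

lemma rotation_exists:
  assumes "distinct c" "3 \<le> length c"
  obtains r where "r permutes set c" "\<And>j. j < length c \<Longrightarrow> r (c ! j) = c ! (Suc j mod length c)"
    "\<And>x. x \<in> set c \<Longrightarrow> r (r x) \<noteq> x"
    "\<And>A. A \<subseteq> set c \<Longrightarrow> A \<noteq> {} \<Longrightarrow> r ` A \<subseteq> A \<Longrightarrow> A = set c"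
proof -
  define m where "m = length c"
  have m: "m \<ge> 3" using assms by (simp add: m_def)
  define r where "r x = (if x \<in> set c then c ! (Suc (THE j. j < m \<and> c ! j = x) mod m) else x)" for x
  have the: "(THE j'. j' < m \<and> c ! j' = c ! j) = j" if "j < m" for j
    using that assms(1) by (intro the_equality) (auto simp: m_def nth_eq_iff_index_eq)
  have r: "r (c ! j) = c ! (Suc j mod m)" if "j < m" for j
    using that by (simp add: r_def the m_def[symmetric])
  have lt: "Suc j mod m < m" for j using m by simp
  have S: "set c = (!) c ` {..<m}" by (auto simp: m_def set_conv_nth)
  have "inj_on r (set c)"
  proof (rule inj_onI)
    fix x y assume "x \<in> set c" "y \<in> set c" "r x = r y"
    then obtain i j where ij: "i < m" "j < m" "x = c ! i" "y = c ! j" "c ! (Suc i mod m) = c ! (Suc j mod m)"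
      unfolding S by (auto simp: r)
    then have "Suc i mod m = Suc j mod m" using lt assms(1) by (simp add: m_def nth_eq_iff_index_eq)
    then have "i = j" using ij by (auto simp: mod_Suc split: if_splits)
    then show "x = y" using ij by simp
  qed
  moreover have "r ` set c \<subseteq> set c" unfolding S using lt by (auto simp: r)
  ultimately have "bij_betw r (set c) (set c)" by (simp add: bij_betw_def endo_inj_surj)
  then have 1: "r permutes set c" by (rule bij_imp_permutes) (simp add: r_def)
  have 2: "r (r x) \<noteq> x" if x: "x \<in> set c" for x
  proof
    assume e: "r (r x) = x"
    obtain j where j: "j < m" "x = c ! j" using x S by auto
    then have "c ! (Suc (Suc j mod m) mod m) = c ! j" using e by (simp add: r lt)
    then have "Suc (Suc j mod m) mod m = j" using lt j assms(1) by (simp add: m_def nth_eq_iff_index_eq)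
    then show False using j m by (auto simp: mod_Suc split: if_splits)
  qed
  have 3: "A = set c" if A: "A \<subseteq> set c" "A \<noteq> {}" "r ` A \<subseteq> A" for A
  proof -
    obtain x where x: "x \<in> A" using A(2) by blast
    then have "x \<in> (!) c ` {..<m}" using A(1) S by blast
    then obtain j where j: "j < m" "c ! j \<in> A" using x by blast
    have step: "c ! ((j + n) mod m) \<in> A" for n
    proof (induction n)
      case 0 then show ?case using j by simp
    next
      case (Suc n)
      have "r (c ! ((j + n) mod m)) \<in> A" using Suc A(3) by blast
      then show ?case using m by (simp add: r mod_Suc_eq)
    qed
    \<comment> \<open>From position \<open>j\<close>, going on by \<open>k + (m - j)\<close> steps
      leads to position \<open>k\<close> modulo \<open>m\<close>.\<close>
    have "c ! k \<in> A" if "k < m" for k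
      using step[of "k + (m - j)"] that j by (simp add: add.commute add.left_commute)
    then have "set c \<subseteq> A" unfolding S by blast
    then show ?thesis using A(1) by (rule antisym[rotated])
  qed
  show ?thesis using that[OF 1 r[unfolded m_def] 2 3] by blast
qed

section \<open>Choice of an irreducible slice\<close>

definition dot :: "int ^ 'd::finite \<Rightarrow> int ^ 'd \<Rightarrow> int" where
  "dot w a = (\<Sum>k\<in>UNIV. w $ k * a $ k)"

lemma dot_simps: "dot w (a + b) = dot w a + dot w b" "dot w (a - b) = dot w a - dot w b"
  "dot w (- a) = - dot w a" "dot w 0 = 0"
  by (simp_all add: dot_def algebra_simps sum.distrib sum_subtractf sum_negf)

lemma dot_sum: "dot w (\<Sum>i\<in>A. f i) = (\<Sum>i\<in>A. dot w (f i))"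
  by (induction A rule: infinite_finite_induct) (auto simp: dot_simps)

text \<open>If \<open>w\<close> is orthogonal to the new vector \<open>b\<close>, then
  \<open>T w + b\<close> is not, since \<open>dot b b\<close> is nonzero. With \<open>T\<close>
  larger than all \<open>\<bar>dot b a\<bar>\<close>, a nonzero integer multiple of \<open>T\<close>
  cannot be cancelled by \<open>dot b a\<close>.\<close>

lemma generic_direction:
  assumes "finite \<Omega>" "0 \<notin> \<Omega>"
  shows "\<exists>w :: int ^ 'd::finite. \<forall>a\<in>\<Omega>. dot w a \<noteq> 0"
  using assms
proof (induction \<Omega> rule: finite_induct)
  case (insert b \<Omega>)
  then obtain w where w: "\<forall>a\<in>\<Omega>. dot w a \<noteq> 0" by auto
  show ?case
  proof (cases "dot w b = 0")
    case False then show ?thesis using w by auto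
  next
    case True
    define T where "T = 1 + (\<Sum>a\<in>\<Omega>. \<bar>dot b a\<bar>)"
    define w' where "w' = (\<chi> k. T * w $ k + b $ k)"
    have w': "dot w' a = T * dot w a + dot b a" for a
      by (simp add: w'_def dot_def algebra_simps sum.distrib sum_distrib_left)
    have "dot b b \<noteq> 0"
    proof
      assume "dot b b = 0"
      then have "\<forall>k\<in>UNIV. b $ k * b $ k = 0" unfolding dot_def
        by (subst (asm) sum_nonneg_eq_0_iff) auto
      then have "b = 0" by (simp add: vec_eq_iff)
      then show False using insert by simp
    qed
    then have "dot w' b \<noteq> 0" using True by (simp add: w')
    moreover have "dot w' a \<noteq> 0" if a: "a \<in> \<Omega>" for a
    proof
      assume "dot w' a = 0"
      then have "\<bar>dot b a\<bar> = \<bar>T\<bar> * \<bar>dot w a\<bar>" unfolding w' by (metis abs_minus_cancel abs_mult add.commute add_eq_0_iff)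
      moreover have "\<bar>dot b a\<bar> \<le> (\<Sum>a\<in>\<Omega>. \<bar>dot b a\<bar>)" using a insert.hyps by (intro member_le_sum) auto
      then have "\<bar>dot b a\<bar> < \<bar>T\<bar>" by (simp add: T_def)
      moreover have "\<bar>dot w a\<bar> \<ge> 1" using w a by fastforce
      then have "\<bar>T\<bar> \<le> \<bar>T\<bar> * \<bar>dot w a\<bar>" by (simp add: mult_le_cancel_left1)
      ultimately show False by linarith
    qed
    ultimately show ?thesis by blast
  qed
qed simp

text \<open>
  The matrix of Laurent polynomials with entries \<open>\<Sum> wt i j a z\<^sup>a\<close> is restricted to the curves
  \<open>z = (c\<^sub>k s\<^bsup>w\<^sub>k\<^esup>)\<^sub>k\<close> and multiplied by \<open>s\<^sup>M\<close>, which makes its entries polynomials in \<open>s\<close>.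
\<close>

locale floquet_graph =
  fixes C :: "'n::finite \<Rightarrow> 'n \<Rightarrow> (int ^ 'd::finite) set"
    and wt :: "'n \<Rightarrow> 'n \<Rightarrow> int ^ 'd \<Rightarrow> complex"
  assumes fin: "\<And>i j. finite (C i j)"
    and sym: "\<And>i j a. a \<in> C i j \<Longrightarrow> - a \<in> C j i"
    and wt_sym: "\<And>i j a. a \<in> C i j \<Longrightarrow> wt j i (- a) = wt i j a"
    and wt_nz: "\<And>i j a. a \<in> C i j \<Longrightarrow> wt i j a \<noteq> 0"
    and no_loop: "\<And>i. 0 \<notin> C i i"
    and conn: "\<And>i j. (i, j) \<in> {(i, j). i \<noteq> j \<and> C i j \<noteq> {}}\<^sup>*"
    and card2: "CARD('n) \<ge> 2"
begin

definition adj :: "'n \<Rightarrow> 'n \<Rightarrow> bool" where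
  "adj i j \<longleftrightarrow> i \<noteq> j \<and> C i j \<noteq> {}"

text \<open>Meaningful for adjacent vertices under \<open>simple_edges\<close>.\<close>

definition shift :: "'n \<Rightarrow> 'n \<Rightarrow> int ^ 'd" where
  "shift i j = (THE a. a \<in> C i j)"

definition equal_loops :: bool where
  "equal_loops \<longleftrightarrow> (\<forall>i j. C i i = C j j \<and> (\<forall>a\<in>C i i. wt i i a = wt j j a))"

definition simple_edges :: bool where
  "simple_edges \<longleftrightarrow> (\<forall>i j. i \<noteq> j \<longrightarrow> card (C i j) \<le> 1)"

text \<open>Formulated with closed walks, as the construction of a potential requires;
  \<open>balanced_iff\<close> makes the passage to cycles.\<close>

definition balanced :: bool where
  "balanced \<longleftrightarrow> (\<forall>xs. closed_walk adj xs \<longrightarrow> walk_sum shift (xs @ [hd xs]) = 0)"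

definition hat :: "int ^ 'd \<Rightarrow> nat \<Rightarrow> complex ^ 'd \<Rightarrow> 'n \<Rightarrow> 'n \<Rightarrow> complex poly" where
  "hat w M c i j = (\<Sum>a\<in>C i j. monom (wt i j a * laurent_monom c a) (nat (int M + dot w a)))"

text \<open>Ensures that the exponents in \<open>hat\<close> lie between 0 and \<open>2 * M\<close>,
  so that \<open>nat\<close> truncates nothing.\<close>

definition bounds :: "int ^ 'd \<Rightarrow> nat \<Rightarrow> bool" where
  "bounds w M \<longleftrightarrow> (\<forall>i j. \<forall>a\<in>C i j. \<bar>dot w a\<bar> \<le> int M)"

lemma adj_sym: "adj i j \<Longrightarrow> adj j i"
  using sym by (auto simp: adj_def)

lemma adj_irrefl: "\<not> adj i i"
  by (simp add: adj_def)

lemma adj_conn: "(i, j) \<in> {(i, j). adj i j}\<^sup>*"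
  using conn[of i j] by (simp add: adj_def)

lemma simple_edge_eq:
  assumes simple_edges "adj i j"
  shows "C i j = {shift i j}"
proof -
  have "card (C i j) \<le> 1" using assms by (auto simp: simple_edges_def adj_def)
  moreover have "card (C i j) \<noteq> 0" using assms fin by (auto simp: adj_def)
  ultimately have "card (C i j) = 1" by linarith
  then obtain a where "C i j = {a}" by (rule card_1_singletonE)
  then show ?thesis by (simp add: shift_def)
qed

lemma shift_anti:
  assumes simple_edges "adj i j"
  shows "shift j i = - shift i j"
proof -
  have "- shift i j \<in> C j i" using simple_edge_eq[OF assms] sym by auto
  then show ?thesis using simple_edge_eq[OF assms(1) adj_sym[OF assms(2)]] by auto
qed

lemma cut_edge:
  assumes "S \<noteq> {}" "S \<noteq> UNIV"
  shows "\<exists>b\<in>S. \<exists>k. k \<notin> S \<and> adj b k"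
proof (rule ccontr)
  assume n: "\<not> ?thesis"
  obtain i j where ij: "i \<in> S" "j \<notin> S" using assms by auto
  have "j \<in> S" using adj_conn[of i j]
    by (induction rule: rtrancl_induct) (use ij n in auto)
  then show False using ij by simp
qed

text \<open>By \<open>char_det_pair\<close>, the loops at \<open>b\<close> and \<open>k\<close> can
  differ only at exponent 0, which no loop has. And if \<open>C b k\<close> contained
  \<open>x\<close> and \<open>y\<close> with \<open>dot w x < dot w y\<close>, then \<open>y\<close>
  together with \<open>- x\<close> in \<open>C k b\<close> would give the product
  \<open>l b k * l k b\<close> a degree above \<open>2 * M\<close>.\<close>

lemma irreducible_choice_pair:
  assumes bd: "bounds w M"
    and nz: "\<And>i j. C i j \<noteq> {} \<Longrightarrow> l i j \<noteq> 0"
    and coe: "\<And>i j a. a \<in> (\<Union>i j. C i j) \<Longrightarrow> coeff (l i j) (nat (int M + dot w a)) = (if a \<in> C i j then wt i j a else 0)"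
    and inj: "inj_on (dot w) (insert 0 (\<Union>i j. C i j))"
    and bk: "adj b k" and bad: "C b b \<noteq> C k k \<or> (\<exists>a\<in>C b b. wt b b a \<noteq> wt k k a) \<or> card (C b k) > 1"
  shows "\<exists>V. irreducible (char_det l M {b, k} V)"
proof (rule ccontr)
  assume "\<not> ?thesis"
  then have red: "\<not> irreducible (char_det l M {b, k} V)" for V by blast
  have ne: "b \<noteq> k" "C b k \<noteq> {}" "C k b \<noteq> {}" using bk adj_sym[OF bk] by (auto simp: adj_def)
  obtain c1 where c1: "l b b - l k k = monom c1 M" and "\<exists>c. l b k * l k b = monom c (2 * M)"
    using char_det_pair[OF ne(1) nz[OF ne(2)] nz[OF ne(3)] red] by blast
  then obtain c2 where c2: "l b k * l k b = monom c2 (2 * M)" by blast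
  have absM: "\<bar>dot w a\<bar> \<le> int M" if "a \<in> C i j" for a i j using bd that by (auto simp: bounds_def)
  have eq: "(if a \<in> C b b then wt b b a else 0) = (if a \<in> C k k then wt k k a else 0)"
    if a: "a \<in> (\<Union>i j. C i j)" "a \<noteq> 0" for a
  proof -
    have "dot w a \<noteq> dot w 0" using inj a by (auto simp: inj_on_def)
    then have "dot w a \<noteq> 0" by (simp add: dot_simps)
    moreover have "\<bar>dot w a\<bar> \<le> int M" using a absM by blast
    ultimately have "nat (int M + dot w a) \<noteq> M" by linarith
    then have "coeff (l b b - l k k) (nat (int M + dot w a)) = 0" using c1 by simp
    then show ?thesis using coe[OF a(1), of b b] coe[OF a(1), of k k] by simp
  qed
  have loops: "a \<in> C b b \<longleftrightarrow> a \<in> C k k" for a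
  proof (cases "a \<in> (\<Union>i j. C i j) \<and> a \<noteq> 0")
    case True
    then show ?thesis using eq[of a] wt_nz by (metis (full_types))
  next
    case False
    then show ?thesis using no_loop by auto
  qed
  moreover have "wt b b a = wt k k a" if "a \<in> C b b" for a
    using eq[of a] that loops no_loop by (metis UN_I UNIV_I)
  ultimately have "card (C b k) > 1" using bad by blast
  then obtain a1 a2 where a: "a1 \<in> C b k" "a2 \<in> C b k" "a1 \<noteq> a2"
    by (metis card_le_Suc0_iff_eq fin not_less One_nat_def)
  have "dot w a1 \<noteq> dot w a2" using inj a by (auto simp: inj_on_def)
  moreover have False if lt: "dot w x < dot w y" and xy: "x \<in> C b k" "y \<in> C b k" for x y
  proof -
    have x': "- x \<in> C k b" using sym xy by simp
    have U: "y \<in> (\<Union>i j. C i j)" "- x \<in> (\<Union>i j. C i j)" using xy x' by blast+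
    have "coeff (l b k) (nat (int M + dot w y)) \<noteq> 0" using coe[OF U(1), of b k] xy wt_nz by simp
    then have 1: "nat (int M + dot w y) \<le> degree (l b k)" by (rule le_degree)
    have "coeff (l k b) (nat (int M + dot w (- x))) \<noteq> 0" using coe[OF U(2), of k b] x' wt_nz by simp
    then have 2: "nat (int M + dot w (- x)) \<le> degree (l k b)" by (rule le_degree)
    have "degree (l b k * l k b) = degree (l b k) + degree (l k b)"
      by (rule degree_mult_eq[OF nz[OF ne(2)] nz[OF ne(3)]])
    moreover have "degree (l b k * l k b) \<le> 2 * M" unfolding c2 by (rule degree_monom_le)
    ultimately show False using 1 2 lt absM[OF xy(1)] absM[OF xy(2)] by (simp add: dot_simps)
  qed
  ultimately show False using a by (metis linorder_neqE)
qed

text \<open>Because the cycle is induced, the block over it has no further off-diagonal entries, and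
  equal loops supply its common diagonal polynomial.\<close>

lemma irreducible_choice_cycle:
  assumes bd: "bounds w M" and l: "l = hat w M 1"
    and I: equal_loops and II: simple_edges
    and c: "3 \<le> length c" "distinct c"
      "\<And>j. j < length c \<Longrightarrow> adj (c ! j) (c ! (Suc j mod length c))"
      "\<And>i j. i < length c \<Longrightarrow> j < length c \<Longrightarrow> adj (c ! i) (c ! j) \<Longrightarrow>
         j = Suc i mod length c \<or> i = Suc j mod length c"
    and E: "dot w (\<Sum>j<length c. shift (c ! j) (c ! (Suc j mod length c))) \<noteq> 0"
  shows "\<exists>V. irreducible (char_det l M (set c) V)"
proof -
  obtain r where r: "r permutes set c" and rc: "\<And>j. j < length c \<Longrightarrow> r (c ! j) = c ! (Suc j mod length c)"
    and r2: "\<And>x. x \<in> set c \<Longrightarrow> r (r x) \<noteq> x"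
    and orbit: "\<And>A. A \<subseteq> set c \<Longrightarrow> A \<noteq> {} \<Longrightarrow> r ` A \<subseteq> A \<Longrightarrow> A = set c"
    using rotation_exists[OF c(2,1)] by blast
  have adjr: "adj i (r i)" if "i \<in> set c" for i
    using that c(3) rc by (auto simp: in_set_conv_nth)
  have chord: "j = r i \<or> i = r j" if ij: "i \<in> set c" "j \<in> set c" "adj i j" for i j
  proof -
    obtain x y where "x < length c" "y < length c" "i = c ! x" "j = c ! y"
      using ij by (auto simp: in_set_conv_nth)
    then show ?thesis using c(4)[of x y] ij rc by auto
  qed
  define g where "g i = wt i (r i) (shift i (r i))" for i
  define eps where "eps i = dot w (shift i (r i))" for i
  have lm: "laurent_monom 1 a = 1" for a :: "int ^ 'd" by (simp add: laurent_monom_def)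
  have sh: "shift i (r i) \<in> C i (r i)" if "i \<in> set c" for i
    using simple_edge_eq[OF II adjr[OF that]] by simp
  obtain i0 where i0: "i0 \<in> set c" using c(1) by (cases c) auto
  show ?thesis
  proof (rule char_det_cycle[OF r r2 orbit])
    show "set c \<noteq> {}" using i0 by auto
    show "l i i = l i0 i0" if "i \<in> set c" for i
    proof -
      have "C i i = C i0 i0" "\<forall>a\<in>C i i. wt i i a = wt i0 i0 a"
        using I unfolding equal_loops_def by blast+
      then show ?thesis unfolding l hat_def lm by (intro sum.cong) simp_all
    qed
    show "l i j = 0" if "i \<in> set c" "j \<in> set c" "i \<noteq> j" "j \<noteq> r i" "i \<noteq> r j" for i j
    proof -
      have "\<not> adj i j" using chord that by blast
      then have "C i j = {}" using that by (simp add: adj_def)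
      then show ?thesis by (simp add: l hat_def)
    qed
    fix i assume i: "i \<in> set c"
    show "l i (r i) = monom (g i) (nat (int M + eps i))"
      unfolding l hat_def lm simple_edge_eq[OF II adjr[OF i]] by (simp add: g_def eps_def)
    have "C (r i) i = {- shift i (r i)}"
      using simple_edge_eq[OF II adj_sym[OF adjr[OF i]]] shift_anti[OF II adjr[OF i]] by simp
    then show "l (r i) i = monom (g i) (nat (int M - eps i))"
      unfolding l hat_def lm by (simp add: g_def eps_def wt_sym[OF sh[OF i]] dot_simps)
    show "\<bar>eps i\<bar> \<le> int M" using bd sh[OF i] by (auto simp: bounds_def eps_def)
    show "g i \<noteq> 0" using wt_nz[OF sh[OF i]] by (simp add: g_def)
  next
    have "(\<Sum>i\<in>set c. eps i) = (\<Sum>j<length c. eps (c ! j))"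
      by (rule sum.reindex_bij_betw[symmetric]) (use bij_betw_nth[OF c(2) refl refl] in simp)
    also have "\<dots> = dot w (\<Sum>j<length c. shift (c ! j) (c ! (Suc j mod length c)))"
      unfolding dot_sum eps_def by (intro sum.cong) (auto simp: rc)
    finally show "(\<Sum>i\<in>set c. eps i) \<noteq> 0" using E by simp
  qed
qed

text \<open>Equality of the loop data across every edge would spread over the whole connected
  graph.\<close>

lemma bad_edge_exists:
  assumes "\<not> (equal_loops \<and> simple_edges)"
  obtains b k where "adj b k" "C b b \<noteq> C k k \<or> (\<exists>a\<in>C b b. wt b b a \<noteq> wt k k a) \<or> card (C b k) > 1"
proof (rule ccontr)
  note ob = that
  assume n: "\<not> thesis"
  have ok: "C b b = C k k \<and> (\<forall>a\<in>C b b. wt b b a = wt k k a) \<and> card (C b k) \<le> 1" if "adj b k" for b k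
    using n ob[OF that] not_le by blast
  have "simple_edges" unfolding simple_edges_def
  proof (intro allI impI)
    fix i j :: 'n assume "i \<noteq> j"
    then show "card (C i j) \<le> 1" using ok[of i j] by (cases "C i j = {}") (auto simp: adj_def)
  qed
  moreover have H: "C i i = C j j \<and> (\<forall>a\<in>C i i. wt i i a = wt j j a)" for i j
    using adj_conn[of i j]
  proof (induction rule: rtrancl_induct)
    case (step y z)
    then have "adj y z" by simp
    then show ?case using ok[of y z] step.IH by auto
  qed simp
  have equal_loops unfolding equal_loops_def by (intro allI) (rule H)
  ultimately show False using assms by blast
qed

lemma irreducible_choice:
  assumes bad: "\<not> (equal_loops \<and> simple_edges \<and> balanced)"
  shows "\<exists>w M V. bounds w M \<and> irreducible (char_det (hat w M 1) M UNIV V)"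
proof -
  define A where "A = insert 0 (\<Union>i j. C i j)"
  have finA: "finite A" unfolding A_def using fin by auto
  \<comment> \<open>The cycle is fixed before the direction, since \<open>w\<close> must not be
    orthogonal to its total shift; if the failure already occurs on an edge, \<open>tot\<close> is
    arbitrary.\<close>
  obtain tot :: "int ^ 'd" where tot: "equal_loops \<and> simple_edges \<longrightarrow> (\<exists>c. 3 \<le> length c \<and> distinct c \<and>
      (\<forall>j<length c. adj (c ! j) (c ! (Suc j mod length c))) \<and>
      (\<forall>i<length c. \<forall>j<length c. adj (c ! i) (c ! j) \<longrightarrow> j = Suc i mod length c \<or> i = Suc j mod length c) \<and>
      tot = (\<Sum>j<length c. shift (c ! j) (c ! (Suc j mod length c))) \<and> tot \<noteq> 0)"
  proof (cases "equal_loops \<and> simple_edges")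
    case True
    then obtain xs where xs: "closed_walk adj xs" "walk_sum shift (xs @ [hd xs]) \<noteq> 0"
      using bad by (auto simp: balanced_def)
    obtain c where "3 \<le> length c" "distinct c"
      "\<And>j. j < length c \<Longrightarrow> adj (c ! j) (c ! (Suc j mod length c))"
      "\<And>i j. i < length c \<Longrightarrow> j < length c \<Longrightarrow> adj (c ! i) (c ! j) \<Longrightarrow>
         j = Suc i mod length c \<or> i = Suc j mod length c"
      "(\<Sum>j<length c. shift (c ! j) (c ! (Suc j mod length c))) \<noteq> 0"
      by (rule induced_cycle_exists[OF adj_irrefl adj_sym shift_anti[OF conjunct2[OF True]] xs], assumption, assumption,
          rule that, assumption+)
    then show ?thesis using that by blast
  next
    case False then show ?thesis using that by blast
  qed
  \<comment> \<open>Avoiding orthogonality to the differences makes \<open>dot w\<close> injective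
    on the exponents, so no two terms of an entry merge on the curve.\<close>
  define \<Omega> where "\<Omega> = ((\<lambda>(a, b). a - b) ` (A \<times> A) \<union> {tot}) - {0}"
  have "finite \<Omega>" "0 \<notin> \<Omega>" using finA by (auto simp: \<Omega>_def)
  then obtain w :: "int ^ 'd" where w: "\<And>a. a \<in> \<Omega> \<Longrightarrow> dot w a \<noteq> 0"
    using generic_direction[of \<Omega>] by metis
  have inj: "inj_on (dot w) A"
  proof (rule inj_onI, rule ccontr)
    fix a b assume "a \<in> A" "b \<in> A" "dot w a = dot w b" "a \<noteq> b"
    then have "a - b \<in> \<Omega>" by (auto simp: \<Omega>_def)
    then show False using w[of "a - b"] \<open>dot w a = dot w b\<close> by (simp add: dot_simps)
  qed
  define M where "M = nat (\<Sum>a\<in>A. \<bar>dot w a\<bar>)"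
  have MA: "\<bar>dot w a\<bar> \<le> int M" if "a \<in> A" for a
  proof -
    have "\<bar>dot w a\<bar> \<le> (\<Sum>a\<in>A. \<bar>dot w a\<bar>)" by (rule member_le_sum) (use that finA in auto)
    then show ?thesis by (simp add: M_def)
  qed
  have bd: "bounds w M" using MA by (auto simp: bounds_def A_def)
  define l where "l = hat w M 1"
  have coe: "coeff (l i j) (nat (int M + dot w a)) = (if a \<in> C i j then wt i j a else 0)" if a: "a \<in> A" for i j a
  proof -
    have "coeff (l i j) (nat (int M + dot w a)) = (\<Sum>b\<in>C i j. if b = a then wt i j b else 0)"
      unfolding l_def hat_def coeff_sum
    proof (intro sum.cong refl)
      fix b assume b: "b \<in> C i j"
      then have bA: "b \<in> A" by (auto simp: A_def)
      have "nat (int M + dot w b) = nat (int M + dot w a) \<longleftrightarrow> b = a"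
        using MA[OF a] MA[OF bA] inj a bA by (auto simp: inj_on_def nat_eq_iff)
      then show "coeff (monom (wt i j b * laurent_monom 1 b) (nat (int M + dot w b))) (nat (int M + dot w a)) =
          (if b = a then wt i j b else 0)" by (auto simp: laurent_monom_def)
    qed
    then show ?thesis using fin by simp
  qed
  have nz: "l i j \<noteq> 0" if ne: "C i j \<noteq> {}" for i j
  proof -
    obtain a where a: "a \<in> C i j" using ne by auto
    then have "a \<in> A" unfolding A_def by blast
    then have "coeff (l i j) (nat (int M + dot w a)) \<noteq> 0" using coe[of a i j] a wt_nz by simp
    then show ?thesis by auto
  qed
  have "\<exists>S V. card S \<ge> 2 \<and> irreducible (char_det l M S V)"
  proof (cases "equal_loops \<and> simple_edges")
    case False
    then obtain b k where bk: "adj b k" "C b b \<noteq> C k k \<or> (\<exists>a\<in>C b b. wt b b a \<noteq> wt k k a) \<or> card (C b k) > 1"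
      by (rule bad_edge_exists)
    have "\<exists>V. irreducible (char_det l M {b, k} V)"
      by (rule irreducible_choice_pair[OF bd nz coe inj[unfolded A_def] bk]) (auto simp: A_def)
    moreover have "card {b, k} = 2" using bk(1) by (simp add: adj_def)
    ultimately show ?thesis by (metis order_refl)
  next
    case True
    then obtain c where c: "3 \<le> length c" "distinct c"
      "\<And>j. j < length c \<Longrightarrow> adj (c ! j) (c ! (Suc j mod length c))"
      "\<And>i j. i < length c \<Longrightarrow> j < length c \<Longrightarrow> adj (c ! i) (c ! j) \<Longrightarrow>
         j = Suc i mod length c \<or> i = Suc j mod length c"
      "tot = (\<Sum>j<length c. shift (c ! j) (c ! (Suc j mod length c)))" "tot \<noteq> 0" using tot by auto
    have "dot w tot \<noteq> 0" using w c(6) by (auto simp: \<Omega>_def)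
    then have "\<exists>V. irreducible (char_det l M (set c) V)"
      using irreducible_choice_cycle[OF bd l_def _ _ c(1-4)] True c(5) by simp
    moreover have "card (set c) \<ge> 2" using c(1,2) by (simp add: distinct_card)
    ultimately show ?thesis by blast
  qed
  then obtain S V where "card S \<ge> 2" "irreducible (char_det l M S V)" by blast
  then have "\<exists>V. irreducible (char_det l M UNIV V)"
  proof (intro char_det_irreducible_extend)
    fix S :: "'n set" assume "S \<noteq> {}" "S \<noteq> UNIV"
    then obtain b k where bk: "b \<in> S" "k \<notin> S" "adj b k" using cut_edge by blast
    then have "l b k \<noteq> 0 \<and> l k b \<noteq> 0" using nz adj_sym[OF bk(3)] by (auto simp: adj_def)
    then show "\<exists>b\<in>S. \<exists>k. k \<notin> S \<and> l b k \<noteq> 0 \<and> l k b \<noteq> 0" using bk by blast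
  qed
  then show ?thesis using bd l_def by blast
qed

end

section \<open>From slices to the Bloch variety\<close>

definition torus :: "(complex ^ 'd::finite) set" where
  "torus = {z. \<forall>k. z $ k \<noteq> 0}"

lemma one_in_torus: "1 \<in> torus"
  by (simp add: torus_def)

lemma torus_line_eq: "torus_line = torus \<times> UNIV"
  by (simp add: torus_line_def torus_def)

lemma function_ring_prod:
  assumes "function_ring R" "\<And>i. i \<in> A \<Longrightarrow> f i \<in> R" shows "(\<lambda>x. \<Prod>i\<in>A. f i x) \<in> R"
  using assms(2) by (induction A rule: infinite_finite_induct)
    (auto intro: function_ring_mult[OF assms(1)] function_ring_const[OF assms(1)])

lemma laurent_monom_add:
  "z \<in> torus \<Longrightarrow> laurent_monom z (a + b) = laurent_monom z a * laurent_monom z b"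
  by (simp add: laurent_monom_def torus_def power_int_add prod.distrib)

section \<open>Regular functions on the product of the torus and the line\<close>

definition regular :: "((complex ^ 'd::finite) \<times> complex \<Rightarrow> complex) \<Rightarrow> bool" where
  "regular h \<longleftrightarrow> (\<exists>f. \<forall>p\<in>torus_line. eval_laurent f p = h p)"

lemma eval_laurent_superset:
  assumes "finite S" "Poly_Mapping.keys f \<subseteq> S"
  shows "eval_laurent f (z, x) = (\<Sum>(a, k)\<in>S. Poly_Mapping.lookup f (a, k) * laurent_monom z a * x ^ k)"
  unfolding eval_laurent_def
  by simp (rule sum.mono_neutral_left, use assms in \<open>auto simp: in_keys_iff\<close>)

lemma eval_laurent_add: "eval_laurent (f + g) (z, x) = eval_laurent f (z, x) + eval_laurent g (z, x)"
proof -
  let ?S = "Poly_Mapping.keys f \<union> Poly_Mapping.keys g"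
  show ?thesis
    unfolding eval_laurent_superset[of ?S "f + g", OF _ Poly_Mapping.keys_add, simplified]
      eval_laurent_superset[of ?S f, simplified] eval_laurent_superset[of ?S g, simplified]
    by (simp add: Poly_Mapping.lookup_add algebra_simps sum.distrib case_prod_unfold)
qed

lemma regular_monomial: "regular (\<lambda>(z, x). c * laurent_monom z a * x ^ k)"
proof -
  have "eval_laurent (Poly_Mapping.single (a, k) c) (z, x) = c * laurent_monom z a * x ^ k" for z x
    by (subst eval_laurent_superset[of "{(a, k)}"]) auto
  then show ?thesis unfolding regular_def by (intro exI[of _ "Poly_Mapping.single (a, k) c"]) auto
qed

lemma regular_add: "regular f \<Longrightarrow> regular g \<Longrightarrow> regular (\<lambda>p. f p + g p)"
  unfolding regular_def
proof (elim exE)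
  fix u v assume "\<forall>p\<in>torus_line. eval_laurent u p = f p" "\<forall>p\<in>torus_line. eval_laurent v p = g p"
  then show "\<exists>f'. \<forall>p\<in>torus_line. eval_laurent f' p = f p + g p"
    by (intro exI[of _ "u + v"] ballI, case_tac p) (simp add: eval_laurent_add)
qed

lemma laurent_monom_zero: "laurent_monom z 0 = 1"
  by (simp add: laurent_monom_def)

lemma regular_const: "regular (\<lambda>_. c)"
  using regular_monomial[of c 0 0] by (simp add: laurent_monom_zero case_prod_unfold)

lemma regular_sum: "(\<And>i. i \<in> A \<Longrightarrow> regular (f i)) \<Longrightarrow> regular (\<lambda>p. \<Sum>i\<in>A. f i p)"
  by (induction A rule: infinite_finite_induct) (auto intro: regular_add regular_const)

lemma regular_cong: "(\<And>p. p \<in> torus_line \<Longrightarrow> f p = g p) \<Longrightarrow> regular f \<Longrightarrow> regular g"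
  unfolding regular_def by force

lemma regular_mult:
  assumes "regular f" "regular g" shows "regular (\<lambda>p. f p * g p)"
proof -
  obtain u v where u: "\<forall>p\<in>torus_line. eval_laurent u p = f p" and v: "\<forall>p\<in>torus_line. eval_laurent v p = g p"
    using assms by (auto simp: regular_def)
  let ?t = "\<lambda>i j. (\<lambda>(z, x). (Poly_Mapping.lookup u i * Poly_Mapping.lookup v j) *
      laurent_monom z (fst i + fst j) * x ^ (snd i + snd j))"
  have "regular (\<lambda>p. \<Sum>i\<in>Poly_Mapping.keys u. \<Sum>j\<in>Poly_Mapping.keys v. ?t i j p)"
    by (intro regular_sum regular_monomial)
  then show ?thesis
  proof (rule regular_cong[rotated])
    fix p :: "(complex ^ 'a) \<times> complex" assume p: "p \<in> torus_line"
    obtain z x where zx: "p = (z, x)" "z \<in> torus" using p by (auto simp: torus_line_eq)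
    show "(\<Sum>i\<in>Poly_Mapping.keys u. \<Sum>j\<in>Poly_Mapping.keys v. ?t i j p) = f p * g p"
      using u[rule_format, OF p, symmetric] v[rule_format, OF p, symmetric] unfolding zx(1)
      by (simp add: eval_laurent_def case_prod_unfold sum_product laurent_monom_add[OF zx(2)] power_add mult_ac)
  qed
qed

lemma regular_ring: "function_ring {h. regular h}"
  unfolding function_ring_def by (auto intro: regular_const regular_add regular_mult)

text \<open>Laurent polynomial functions of \<open>z\<close>, encoded by clearing denominators with
  a power of the product of the coordinates; vanishing statements for \<open>polyfun\<close> then
  carry over to the torus.\<close>

definition laurent_fun :: "(complex ^ 'd::finite \<Rightarrow> complex) \<Rightarrow> bool" where
  "laurent_fun h \<longleftrightarrow> (\<exists>m q. polyfun q \<and> (\<forall>z\<in>torus. h z * (\<Prod>k\<in>UNIV. z $ k) ^ m = q z))"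

lemma polyfun_prod: "(\<And>i. i \<in> A \<Longrightarrow> polyfun (f i)) \<Longrightarrow> polyfun (\<lambda>V. \<Prod>i\<in>A. f i V)"
  using function_ring_prod[OF polyfun_ring, of A f] by simp

lemma polyfun_power: "polyfun f \<Longrightarrow> polyfun (\<lambda>V. f V ^ m)"
  by (induction m) (auto intro: polyfun_mult polyfun_const)

lemma laurent_fun_ring: "function_ring {h. laurent_fun h}"
  unfolding function_ring_def mem_Collect_eq
proof (intro conjI allI ballI, goal_cases)
  case (1 c)
  then show ?case unfolding laurent_fun_def by (intro exI[of _ 0] exI[of _ "\<lambda>_. c"]) (simp add: polyfun_const)
next
  case (2 f g)
  obtain m q where f: "polyfun q" "\<And>z. z \<in> torus \<Longrightarrow> f z * (\<Prod>k\<in>UNIV. z $ k) ^ m = q z"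
    using 2(1) by (auto simp: laurent_fun_def)
  obtain n r where g: "polyfun r" "\<And>z. z \<in> torus \<Longrightarrow> g z * (\<Prod>k\<in>UNIV. z $ k) ^ n = r z"
    using 2(2) by (auto simp: laurent_fun_def)
  have "polyfun (\<lambda>z. q z * (\<Prod>k\<in>UNIV. z $ k) ^ n + r z * (\<Prod>k\<in>UNIV. z $ k) ^ m)"
    by (intro polyfun_add polyfun_mult polyfun_power polyfun_prod polyfun_nth f g)
  moreover have "(f z + g z) * (\<Prod>k\<in>UNIV. z $ k) ^ (m + n) =
     q z * (\<Prod>k\<in>UNIV. z $ k) ^ n + r z * (\<Prod>k\<in>UNIV. z $ k) ^ m" if "z \<in> torus" for z
    by (simp add: f(2)[OF that, symmetric] g(2)[OF that, symmetric] power_add algebra_simps)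
  ultimately show ?case unfolding laurent_fun_def by blast
next
  case (3 f g)
  obtain m q where f: "polyfun q" "\<And>z. z \<in> torus \<Longrightarrow> f z * (\<Prod>k\<in>UNIV. z $ k) ^ m = q z"
    using 3(1) by (auto simp: laurent_fun_def)
  obtain n r where g: "polyfun r" "\<And>z. z \<in> torus \<Longrightarrow> g z * (\<Prod>k\<in>UNIV. z $ k) ^ n = r z"
    using 3(2) by (auto simp: laurent_fun_def)
  have "polyfun (\<lambda>z. q z * r z)" by (intro polyfun_mult f g)
  moreover have "(f z * g z) * (\<Prod>k\<in>UNIV. z $ k) ^ (m + n) = q z * r z" if "z \<in> torus" for z
    by (simp add: f(2)[OF that, symmetric] g(2)[OF that, symmetric] power_add mult_ac)
  ultimately show ?case unfolding laurent_fun_def by blast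
qed

lemma laurent_fun_monom: "laurent_fun (\<lambda>z. laurent_monom z a)"
proof -
  define m where "m = nat (\<Sum>k\<in>UNIV. \<bar>a $ k\<bar>)"
  have m: "\<bar>a $ k\<bar> \<le> int m" for k
  proof -
    have "\<bar>a $ k\<bar> \<le> (\<Sum>k\<in>UNIV. \<bar>a $ k\<bar>)" by (rule member_le_sum) auto
    then show ?thesis by (simp add: m_def)
  qed
  have "laurent_monom z a * (\<Prod>k\<in>UNIV. z $ k) ^ m = (\<Prod>k\<in>UNIV. (z $ k) ^ nat (a $ k + int m))" if z: "z \<in> torus" for z
  proof -
    have "(z $ k) powi (a $ k) * (z $ k) ^ m = (z $ k) ^ nat (a $ k + int m)" for k
    proof -
      have "(z $ k) ^ nat (a $ k + int m) = (z $ k) powi (a $ k + int m)" using m[of k] by (simp add: power_int_def)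
      then show ?thesis using z by (simp add: power_int_add torus_def)
    qed
    then show ?thesis by (simp add: laurent_monom_def prod_power_distrib flip: prod.distrib)
  qed
  moreover have "polyfun (\<lambda>z. \<Prod>k\<in>UNIV. (z $ k) ^ nat (a $ k + int m))"
    by (intro polyfun_prod polyfun_power polyfun_nth)
  ultimately show ?thesis unfolding laurent_fun_def by blast
qed

lemma eventually_in_torus: "eventually (\<lambda>z. z \<in> torus) (nhds (1 :: complex ^ 'd::finite))"
proof -
  have "eventually (\<lambda>z::complex ^ 'd. z $ k \<noteq> 0) (nhds 1)" for k
  proof -
    have "((\<lambda>z::complex ^ 'd. z $ k) \<longlongrightarrow> 1 $ k) (nhds 1)" by (intro tendsto_vec_nth) (simp add: filterlim_ident)
    then show ?thesis by (rule tendsto_imp_eventually_ne) simp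
  qed
  then show ?thesis unfolding torus_def by (simp add: eventually_all_finite)
qed

text \<open>If each family had a member that is not identically zero on the torus, then after
  clearing denominators the product of the two would be a polynomial vanishing near
  \<open>1\<close>, hence everywhere, although both factors are nonzero somewhere.\<close>

lemma laurent_fun_product_zero:
  assumes h: "\<And>i. laurent_fun (h i)" and k: "\<And>j. laurent_fun (k j)"
    and ev: "eventually (\<lambda>z. (\<forall>i. h i z = 0) \<or> (\<forall>j. k j z = 0)) (nhds 1)"
  shows "(\<forall>z\<in>torus. \<forall>i. h i z = 0) \<or> (\<forall>z\<in>torus. \<forall>j. k j z = 0)"
proof (rule ccontr)
  assume "\<not> ?thesis"
  then obtain x i y j where x: "x \<in> torus" "h i x \<noteq> 0" and y: "y \<in> torus" "k j y \<noteq> 0" by blast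
  obtain m q where q: "polyfun q" "\<And>z. z \<in> torus \<Longrightarrow> h i z * (\<Prod>k\<in>UNIV. z $ k) ^ m = q z"
    using h[of i] by (auto simp: laurent_fun_def)
  obtain n r where r: "polyfun r" "\<And>z. z \<in> torus \<Longrightarrow> k j z * (\<Prod>k\<in>UNIV. z $ k) ^ n = r z"
    using k[of j] by (auto simp: laurent_fun_def)
  have "q x \<noteq> 0" "r y \<noteq> 0" unfolding q(2)[OF x(1), symmetric] r(2)[OF y(1), symmetric]
    using x y by (simp_all add: torus_def prod_zero_iff)
  then obtain z where z: "q z \<noteq> 0" "r z \<noteq> 0" using polyfun_common_nonzero[OF q(1) _ r(1)] by blast
  have "eventually (\<lambda>z. q z * r z = 0) (nhds 1)"
    using ev eventually_in_torus
    by eventually_elim (auto simp flip: q(2) r(2))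
  then have "q z * r z = 0" using polyfun_zero_if_locally_zero[OF polyfun_mult[OF q(1) r(1)]] by blast
  then show False using z by simp
qed

text \<open>Division by a monic polynomial needs no inverses, so the coefficients of the remainder
  stay in the ring. Divisibility in a family thereby becomes the vanishing of ring elements.\<close>

lemma monic_division_in_ring:
  fixes D F :: "'p \<Rightarrow> 'a::comm_ring_1 poly"
  assumes R: "function_ring R" and D: "\<And>a. (\<lambda>t. coeff (D t) a) \<in> R"
    and N: "\<And>t. coeff (D t) N = 1" "\<And>t a. a > N \<Longrightarrow> coeff (D t) a = 0"
    and F: "\<And>a. (\<lambda>t. coeff (F t) a) \<in> R" "\<And>t a. a \<ge> K \<Longrightarrow> coeff (F t) a = 0"
  shows "\<exists>r. (\<forall>a. (\<lambda>t. coeff (r t) a) \<in> R) \<and> (\<forall>t a. a \<ge> N \<longrightarrow> coeff (r t) a = 0) \<and> (\<forall>t. D t dvd F t - r t)"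
  using F
proof (induction K arbitrary: F)
  case 0
  then show ?case by (intro exI[of _ F]) auto
next
  case (Suc K)
  show ?case
  proof (cases "K < N")
    case True
    then show ?thesis using Suc.prems by (intro exI[of _ F]) auto
  next
    case False
    define G where "G t = F t - monom (coeff (F t) K) (K - N) * D t" for t
    have cG: "coeff (G t) a = coeff (F t) a - (if K - N \<le> a then coeff (F t) K * coeff (D t) (a - (K - N)) else 0)" for t a
      by (simp add: G_def coeff_monom_mult)
    have "(\<lambda>t. coeff (G t) a) \<in> R" for a
      unfolding cG using Suc.prems(1) D
      by (cases "K - N \<le> a") (auto intro!: function_ring_diff[OF R] function_ring_mult[OF R] function_ring_const[OF R])
    moreover have "coeff (G t) a = 0" if "a \<ge> K" for t a
      using that False N Suc.prems(2)[of a t] by (cases "a = K") (auto simp: cG)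
    ultimately obtain r where r: "\<forall>a. (\<lambda>t. coeff (r t) a) \<in> R" "\<forall>t a. a \<ge> N \<longrightarrow> coeff (r t) a = 0" "\<forall>t. D t dvd G t - r t"
      using Suc.IH[of G] by blast
    have "D t dvd F t - r t" for t
    proof -
      have "F t - r t = (G t - r t) + monom (coeff (F t) K) (K - N) * D t" by (simp add: G_def)
      then show ?thesis using r(3) by (metis dvd_add dvd_triv_right)
    qed
    then show ?thesis using r by blast
  qed
qed

lemma dvd_iff_remainder_zero:
  fixes D F r :: "complex poly"
  assumes "D dvd F - r" "lead_coeff D = 1" "\<And>a. a \<ge> degree D \<Longrightarrow> coeff r a = 0"
  shows "D dvd F \<longleftrightarrow> r = 0"
proof
  assume "D dvd F"
  then have "D dvd F - (F - r)" using assms(1) by (rule dvd_diff)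
  then have "D dvd r" by simp
  show "r = 0"
  proof (rule ccontr)
    assume "r \<noteq> 0"
    then have "degree D \<le> degree r" using \<open>D dvd r\<close> by (rule dvd_imp_degree_le[rotated])
    then have "lead_coeff r = 0" using assms(3) by blast
    then show False using \<open>r \<noteq> 0\<close> by simp
  qed
qed (use assms in simp)

definition fibre :: "((int ^ 'd::finite) \<times> nat \<Rightarrow>\<^sub>0 complex) \<Rightarrow> complex ^ 'd \<Rightarrow> complex poly" where
  "fibre f z = (\<Sum>(a, k)\<in>Poly_Mapping.keys f. monom (Poly_Mapping.lookup f (a, k) * laurent_monom z a) k)"

lemma poly_fibre: "poly (fibre f z) x = eval_laurent f (z, x)"
  by (simp add: fibre_def eval_laurent_def poly_sum poly_monom case_prod_unfold)

lemma coeff_fibre: "laurent_fun (\<lambda>z. coeff (fibre f z) b)"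
proof -
  have "(\<lambda>z. \<Sum>i\<in>Poly_Mapping.keys f. (if snd i = b then Poly_Mapping.lookup f i else 0) * laurent_monom z (fst i)) \<in> {h. laurent_fun h}"
    by (intro function_ring_sum function_ring_mult function_ring_const laurent_fun_ring) (simp add: laurent_fun_monom)
  moreover have "coeff (fibre f z) b = (\<Sum>i\<in>Poly_Mapping.keys f. (if snd i = b then Poly_Mapping.lookup f i else 0) * laurent_monom z (fst i))" for z
    by (simp add: fibre_def coeff_sum case_prod_unfold) (intro sum.cong, auto)
  ultimately show ?thesis by simp
qed

lemma coeff_fibre_bound: "\<exists>K. \<forall>z. \<forall>b\<ge>K. coeff (fibre f z) b = 0"
proof -
  define K where "K = Suc (\<Sum>i\<in>Poly_Mapping.keys f. snd i)"
  have "snd i < K" if "i \<in> Poly_Mapping.keys f" for i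
    unfolding K_def using member_le_sum[OF that, where f = snd] by (simp add: less_Suc_eq_le)
  then have "coeff (fibre f z) b = 0" if "b \<ge> K" for z b
    unfolding fibre_def coeff_sum case_prod_unfold by (intro sum.neutral) (use that in fastforce)
  then show ?thesis by blast
qed

definition curve :: "int ^ 'd::finite \<Rightarrow> complex ^ 'd \<Rightarrow> complex \<Rightarrow> complex ^ 'd" where
  "curve w c s = (\<chi> k. c $ k * s powi (w $ k))"

lemma curve_in_torus: "c \<in> torus \<Longrightarrow> s \<noteq> 0 \<Longrightarrow> curve w c s \<in> torus"
  by (simp add: curve_def torus_def)

lemma curve_one: "curve w c 1 = c"
  by (simp add: curve_def vec_eq_iff)

lemma laurent_monom_curve:
  assumes "s \<noteq> 0"
  shows "laurent_monom (curve w c s) a = laurent_monom c a * s powi (dot w a)"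
proof -
  have "(\<Prod>k\<in>A. s powi (w $ k * a $ k)) = s powi (\<Sum>k\<in>A. w $ k * a $ k)" for A :: "'a set"
    using finite[of A] by (induction A rule: finite_induct) (use assms in \<open>auto simp: power_int_add\<close>)
  then show ?thesis
    by (simp add: laurent_monom_def curve_def dot_def power_int_mult_distrib prod.distrib power_int_mult)
qed

lemma holds_genericallyI:
  assumes "polyfun P" "P V0 \<noteq> 0" "\<And>V. P V \<noteq> 0 \<Longrightarrow> Q V"
  shows "holds_generically Q"
proof -
  obtain f where f: "\<And>V. eval_poly f V = P V" using assms(1) by (auto simp: polyfun_def)
  let ?U = "- {V. \<forall>f\<in>{f}. eval_poly f V = 0}"
  have "zariski_open ?U" unfolding zariski_open_def by blast
  moreover have "V0 \<in> ?U" using assms(2) f by simp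
  moreover have "\<forall>V\<in>?U. Q V" using assms(3) f by simp
  ultimately show ?thesis unfolding holds_generically_def by blast
qed

context floquet_graph
begin

definition entry :: "complex ^ 'd \<Rightarrow> 'n \<Rightarrow> 'n \<Rightarrow> complex" where
  "entry z i j = (\<Sum>a\<in>C i j. wt i j a * laurent_monom z a)"

text \<open>The unscaled characteristic polynomial at a single \<open>z\<close>;
  \<open>eval2_char_det\<close> compares it with \<open>char_det\<close> along a curve.\<close>

definition charpoly :: "complex ^ 'd \<Rightarrow> complex ^ 'n \<Rightarrow> complex poly" where
  "charpoly z V = block_det UNIV (\<lambda>i j. if i = j then [:- (V $ i + entry z i j), 1:] else [:- entry z i j:])"

definition bloch :: "complex ^ 'n \<Rightarrow> ((complex ^ 'd) \<times> complex) set" where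
  "bloch V = {(z, x). z \<in> torus \<and> poly (charpoly z V) x = 0}"

lemma charpoly_monic: "degree (charpoly z V) = CARD('n)" "lead_coeff (charpoly z V) = 1"
proof -
  have eq: "(\<lambda>i j. if i = j then [:- (V $ i + entry z i j), 1:] else [:- entry z i j:]) =
     (\<lambda>i j. if i = j then [:- ((if i = j then V $ i else 0) + entry z i j), 1:] else [:- ((if i = j then V $ i else 0) + entry z i j):])"
    by (auto simp: fun_eq_iff)
  show "degree (charpoly z V) = CARD('n)" "lead_coeff (charpoly z V) = 1"
    unfolding charpoly_def eq
    using block_det_char_monic[of UNIV "\<lambda>i j. (if i = j then V $ i else 0) + entry z i j"] by simp_all
qed

lemma poly_charpoly:
  "poly (charpoly z V) x = block_det UNIV (\<lambda>i j. (if i = j then x - V $ i else 0) - entry z i j)"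
  unfolding charpoly_def block_det_def poly_sum poly_mult poly_prod
  by (intro sum.cong refl arg_cong2[of _ _ _ _ "(*)"] prod.cong) (auto simp: algebra_simps of_int_poly)

lemma regular_charpoly: "regular (\<lambda>(z, x). poly (charpoly z V) x)"
proof -
  define R :: "((complex ^ 'd) \<times> complex \<Rightarrow> complex) set" where "R = {h. regular h}"
  have R: "function_ring R" unfolding R_def by (rule regular_ring)
  have lm: "(\<lambda>p. laurent_monom (fst p) a) \<in> R" for a
    using regular_monomial[of 1 a 0] by (simp add: R_def case_prod_unfold)
  have x: "(\<lambda>p. snd p) \<in> R"
    using regular_monomial[of 1 0 1] by (simp add: R_def laurent_monom_zero case_prod_unfold)
  have d: "(\<lambda>p. if i = j then snd p - V $ i else 0) \<in> R" for i j
    using function_ring_diff[OF R x function_ring_const[OF R]] function_ring_const[OF R] by (cases "i = j") simp_all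
  have "(\<lambda>p. block_det UNIV (\<lambda>i j. (if i = j then snd p - V $ i else 0) - (\<Sum>a\<in>C i j. wt i j a * laurent_monom (fst p) a))) \<in> R"
    unfolding block_det_def
    by (intro function_ring_sum[OF R] function_ring_mult[OF R] function_ring_prod[OF R] function_ring_diff[OF R]
        function_ring_const[OF R] d lm)
  then have "regular (\<lambda>p. block_det UNIV (\<lambda>i j. (if i = j then snd p - V $ i else 0) - (\<Sum>a\<in>C i j. wt i j a * laurent_monom (fst p) a)))"
    unfolding R_def by (rule CollectD)
  then show ?thesis by (simp add: poly_charpoly entry_def case_prod_unfold)
qed

lemma algebraic_bloch: "algebraic_set (bloch V)"
proof -
  obtain f where f: "\<forall>p\<in>torus_line. eval_laurent f p = (case p of (z, x) \<Rightarrow> poly (charpoly z V) x)"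
    using regular_charpoly[of V] by (auto simp: regular_def)
  have "bloch V = {p \<in> torus_line. \<forall>f\<in>{f}. eval_laurent f p = 0}"
    using f by (auto simp: bloch_def torus_line_eq)
  then show ?thesis unfolding algebraic_set_def by blast
qed

lemma bloch_nonempty: "bloch V \<noteq> {}"
proof -
  have "degree (charpoly 1 V) \<noteq> 0" using charpoly_monic(1)[of 1 V] by simp
  then obtain x where "poly (charpoly 1 V) x = 0" by (metis fundamental_theorem_of_algebra constant_degree)
  then have "(1, x) \<in> bloch V" by (simp add: bloch_def one_in_torus)
  then show ?thesis by blast
qed

lemma eval2_hat:
  assumes "bounds w M" "s \<noteq> 0"
  shows "poly (hat w M c i j) s = s ^ M * entry (curve w c s) i j"
proof -
  have "s ^ nat (int M + dot w a) = s ^ M * s powi (dot w a)" if "a \<in> C i j" for a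
  proof -
    have "\<bar>dot w a\<bar> \<le> int M" using assms that by (auto simp: bounds_def)
    then have "s ^ nat (int M + dot w a) = s powi (int M + dot w a)" by (simp add: power_int_def)
    then show ?thesis using assms by (simp add: power_int_add)
  qed
  then show ?thesis unfolding hat_def entry_def poly_sum sum_distrib_left
    by (intro sum.cong refl) (simp add: poly_monom laurent_monom_curve assms)
qed

lemma eval2_char_det:
  assumes "bounds w M" "s \<noteq> 0"
  shows "eval2 (char_det (hat w M c) M UNIV V) s (s ^ M * x) = s ^ (M * CARD('n)) * poly (charpoly (curve w c s) V) x"
proof -
  have "eval2 (char_entry (hat w M c) M V i j) s (s ^ M * x) =
      s ^ M * ((if i = j then x - V $ i else 0) - entry (curve w c s) i j)" for i j
    by (simp add: char_entry_def eval2_hat[OF assms] poly_monom algebra_simps)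
  then show ?thesis unfolding char_det_def eval2_block_det poly_charpoly
    by (simp add: block_det_scale power_mult)
qed

text \<open>Along the curve through \<open>c\<close>, multiplication by powers of \<open>s\<close>
  turns \<open>f\<close> and \<open>g\<close> into polynomials \<open>F\<close> and
  \<open>G\<close>. Their product vanishes on the zeros of the prime \<open>D\<close> with
  \<open>s \<noteq> 0\<close>, so \<open>D\<close> divides \<open>F\<close> or \<open>G\<close>;
  putting \<open>s = 1\<close> returns to the fibre over \<open>c\<close>.\<close>

lemma slice_divides:
  assumes bd: "bounds w M" and irr: "irreducible (char_det (hat w M c) M UNIV V)" and c: "c \<in> torus"
    and zero: "\<And>z x. (z, x) \<in> bloch V \<Longrightarrow> eval_laurent f (z, x) = 0 \<or> eval_laurent g (z, x) = 0"
  shows "charpoly c V dvd fibre f c \<or> charpoly c V dvd fibre g c"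
proof -
  define D where "D = char_det (hat w M c) M UNIV V"
  have D1: "lead_coeff D = 1" "degree D \<ge> 1"
    unfolding D_def by (rule char_det_monic(2)) (simp add: char_det_monic(1))
  have prime: "prime_elem D" using irr by (simp add: D_def prime_elem_iff_irreducible)
  have lift: "\<exists>p K. \<forall>s x. s \<noteq> 0 \<longrightarrow> eval2 p s (s ^ M * x) = s ^ K * poly (fibre h (curve w c s)) x" for h
  proof -
    \<comment> \<open>In the scaled variable \<open>s^M x\<close> the term with exponents
      \<open>(a, k)\<close> carries the power \<open>dot w a - M * k\<close> of \<open>s\<close>;
      raising all exponents by \<open>K\<close> makes them nonnegative.\<close>
    define K where "K = nat (\<Sum>(a, k)\<in>Poly_Mapping.keys h. \<bar>dot w a\<bar> + int (M * k))"
    have K: "\<bar>dot w a\<bar> + int (M * k) \<le> int K" if "(a, k) \<in> Poly_Mapping.keys h" for a k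
    proof -
      have "(case (a, k) of (a, k) \<Rightarrow> \<bar>dot w a\<bar> + int (M * k)) \<le> (\<Sum>(a, k)\<in>Poly_Mapping.keys h. \<bar>dot w a\<bar> + int (M * k))"
        by (rule member_le_sum[OF that]) auto
      then show ?thesis by (simp add: K_def)
    qed
    define p where "p = (\<Sum>(a, k)\<in>Poly_Mapping.keys h. [:monom (Poly_Mapping.lookup h (a, k) * laurent_monom c a) (nat (int K + dot w a - int (M * k))):] * [:0, 1:] ^ k)"
    have "eval2 p s (s ^ M * x) = s ^ K * poly (fibre h (curve w c s)) x" if s: "s \<noteq> 0" for s x
    proof -
      have "s ^ nat (int K + dot w a - int (M * k)) * (s ^ M) ^ k = s ^ K * s powi dot w a"
        if "(a, k) \<in> Poly_Mapping.keys h" for a k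
      proof -
        have "int K + dot w a - int (M * k) \<ge> 0" using K[OF that] by linarith
        then have "s ^ nat (int K + dot w a - int (M * k)) = s powi (int K + dot w a - int (M * k))"
          by (simp only: power_int_def if_True)
        then have "s ^ nat (int K + dot w a - int (M * k)) * (s ^ M) ^ k = s powi (int K + dot w a - int (M * k)) * s powi (int (M * k))"
          by (simp only: power_int_of_nat power_mult)
        also have "\<dots> = s powi (int K + dot w a)" using s by (simp flip: power_int_add)
        finally show ?thesis using s by (simp add: power_int_add)
      qed
      then show ?thesis unfolding p_def fibre_def eval2_sum poly_sum sum_distrib_left
        by (intro sum.cong refl) (auto simp: poly_monom laurent_monom_curve[OF s] power_mult_distrib)
    qed
    then show ?thesis by blast
  qed
  obtain F K where F: "\<And>s x. s \<noteq> 0 \<Longrightarrow> eval2 F s (s ^ M * x) = s ^ K * poly (fibre f (curve w c s)) x" using lift[of f] by blast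
  obtain G L where G: "\<And>s x. s \<noteq> 0 \<Longrightarrow> eval2 G s (s ^ M * x) = s ^ L * poly (fibre g (curve w c s)) x" using lift[of g] by blast
  have res: "charpoly c V dvd fibre h c"
    if H: "D dvd H" "\<And>s x. s \<noteq> 0 \<Longrightarrow> eval2 H s (s ^ M * x) = s ^ K * poly (fibre h (curve w c s)) x" for H h K
  proof -
    obtain q where q: "H = D * q" using H(1) by (rule dvdE)
    have "poly (fibre h c) x = poly (charpoly c V * map_poly (\<lambda>c. poly c 1) q) x" for x
      using H(2)[of 1 x] eval2_char_det[OF bd, of 1 c V x]
      by (simp add: curve_one q eval2_map_poly[of q] flip: D_def)
    then have "fibre h c = charpoly c V * map_poly (\<lambda>c. poly c 1) q" using poly_eq_poly_eq_iff by blast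
    then show ?thesis by simp
  qed
  have "D dvd F * G"
  proof (rule ccontr)
    assume nd: "\<not> D dvd F * G"
    obtain u v \<rho> where b: "u * D + v * (F * G) = [:\<rho>:]" "\<rho> \<noteq> 0"
      using bezout_irreducible[OF irr[folded D_def] D1(2) nd] .
    \<comment> \<open>The extra factor excludes \<open>s = 0\<close>, where there is no point of the
      curve in the torus.\<close>
    have "[:0, 1:] * \<rho> \<noteq> 0" using b(2) by simp
    then obtain s where "poly ([:0, 1:] * \<rho>) s \<noteq> 0" using poly_all_0_iff_0 by blast
    then have s: "s \<noteq> 0" "poly \<rho> s \<noteq> 0" by auto
    have "degree (map_poly (\<lambda>c. poly c s) D) \<noteq> 0" using degree_map_poly_eval_monic[OF D1(1)] D1(2) by simp
    then obtain y where y: "eval2 D s y = 0" unfolding eval2_map_poly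
      by (metis fundamental_theorem_of_algebra constant_degree)
    define x where "x = y / s ^ M"
    have yx: "y = s ^ M * x" using s by (simp add: x_def)
    have "(curve w c s, x) \<in> bloch V"
      using eval2_char_det[OF bd s(1), of c V x] y s curve_in_torus[OF c s(1)] by (simp add: bloch_def D_def yx)
    then have "eval2 (F * G) s y = 0" using zero F[OF s(1), of x] G[OF s(1), of x] by (auto simp: yx poly_fibre)
    then have "eval2 (u * D + v * (F * G)) s y = 0" using y by simp
    then show False using b s by simp
  qed
  then have "D dvd F \<or> D dvd G" using prime by (simp add: prime_elem_dvd_mult_iff)
  then show ?thesis using res F G by blast
qed

text \<open>\<open>coeffs_in_block_det\<close> speaks of nested polynomials; wrapping each entry as
  a constant one makes it applicable to polynomials in \<open>x\<close> alone.\<close>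

lemma charpoly_coeff_laurent: "laurent_fun (\<lambda>z. coeff (charpoly z V) b)"
proof -
  define R :: "(complex ^ 'd \<Rightarrow> complex) set" where "R = {h. laurent_fun h}"
  have R: "function_ring R" unfolding R_def by (rule laurent_fun_ring)
  have lm: "(\<lambda>z. laurent_monom z a) \<in> R" for a by (simp add: R_def laurent_fun_monom)
  have c1: "coeffs_in R (\<lambda>z. [:(if i = j then [:- (V $ i + entry z i j), 1:] else [:- entry z i j:]):])" for i j
  proof -
    have ce: "coeff (coeff [:(if i = j then [:- (V $ i + entry z i j), 1:] else [:- entry z i j:]):] a) b =
       (if a = 0 \<and> b = 0 then (if i = j then - (V $ i) else 0) - entry z i j else if a = 0 \<and> b = 1 \<and> i = j then 1 else 0)" for z a b
      by (auto simp: coeff_pCons split: nat.splits)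
    have m: "(\<lambda>z. (if i = j then - (V $ i) else 0) - entry z i j) \<in> R"
      unfolding entry_def by (intro function_ring_diff[OF R] function_ring_sum[OF R] function_ring_mult[OF R] function_ring_const[OF R] lm)
    show ?thesis unfolding coeffs_in_def ce
    proof (intro allI)
      fix a b :: nat
      show "(\<lambda>z. if a = 0 \<and> b = 0 then (if i = j then - (V $ i) else 0) - entry z i j else if a = 0 \<and> b = 1 \<and> i = j then 1 else 0) \<in> R"
      proof (cases "a = 0 \<and> b = 0")
        case True
        then show ?thesis using m by simp
      next
        case False
        then show ?thesis using function_ring_const[OF R] by (simp only: if_False)
      qed
    qed
  qed
  have "coeffs_in R (\<lambda>z. block_det UNIV (\<lambda>i j. [:(if i = j then [:- (V $ i + entry z i j), 1:] else [:- entry z i j:]):]))"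
    by (intro coeffs_in_block_det R c1)
  moreover have "block_det UNIV (\<lambda>i j. [:(if i = j then [:- (V $ i + entry z i j), 1:] else [:- entry z i j:]):]) = [:charpoly z V:]" for z
  proof -
    have pr: "(\<Prod>i\<in>A. [:f i:]) = [:\<Prod>i\<in>A. f i:]" for f :: "'n \<Rightarrow> complex poly" and A
      by (induction A rule: infinite_finite_induct) (auto simp: one_pCons)
    have su: "(\<Sum>p\<in>A. [:f p:]) = [:\<Sum>p\<in>A. f p:]" for f :: "('n \<Rightarrow> 'n) \<Rightarrow> complex poly" and A
      by (induction A rule: infinite_finite_induct) auto
    show ?thesis unfolding charpoly_def block_det_def pr
      by (simp add: of_int_poly[where 'a = "complex poly"] su mult.commute)
  qed
  ultimately have "\<forall>a b. (\<lambda>z. coeff (coeff [:charpoly z V:] a) b) \<in> R"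
    unfolding coeffs_in_def by (simp only: simp_thms)
  from this[rule_format, of 0 b] show ?thesis by (simp add: R_def)
qed

text \<open>A decomposition yields \<open>f\<close> and \<open>g\<close> with product zero on the
  variety, neither of them vanishing on all of it. For \<open>z\<close> near \<open>1\<close> the
  characteristic polynomial divides one of the two fibres. The remainders have Laurent polynomial
  coefficients, so one of \<open>f\<close> and \<open>g\<close> has divisible fibres over the whole
  torus and vanishes on the variety.\<close>

lemma bloch_irreducible_from_slices:
  assumes bd: "bounds w M"
    and ev: "eventually (\<lambda>c. irreducible (char_det (hat w M c) M UNIV V)) (nhds 1)"
  shows "irreducible_set (bloch V)"
proof -
  have "\<not> reducible_set (bloch V)"
  proof
    assume "reducible_set (bloch V)"
    then obtain Y Z where YZ: "algebraic_set Y" "algebraic_set Z" "Y \<subset> bloch V" "Z \<subset> bloch V" "bloch V = Y \<union> Z"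
      unfolding reducible_set_def by blast
    have sub: "bloch V \<subseteq> torus_line" by (auto simp: bloch_def torus_line_eq)
    have pick: "\<exists>f. (\<forall>p\<in>Y. eval_laurent f p = 0) \<and> (\<exists>p\<in>bloch V. eval_laurent f p \<noteq> 0)"
      if "algebraic_set Y" "Y \<subset> bloch V" for Y
      using that sub unfolding algebraic_set_def by blast
    obtain f where f: "\<forall>p\<in>Y. eval_laurent f p = 0" "\<exists>p\<in>bloch V. eval_laurent f p \<noteq> 0" using pick[OF YZ(1,3)] by blast
    obtain g where g: "\<forall>p\<in>Z. eval_laurent g p = 0" "\<exists>p\<in>bloch V. eval_laurent g p \<noteq> 0" using pick[OF YZ(2,4)] by blast
    have zero: "eval_laurent f (z, x) = 0 \<or> eval_laurent g (z, x) = 0" if "(z, x) \<in> bloch V" for z x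
      using that f g YZ(5) by auto
    have rem: "\<exists>r. (\<forall>a. laurent_fun (\<lambda>z. coeff (r z) a)) \<and> (\<forall>z. charpoly z V dvd fibre h z \<longleftrightarrow> (\<forall>a. coeff (r z) a = 0))" for h
    proof -
      obtain K where K: "\<And>z b. b \<ge> K \<Longrightarrow> coeff (fibre h z) b = 0" using coeff_fibre_bound[of h] by blast
      have "\<exists>r. (\<forall>a. (\<lambda>z. coeff (r z) a) \<in> {h. laurent_fun h}) \<and> (\<forall>z a. a \<ge> CARD('n) \<longrightarrow> coeff (r z) a = 0) \<and>
          (\<forall>z. charpoly z V dvd fibre h z - r z)"
      proof (rule monic_division_in_ring[OF laurent_fun_ring, of "\<lambda>z. charpoly z V" _ "fibre h" K])
        show "coeff (charpoly z V) CARD('n) = 1" for z using charpoly_monic[of z V] by simp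
        show "coeff (charpoly z V) a = 0" if "a > CARD('n)" for z a
          using that charpoly_monic[of z V] by (simp add: coeff_eq_0)
      qed (use K charpoly_coeff_laurent coeff_fibre in auto)
      then obtain r where r: "\<And>a. laurent_fun (\<lambda>z. coeff (r z) a)" "\<And>z a. a \<ge> CARD('n) \<Longrightarrow> coeff (r z) a = 0"
          "\<And>z. charpoly z V dvd fibre h z - r z" by auto
      have "charpoly z V dvd fibre h z \<longleftrightarrow> r z = 0" for z
        by (rule dvd_iff_remainder_zero[OF r(3) charpoly_monic(2)]) (use r(2) charpoly_monic(1) in auto)
      then show ?thesis using r(1) by (intro exI[of _ r]) (auto simp: poly_eq_iff)
    qed
    obtain r where r: "\<And>a. laurent_fun (\<lambda>z. coeff (r z) a)" "\<And>z. charpoly z V dvd fibre f z \<longleftrightarrow> (\<forall>a. coeff (r z) a = 0)"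
      using rem[of f] by blast
    obtain q where q: "\<And>a. laurent_fun (\<lambda>z. coeff (q z) a)" "\<And>z. charpoly z V dvd fibre g z \<longleftrightarrow> (\<forall>a. coeff (q z) a = 0)"
      using rem[of g] by blast
    have "eventually (\<lambda>z. (\<forall>a. coeff (r z) a = 0) \<or> (\<forall>a. coeff (q z) a = 0)) (nhds 1)"
      using ev eventually_in_torus
    proof eventually_elim
      case (elim z)
      then show ?case using slice_divides[OF bd elim(1,2) zero] r(2) q(2) by blast
    qed
    from laurent_fun_product_zero[OF r(1) q(1) this]
    have "(\<forall>z\<in>torus. charpoly z V dvd fibre f z) \<or> (\<forall>z\<in>torus. charpoly z V dvd fibre g z)"
      using r(2) q(2) by blast
    moreover have "\<forall>p\<in>bloch V. eval_laurent h p = 0" if dv: "\<forall>z\<in>torus. charpoly z V dvd fibre h z" for h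
    proof
      fix p assume "p \<in> bloch V"
      then obtain z x where p: "p = (z, x)" "z \<in> torus" "poly (charpoly z V) x = 0" by (auto simp: bloch_def)
      then obtain k where "fibre h z = charpoly z V * k" using dv by (meson dvdE)
      then have "poly (fibre h z) x = 0" using p by simp
      then show "eval_laurent h p = 0" using p by (simp add: poly_fibre)
    qed
    ultimately show False using f(2) g(2) by blast
  qed
  then show ?thesis using algebraic_bloch bloch_nonempty by (simp add: irreducible_set_def)
qed

lemma generically_irreducible:
  assumes "\<not> (equal_loops \<and> simple_edges \<and> balanced)"
  shows "holds_generically (\<lambda>V. irreducible_set (bloch V))"
proof -
  obtain w M V0 where bd: "bounds w M" and irr: "irreducible (char_det (hat w M 1) M UNIV V0)"
    using irreducible_choice[OF assms] by blast
  \<comment> \<open>The function \<open>P\<close> that detects irreducibility must be polynomial in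
    the potential on the slice \<open>c = 1\<close>, for genericity, and continuous at
    \<open>c = 1\<close>, to reach the neighbouring slices.\<close>
  define R :: "((complex ^ 'n) \<times> (complex ^ 'd) \<Rightarrow> complex) set" where
    "R = {g. polyfun (\<lambda>V. g (V, 1)) \<and> (\<forall>V. isCont (\<lambda>c. g (V, c)) 1)}"
  have R: "function_ring R" unfolding function_ring_def R_def
    by (auto intro: polyfun_const polyfun_add polyfun_mult)
  have Rlm: "(\<lambda>t. laurent_monom (snd t) a) \<in> R" for a
    unfolding R_def laurent_monom_def by (auto intro!: polyfun_const continuous_intros)
  have RV: "(\<lambda>t. fst t $ i) \<in> R" for i
    unfolding R_def by (auto intro: polyfun_nth)
  have hatR: "(\<lambda>t. coeff (hat w M (snd t) i j) b) \<in> R" for i j b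
  proof -
    have "(\<lambda>t. \<Sum>a\<in>C i j. (if nat (int M + dot w a) = b then wt i j a else 0) * laurent_monom (snd t) a) \<in> R"
      by (intro function_ring_sum function_ring_mult function_ring_const R Rlm)
    moreover have "coeff (hat w M c i j) b = (\<Sum>a\<in>C i j. (if nat (int M + dot w a) = b then wt i j a else 0) * laurent_monom c a)" for c
      unfolding hat_def coeff_sum by (intro sum.cong) auto
    ultimately show ?thesis by simp
  qed
  have ent: "coeffs_in R (\<lambda>t. char_entry (hat w M (snd t)) M (fst t) i j)" for i j
  proof -
    have 1: "(\<lambda>t. 0 - coeff (hat w M (snd t) i j) b - (if i = j \<and> b = M then 1 else 0) * fst t $ i) \<in> R" for b
      by (intro function_ring_diff function_ring_mult function_ring_const R hatR RV)
    have 2: "coeff (coeff (char_entry (hat w M (snd t)) M (fst t) i j) a) b =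
       (if a = 0 then 0 - coeff (hat w M (snd t) i j) b - (if i = j \<and> b = M then 1 else 0) * fst t $ i
        else if i = j \<and> a = 1 \<and> b = 0 then 1 else 0)" for t a b
      by (auto simp: char_entry_def coeff_pCons split: nat.splits)
    have "(\<lambda>t. if a = 0 then 0 - coeff (hat w M (snd t) i j) b - (if i = j \<and> b = M then 1 else 0) * fst t $ i
        else if i = j \<and> a = 1 \<and> b = 0 then 1 else 0) \<in> R" for a b
      using 1 function_ring_const[OF R] by (cases "a = 0") auto
    then show ?thesis unfolding coeffs_in_def 2 by blast
  qed
  have "\<exists>P\<in>R. P (V0, 1) \<noteq> 0 \<and> (\<forall>t. P t \<noteq> 0 \<longrightarrow> irreducible (char_det (hat w M (snd t)) M UNIV (fst t)))"
  proof (rule irreducible_open[OF R, where N = "CARD('n)" and K = "CARD('n) * (2 * M)"])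
    show "coeffs_in R (\<lambda>t. char_det (hat w M (snd t)) M UNIV (fst t))"
      unfolding char_det_def by (intro coeffs_in_block_det R ent)
    fix t :: "(complex ^ 'n) \<times> (complex ^ 'd)"
    show "sdeg_le (CARD('n) * (2 * M)) (char_det (hat w M (snd t)) M UNIV (fst t))"
    proof (rule sdeg_le_char_det)
      show "degree (hat w M (snd t) i j) \<le> 2 * M" for i j
        unfolding hat_def
      proof (intro degree_sum_le fin order_trans[OF degree_monom_le])
        fix a assume "a \<in> C i j"
        then have "\<bar>dot w a\<bar> \<le> int M" using bd by (auto simp: bounds_def)
        then show "nat (int M + dot w a) \<le> 2 * M" by linarith
      qed
    qed simp
  qed (use irr char_det_monic in auto)
  then obtain P where P: "P \<in> R" "P (V0, 1) \<noteq> 0"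
    and Pirr: "\<And>V c. P (V, c) \<noteq> 0 \<Longrightarrow> irreducible (char_det (hat w M c) M UNIV V)" by force
  show ?thesis
  proof (rule holds_genericallyI[of "\<lambda>V. P (V, 1)" V0])
    show "polyfun (\<lambda>V. P (V, 1))" using P(1) by (simp add: R_def)
    fix V assume V: "P (V, 1) \<noteq> 0"
    have "isCont (\<lambda>c. P (V, c)) 1" using P(1) by (simp add: R_def)
    then have "((\<lambda>c. P (V, c)) \<longlongrightarrow> P (V, 1)) (nhds 1)"
      unfolding isCont_def by (rule tendsto_at_iff_tendsto_nhds[THEN iffD1])
    then have "eventually (\<lambda>c. P (V, c) \<noteq> 0) (nhds 1)" using V by (rule tendsto_imp_eventually_ne)
    then have "eventually (\<lambda>c. irreducible (char_det (hat w M c) M UNIV V)) (nhds 1)"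
      by (rule eventually_mono) (rule Pirr)
    then show "irreducible_set (bloch V)" by (rule bloch_irreducible_from_slices[OF bd])
  qed (rule P(2))
qed

end

section \<open>The main theorem\<close>

lemma holds_generically_inter:
  assumes "holds_generically P" "holds_generically Q"
  shows "\<exists>V. P V \<and> Q V"
proof -
  have pick: "\<exists>f x. polyfun f \<and> f x \<noteq> 0 \<and> (\<forall>V. f V \<noteq> 0 \<longrightarrow> P V)" if gen: "holds_generically P" for P :: "complex ^ 'n \<Rightarrow> bool"
  proof -
    obtain S where S: "- {V. \<forall>f\<in>S. eval_poly f V = 0} \<noteq> {}" "\<forall>V\<in>- {V. \<forall>f\<in>S. eval_poly f V = 0}. P V"
      using gen unfolding holds_generically_def zariski_open_def by blast
    then obtain f x where "f \<in> S" "eval_poly f x \<noteq> 0" by auto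
    then show ?thesis using S(2) by (intro exI[of _ "eval_poly f"] exI[of _ x]) (auto simp: polyfun_def)
  qed
  obtain f x where f: "polyfun f" "f x \<noteq> 0" "\<And>V. f V \<noteq> 0 \<Longrightarrow> P V" using pick[OF assms(1)] by blast
  obtain g y where g: "polyfun g" "g y \<noteq> 0" "\<And>V. g V \<noteq> 0 \<Longrightarrow> Q V" using pick[OF assms(2)] by blast
  obtain V where "f V \<noteq> 0" "g V \<noteq> 0" using polyfun_common_nonzero[OF f(1,2) g(1,2)] by blast
  then show ?thesis using f g by blast
qed

text \<open>Along a permutation the quotients \<open>g (p i) / g i\<close> multiply to 1.\<close>

lemma block_det_conjugate:
  fixes X :: "'n::finite \<Rightarrow> 'n \<Rightarrow> 'a::field"
  assumes "\<And>i. g i \<noteq> 0"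
  shows "block_det S (\<lambda>i j. X i j * (g j / g i)) = block_det S X"
proof -
  have "(\<Prod>i\<in>S. X i (p i) * (g (p i) / g i)) = (\<Prod>i\<in>S. X i (p i))" if "p permutes S" for p
    using prod.permute[OF that, of g] assms by (simp add: prod.distrib prod_dividef o_def prod_zero_iff)
  then show ?thesis by (simp add: block_det_def)
qed

lemma algebraic_set_regular: "regular h \<Longrightarrow> algebraic_set {p \<in> torus_line. h p = 0}"
proof -
  assume "regular h"
  then obtain f where "\<forall>p\<in>torus_line. eval_laurent f p = h p" by (auto simp: regular_def)
  then have "{p \<in> torus_line. h p = 0} = {p \<in> torus_line. \<forall>f\<in>{f}. eval_laurent f p = 0}" by auto
  then show ?thesis unfolding algebraic_set_def by blast
qed

text \<open>
  The expression below is, up to sign, the sum of the squared differences of the \<open>N\<close> roots of \<open>p\<close>.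
\<close>

lemma two_roots:
  fixes p :: "complex poly"
  assumes p: "lead_coeff p = 1" "degree p = N" "N \<ge> 2"
    and ne: "2 * of_nat N * coeff p (N - 2) - (of_nat N - 1) * coeff p (N - 1) ^ 2 \<noteq> 0"
  obtains x y where "poly p x = 0" "poly p y = 0" "x \<noteq> y"
proof (rule ccontr)
  note ob = that
  assume n: "\<not> thesis"
  have "degree p \<noteq> 0" using p by simp
  then obtain x where x: "poly p x = 0" by (metis fundamental_theorem_of_algebra constant_degree)
  have p0: "p \<noteq> 0" using p by auto
  \<comment> \<open>If \<open>x\<close> is the only root, then \<open>p\<close> is a power of
    \<open>[:-x, 1:]\<close>, and the binomial values of its two subleading coefficients make the
    expression vanish.\<close>
  obtain k q where q: "p = [:-x, 1:] ^ k * q" "\<not> [:-x, 1:] dvd q" using order_decomp[OF p0] by blast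
  have "poly q y \<noteq> 0" for y
  proof
    assume y: "poly q y = 0"
    then have "poly p y = 0" using q(1) by simp
    moreover have "y \<noteq> x" using q(2) y by (metis poly_eq_0_iff_dvd)
    ultimately show False using n ob[of x y] x by blast
  qed
  then have "degree q = 0" by (metis fundamental_theorem_of_algebra constant_degree)
  then obtain a where a: "q = [:a:]" by (rule degree_eq_zeroE)
  have "lead_coeff ([:-x, 1:] ^ k) * a = 1" using p(1) unfolding q(1) lead_coeff_mult a by simp
  then have "a = 1" by (simp add: lead_coeff_power)
  then have pk: "p = [:-x, 1:] ^ k" using q a by (simp add: one_pCons)
  then have k: "k = N" using p(2) by (simp add: degree_linear_power)
  obtain n where N: "N = Suc (Suc n)" using p(3) by (metis add_2_eq_Suc le_Suc_ex)
  have c1: "coeff p (N - 1) = - of_nat N * x" unfolding pk k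
    by (subst coeff_linear_poly_power) (use N in \<open>auto simp: algebra_simps\<close>)
  have c2: "coeff p (N - 2) = of_nat (N choose 2) * x ^ 2" unfolding pk k
    by (subst coeff_linear_poly_power) (use N binomial_symmetric[of 2 N] in \<open>auto simp: numeral_2_eq_2\<close>)
  have "even (N * (N - 1))" using N by auto
  then have "2 * (N choose 2) = N * (N - 1)" unfolding choose_two by (rule dvd_mult_div_cancel)
  then have "of_nat (2 * (N choose 2)) = (of_nat (N * (N - 1)) :: complex)" by (simp only:)
  then have e: "2 * of_nat (N choose 2) = (of_nat N * (of_nat N - 1) :: complex)" using p(3) by (simp add: of_nat_diff)
  have "2 * of_nat N * (of_nat (N choose 2) * x ^ 2) = (2 * of_nat (N choose 2)) * (of_nat N * x ^ 2)" by simp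
  then have c3: "2 * of_nat N * (of_nat (N choose 2) * x ^ 2) = (of_nat N * (of_nat N - 1)) * (of_nat N * x ^ 2)"
    unfolding e .
  have "2 * of_nat N * coeff p (N - 2) - (of_nat N - 1) * coeff p (N - 1) ^ 2 = 0"
    unfolding c1 c2 c3 by (simp add: power2_eq_square algebra_simps)
  then show False using ne by simp
qed

context floquet_graph
begin

text \<open>Genericity only serves to give the constant matrix two different eigenvalues, which
  \<open>disc\<close> expresses as a polynomial condition on the potential.\<close>

lemma generically_reducible:
  assumes I: equal_loops and II: simple_edges and III: balanced
  shows "holds_generically (\<lambda>V. reducible_set (bloch V))"
proof -
  obtain phi where phi: "\<And>i j. adj i j \<Longrightarrow> shift i j = phi j - phi i"
    by (rule potential_exists[of adj shift, OF adj_sym shift_anti[OF II] adj_conn])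
       (use III in \<open>auto simp: balanced_def\<close>)
  define k0 :: 'n where "k0 = undefined"
  define p where "p z = entry z k0 k0" for z
  have entry_diag: "entry z i i = p z" for z i
  proof -
    have "C i i = C k0 k0" "\<forall>a\<in>C i i. wt i i a = wt k0 k0 a"
      using I unfolding equal_loops_def by blast+
    then show ?thesis unfolding entry_def p_def by (intro sum.cong) simp_all
  qed
  define K where "K i j = (if adj i j then wt i j (shift i j) else 0)" for i j
  have entry_off: "entry z i j = K i j * (laurent_monom z (phi j) / laurent_monom z (phi i))" if "i \<noteq> j" "z \<in> torus" for z i j
  proof (cases "adj i j")
    case True
    have "laurent_monom z (phi j) = laurent_monom z (phi j - phi i) * laurent_monom z (phi i)"
      using laurent_monom_add[OF that(2), of "phi j - phi i" "phi i"] by simp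
    moreover have "laurent_monom z (phi i) \<noteq> 0" using that by (simp add: laurent_monom_def torus_def prod_zero_iff)
    ultimately show ?thesis using True by (simp add: entry_def simple_edge_eq[OF II True] K_def phi)
  next
    case False
    then have "C i j = {}" using that by (simp add: adj_def)
    then show ?thesis using False by (simp add: entry_def K_def)
  qed
  \<comment> \<open>The constant matrix is passed to \<open>char_det\<close> with
    \<open>M = 0\<close>, so that the inner variable is a dummy; it is removed by evaluation at
    0.\<close>
  define l where "l i j = [:if i = j then 0 else K i j:]" for i j
  define P where "P V = map_poly (\<lambda>c. poly c 0) (char_det l 0 UNIV V)" for V
  have Pmonic: "degree (P V) = CARD('n)" "lead_coeff (P V) = 1" for V
    unfolding P_def using degree_map_poly_eval_monic[OF char_det_monic(2), of 0 l 0 UNIV V]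
    by (simp_all only: char_det_monic(1))
  have coeP: "coeff (P V) m = coeff (coeff (char_det l 0 UNIV V) m) 0" for V m
    by (simp add: P_def coeff_map_poly poly_0_coeff_0)
  have cp: "poly (charpoly z V) x = poly (P V) (x - p z)" if z: "z \<in> torus" for z V x
  proof -
    define X where "X i j = (if i = j then x - p z - V $ i else - K i j)" for i j
    have nz: "laurent_monom z (phi i) \<noteq> 0" for i using z by (simp add: laurent_monom_def torus_def prod_zero_iff)
    have "poly (charpoly z V) x = block_det UNIV (\<lambda>i j. X i j * (laurent_monom z (phi j) / laurent_monom z (phi i)))"
      unfolding poly_charpoly
      by (rule block_det_cong) (use nz in \<open>auto simp: X_def entry_diag entry_off[OF _ z]\<close>)
    also have "\<dots> = block_det UNIV X" by (rule block_det_conjugate[OF nz])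
    also have "\<dots> = eval2 (char_det l 0 UNIV V) 0 (x - p z)"
      unfolding char_det_def eval2_block_det
      by (rule block_det_cong) (auto simp: X_def char_entry_def l_def poly_monom)
    finally show ?thesis by (simp add: eval2_map_poly P_def)
  qed
  define N where "N = CARD('n)"
  define disc where "disc V = 2 * of_nat N * coeff (P V) (N - 2) - (of_nat N - 1) * coeff (P V) (N - 1) ^ 2" for V
  have disc_poly: "polyfun disc"
  proof -
    have c: "polyfun (\<lambda>V. coeff (P V) m)" for m
      unfolding coeP using coeffs_in_char_det[of l 0 UNIV] by (simp add: coeffs_in_def)
    have "polyfun (\<lambda>V. 2 * of_nat N * coeff (P V) (N - 2) + (- (of_nat N - 1)) * (coeff (P V) (N - 1) * coeff (P V) (N - 1)))"
      by (intro polyfun_add polyfun_mult polyfun_const c)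
    moreover have "disc = (\<lambda>V. 2 * of_nat N * coeff (P V) (N - 2) + (- (of_nat N - 1)) * (coeff (P V) (N - 1) * coeff (P V) (N - 1)))"
      by (rule ext) (simp add: disc_def power2_eq_square algebra_simps)
    ultimately show ?thesis by (simp only:)
  qed
  have N2: "N \<ge> 2" using card2 by (simp add: N_def)
  \<comment> \<open>When only the potential \<open>t\<close> at \<open>k0\<close> varies,
    \<open>disc\<close> is a quadratic polynomial in \<open>t\<close> with leading coefficient
    \<open>1 - N\<close>.\<close>
  have "\<exists>V. disc V \<noteq> 0"
  proof -
    define F where "F = char_det l 0 (UNIV - {k0}) 0"
    define Q where "Q = block_det UNIV (char_entry0 l 0 k0 0)"
    have F: "coeff F (N - 1) = 1"
      using char_det_monic[of l 0 "UNIV - {k0}" 0] by (simp add: F_def N_def card_Diff_subset)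
    have upd: "char_det l 0 UNIV (update 0 k0 t) = [:- [:t:], 1:] * F + Q" for t
      using char_det_update[of k0 UNIV l 0 0 t] by (simp add: F_def Q_def l_def monom_0)
    have "degree Q < CARD('n) - 1" unfolding Q_def
      by (rule block_det_zero_diagonal_degree[where k = k0, OF _ _ _ char_entry0_degree])
         (use card2 in \<open>auto simp: char_entry0_def\<close>)
    then have Q: "coeff Q (N - 1) = 0" by (simp add: N_def coeff_eq_0)
    \<comment> \<open>For \<open>N = 2\<close> there is no coefficient of index
      \<open>N - 3\<close>; truncated subtraction would pick the one of index 0.\<close>
    define a b c where "a = coeff (coeff F (N - 2)) 0" and "b = (if N = 2 then 0 else coeff (coeff F (N - 3)) 0)"
      and "c = coeff (coeff Q (N - 2)) 0"
    have n1: "N - 1 = Suc (N - 2)" using N2 by simp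
    have c1: "coeff (P (update 0 k0 t)) (N - 1) = a - t" for t
      unfolding coeP upd using F Q unfolding n1 by (simp add: a_def)
    have c2: "coeff (P (update 0 k0 t)) (N - 2) = b + c - t * a" for t
    proof (cases "N - 2")
      case 0
      then show ?thesis unfolding coeP upd using N2 by (simp add: a_def b_def c_def)
    next
      case (Suc n)
      then have "N = Suc (Suc (Suc n))" using N2 by linarith
      then show ?thesis unfolding coeP upd by (simp add: a_def b_def c_def)
    qed
    define D where "D = [:2 * of_nat N * (b + c) - (of_nat N - 1) * a ^ 2, - 2 * of_nat N * a + 2 * (of_nat N - 1) * a, - (of_nat N - 1):]"
    have "N \<noteq> 1" using N2 by simp
    then have "of_nat N \<noteq> (1::complex)" by (metis of_nat_1 of_nat_eq_iff)
    then have "D \<noteq> 0" by (simp add: D_def)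
    then obtain t where "poly D t \<noteq> 0" using poly_all_0_iff_0 by blast
    moreover have "disc (update 0 k0 t) = poly D t"
      unfolding disc_def c1 c2 D_def by (simp add: algebra_simps power2_eq_square)
    ultimately show ?thesis by metis
  qed
  then obtain V0 where V0: "disc V0 \<noteq> 0" by blast
  have "reducible_set (bloch V)" if V: "disc V \<noteq> 0" for V
  proof -
    obtain x y where xy: "poly (P V) x = 0" "poly (P V) y = 0" "x \<noteq> y"
      using two_roots[OF Pmonic(2) Pmonic(1)] V N2 unfolding disc_def N_def by metis
    have "P V \<noteq> 0" using Pmonic(2)[of V] by auto
    then obtain k q where q: "P V = [:-x, 1:] ^ k * q" "\<not> [:-x, 1:] dvd q" using order_decomp by blast
    have qx: "poly q x \<noteq> 0" using q(2) by (simp add: poly_eq_0_iff_dvd)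
    have k: "k \<noteq> 0" using xy(1) q(1) qx by (cases k) auto
    have R: "function_ring {h. regular h}" by (rule regular_ring)
    define arg where "arg = (\<lambda>t :: (complex ^ 'd) \<times> complex. snd t - p (fst t))"
    have "(\<lambda>t. snd t - (\<Sum>a\<in>C k0 k0. wt k0 k0 a * laurent_monom (fst t) a)) \<in> {h. regular h}"
    proof (intro function_ring_diff[OF R] function_ring_sum[OF R] function_ring_mult[OF R] function_ring_const[OF R])
      show "(\<lambda>t :: (complex ^ 'd) \<times> complex. snd t) \<in> {h. regular h}"
        using regular_monomial[of 1 0 1] by (simp add: laurent_monom_zero case_prod_unfold)
      show "(\<lambda>t :: (complex ^ 'd) \<times> complex. laurent_monom (fst t) a) \<in> {h. regular h}" for a
        using regular_monomial[of 1 a 0] by (simp add: case_prod_unfold)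
    qed
    then have arg: "arg \<in> {h. regular h}" by (simp add: arg_def p_def entry_def)
    have pow: "(\<lambda>t. arg t ^ m) \<in> {h. regular h}" for m
      by (induction m) (auto intro: function_ring_mult[OF R, of arg, simplified] function_ring_const[OF R, simplified] arg[simplified])
    have polyarg: "regular (\<lambda>t. poly g (arg t))" for g
    proof -
      have "(\<lambda>t. \<Sum>i\<le>degree g. coeff g i * arg t ^ i) \<in> {h. regular h}"
        by (intro function_ring_sum[OF R] function_ring_mult[OF R] function_ring_const[OF R] pow)
      then show ?thesis by (simp add: poly_altdef)
    qed
    define Y where "Y = {t \<in> torus_line. poly [:-x, 1:] (arg t) = 0}"
    define Z where "Z = {t \<in> torus_line. poly q (arg t) = 0}"
    have B: "bloch V = {t \<in> torus_line. poly (P V) (arg t) = 0}"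
      by (auto simp: bloch_def torus_line_eq cp arg_def)
    have "bloch V = Y \<union> Z" unfolding B Y_def Z_def q(1) using k by auto
    \<comment> \<open>One point over \<open>z = 1\<close> for each of the two eigenvalues shows that
      both parts are proper.\<close>
    moreover have "(1, p 1 + x) \<in> bloch V - Z" "(1, p 1 + y) \<in> bloch V - Y"
      using xy qx by (auto simp: B Y_def Z_def torus_line_eq one_in_torus arg_def)
    moreover have "algebraic_set Y" "algebraic_set Z" unfolding Y_def Z_def
      by (intro algebraic_set_regular polyarg)+
    ultimately show ?thesis unfolding reducible_set_def by blast
  qed
  then show ?thesis by (rule holds_genericallyI[OF disc_poly V0])
qed

text \<open>Cycles are closed walks; conversely \<open>induced_cycle_exists\<close> extracts a cycle
  with nonzero sum from a closed walk with nonzero sum.\<close>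

lemma balanced_iff:
  assumes simple_edges
  shows "balanced \<longleftrightarrow> (\<forall>c. is_cycle {(i, j). i \<noteq> j \<and> C i j \<noteq> {}} c \<longrightarrow>
     (\<Sum>j<length c. shift (c ! j) (c ! (Suc j mod length c))) = 0)"
proof
  assume b: balanced
  show "\<forall>c. is_cycle {(i, j). i \<noteq> j \<and> C i j \<noteq> {}} c \<longrightarrow> (\<Sum>j<length c. shift (c ! j) (c ! (Suc j mod length c))) = 0"
  proof (intro allI impI)
    fix c assume c: "is_cycle {(i, j). i \<noteq> j \<and> C i j \<noteq> {}} c"
    then have ne: "c \<noteq> []" by (auto simp: is_cycle_def)
    have "closed_walk adj c" unfolding closed_walk_def successively_append_hd[OF ne]
      using c ne by (simp add: is_cycle_def adj_def)
    then have "walk_sum shift (c @ [hd c]) = 0" using b by (simp add: balanced_def)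
    then show "(\<Sum>j<length c. shift (c ! j) (c ! (Suc j mod length c))) = 0" by (simp only: walk_sum_append_hd[OF ne])
  qed
next
  assume z: "\<forall>c. is_cycle {(i, j). i \<noteq> j \<and> C i j \<noteq> {}} c \<longrightarrow> (\<Sum>j<length c. shift (c ! j) (c ! (Suc j mod length c))) = 0"
  show balanced
  proof (rule ccontr)
    assume "\<not> balanced"
    then obtain xs where xs: "closed_walk adj xs" "walk_sum shift (xs @ [hd xs]) \<noteq> 0" by (auto simp: balanced_def)
    obtain c where c: "3 \<le> length c" "distinct c"
      "\<And>j. j < length c \<Longrightarrow> adj (c ! j) (c ! (Suc j mod length c))"
      "(\<Sum>j<length c. shift (c ! j) (c ! (Suc j mod length c))) \<noteq> 0"
      by (rule induced_cycle_exists[OF adj_irrefl adj_sym shift_anti[OF assms] xs], assumption, assumption,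
          rule that, assumption+)
    then have "is_cycle {(i, j). i \<noteq> j \<and> C i j \<noteq> {}} c" by (auto simp: is_cycle_def adj_def)
    then show False using z c(4) by blast
  qed
qed

end

section \<open>Finiteness and symmetry of the connection sets of a periodic graph\<close>

lemma (in periodic_graph) conn_finite:
  assumes "u i \<in> verts" "u j \<in> verts"
  shows "finite (conn act edges u i j)"
proof -
  \<comment> \<open>Freeness of the action makes different translates of \<open>u j\<close>
    different neighbours of \<open>u i\<close>.\<close>
  have "inj_on (\<lambda>a. act a (u j)) (conn act edges u i j)"
  proof (rule inj_onI)
    fix a b assume "act a (u j) = act b (u j)"
    then have "act (- b + a) (u j) = act (- b + b) (u j)" using assms by (simp only: act_add)
    then have "act (- b + a) (u j) = u j" using assms by (simp add: act_zero)
    then have "- b + a = 0" using assms act_free by blast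
    then show "a = b" by simp
  qed
  moreover have "(\<lambda>a. act a (u j)) ` conn act edges u i j \<subseteq> {y. (u i, y) \<in> edges}"
    by (auto simp: conn_def)
  ultimately show ?thesis using locally_finite[OF assms(1)] by (meson finite_imageD finite_subset)
qed

lemma (in periodic_graph) conn_uminus:
  assumes "u i \<in> verts" "u j \<in> verts" "a \<in> conn act edges u i j"
  shows "- a \<in> conn act edges u j i"
proof -
  have "(u i, act a (u j)) \<in> edges" using assms by (simp add: conn_def)
  then have "(act a (u j), u i) \<in> edges" using edges_sym by (rule symD[rotated])
  then have "(act (- a) (act a (u j)), act (- a) (u i)) \<in> edges" by (rule act_edges)
  then have "(act (- a + a) (u j), act (- a) (u i)) \<in> edges" using assms by (simp only: act_add)
  then show ?thesis using assms by (simp add: act_zero conn_def)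
qed

lemma (in periodic_graph) weight_uminus:
  assumes "u i \<in> verts" "u j \<in> verts" "a \<in> conn act edges u i j" and E: "periodic_edge_weight act edges E"
  shows "E (u j, act (- a) (u i)) = E (u i, act a (u j))"
proof -
  have e: "(u j, act (- a) (u i)) \<in> edges" using conn_uminus[OF assms(1-3)] by (simp add: conn_def)
  have "E (u j, act (- a) (u i)) = E (act a (u j), act a (act (- a) (u i)))"
    using E e unfolding periodic_edge_weight_def by blast
  also have "act a (act (- a) (u i)) = u i" using assms by (simp add: act_zero flip: act_add)
  also have "E (act a (u j), u i) = E (u i, act a (u j))"
    using E assms(3) unfolding periodic_edge_weight_def conn_def by fastforce
  finally show ?thesis .
qed

theorem corollary1p2:
  fixes act :: "int ^ 'd::finite \<Rightarrow> 'v \<Rightarrow> 'v"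
    and verts :: "'v set"
    and edges :: "('v \<times> 'v) set"
    and E :: "'v \<times> 'v \<Rightarrow> complex"
    and u :: "'n::finite \<Rightarrow> 'v"
  assumes "periodic_graph act verts edges"
    and "no_self_loops edges"
    and "periodic_edge_weight act edges E"
    and "nowhere_zero_weight edges E"
    and "fundamental_domain act verts u"
    and "CARD('n) \<ge> 2"
    and "quotient_connected act edges u"
  shows "(holds_generically (\<lambda>V. reducible_set (bloch_variety act edges E u V)) \<longleftrightarrow>
            condition_I act edges E u \<and> condition_II act edges u \<and> condition_III act edges u)
       \<and> (\<not> (condition_I act edges E u \<and> condition_II act edges u \<and> condition_III act edges u) \<longrightarrow>
            holds_generically (\<lambda>V. irreducible_set (bloch_variety act edges E u V)))"
proof -
  interpret periodic_graph act verts edges by (rule assms(1))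
  have uv: "u i \<in> verts" for i using assms(5) by (auto simp: fundamental_domain_def)
  define C where "C = conn act edges u"
  define wt where "wt i j a = E (u i, act a (u j))" for i j a
  interpret floquet_graph C wt
  proof
    fix i j :: 'n and a
    show "finite (C i j)" unfolding C_def by (rule conn_finite[where u = u, OF uv uv])
    show "- a \<in> C j i" if "a \<in> C i j" using that unfolding C_def by (rule conn_uminus[where u = u, OF uv uv])
    show "wt j i (- a) = wt i j a" if "a \<in> C i j"
      unfolding wt_def by (rule weight_uminus[where u = u, OF uv uv _ assms(3)]) (use that C_def in simp)
    show "wt i j a \<noteq> 0" if "a \<in> C i j"
      using that assms(4) by (auto simp: wt_def C_def conn_def nowhere_zero_weight_def)
    show "0 \<notin> C i i"
      using assms(2) uv by (auto simp: C_def conn_def no_self_loops_def act_zero)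
    show "(i, j) \<in> {(i, j). i \<noteq> j \<and> C i j \<noteq> {}}\<^sup>*"
      using assms(7) by (simp add: quotient_connected_def quotient_edges_def C_def)
  qed (rule assms(6))
  have var: "bloch_variety act edges E u V = bloch V" for V
  proof -
    have fe: "floquet_entry act edges E u i j z = entry z i j" for i j z
      unfolding floquet_entry_def entry_def unfolding C_def wt_def ..
    have "dispersion act edges E u z V x = poly (charpoly z V) x" for z x
      unfolding dispersion_def det_eq_block_det poly_charpoly
      by (rule block_det_cong) (simp add: mat_def floquet_matrix_def fe)
    then show ?thesis by (auto simp: bloch_variety_def bloch_def torus_line_eq)
  qed
  have 1: "condition_I act edges E u \<longleftrightarrow> equal_loops"
  proof
    assume "condition_I act edges E u"
    then show equal_loops unfolding condition_I_def equal_loops_def unfolding C_def wt_def by blast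
  next
    assume e: equal_loops
    \<comment> \<open>\<open>undefined\<close> stands for an arbitrary vertex, all loop sets being
      equal.\<close>
    then have "conn act edges u i i = C undefined undefined" for i
      unfolding equal_loops_def unfolding C_def by blast
    moreover have "E (u i, act a (u i)) = E (u j, act a (u j))" if "a \<in> C undefined undefined" for a i j
    proof -
      have "a \<in> C i i" using e that unfolding equal_loops_def by blast
      then show ?thesis using e unfolding equal_loops_def unfolding wt_def by blast
    qed
    ultimately show "condition_I act edges E u" unfolding condition_I_def
      by (intro exI[of _ "C undefined undefined"]) (simp add: fin)
  qed
  have 2: "condition_II act edges u \<longleftrightarrow> simple_edges"
    unfolding condition_II_def simple_edges_def using fin unfolding C_def by simp
  have 3: "condition_III act edges u \<longleftrightarrow> balanced" if simple_edges
    unfolding balanced_iff[OF that] condition_III_def quotient_edges_def shift_def conn_elem_def unfolding C_def ..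
  have good: "condition_I act edges E u \<and> condition_II act edges u \<and> condition_III act edges u \<longleftrightarrow>
      equal_loops \<and> simple_edges \<and> balanced"
    using 1 2 3 by blast
  show ?thesis unfolding var good
  proof (intro conjI iffI impI)
    assume red: "holds_generically (\<lambda>V. reducible_set (bloch V))"
    have "equal_loops \<and> simple_edges \<and> balanced"
    proof (rule ccontr)
      assume "\<not> ?thesis"
      then have "holds_generically (\<lambda>V. irreducible_set (bloch V))" by (rule generically_irreducible)
      \<comment> \<open>Two generic properties hold together at some potential, but
        \<open>irreducible_set\<close> excludes \<open>reducible_set\<close>.\<close>
      from holds_generically_inter[OF red this] show False by (auto simp: irreducible_set_def)
    qed
    then show equal_loops simple_edges balanced by blast+
  next
    assume "equal_loops \<and> simple_edges \<and> balanced"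
    then show "holds_generically (\<lambda>V. reducible_set (bloch V))" using generically_reducible by blast
  next
    assume "\<not> (equal_loops \<and> simple_edges \<and> balanced)"
    then show "holds_generically (\<lambda>V. irreducible_set (bloch V))" by (rule generically_irreducible)
  qed
qed

end
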